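(* Let $d,K\ge 1$ be integers. Let $G:(0,1)\to\mathbb{R}$ be a diffeomorphism (a differentiable, strictly increasing bijection) with inverse $F=G^{-1}$, such that: (i) for every $B>0$ there is a constant $C>0$ with $|G(u)|\le C\min(u,1-u)^{-B}$ and $|G'(u)|\le C\min(u,1-u)^{-1-B}$ for all $u\in(0,1)$; $\log F$ is concave on $\mathbb{R}$; and $F(x)+F(-x)=1$ for all $x\in\mathbb{R}$. For $1\le k\le K$ let $L^k\in\mathbb{R}^{d\times d}$ be lower triangular with positive diagonal entries and with rows normalized so that $\sum_{j=1}^d|L^k_{ij}|=1$ for every $i$, and let $T^k(\mathbf{z})=(T^k_1(z_1),\dots,T^k_d(z_d))$, where each $T=T^k_i:\mathbb{R}\to\mathbb{R}$ is an increasing diffeomorphism of $\mathbb{R}$ with $d$ continuous derivatives $T^{(1)},\dots,T^{(d)}$ (and $T^{(0)}=T$) such that: (ii) for every $B>0$ there is a constant $C$ with $|T^{(m)}(z)|\le C\min(F(z),1-F(z))^{-B}$ for all $m=0,1,\dots,d$ and all $z\in\mathbb{R}$; and (iii) there exist $B_1>0$, $C_1>0$ with $\min(F(z),1-F(z))^{-1}\le C_1\min\big(F(T^{-1}(z)),1-F(T^{-1}(z))\big)^{-B_1}$ for all $z\in\mathbb{R}$. Put $\tau^k(\mathbf{x})=T^k(L^k\mathbf{x})$ and $\tau=\tau^K\circ\cdots\circ\tau^1\circ G:(0,1)^d\to\mathbb{R}^d$, where $G$ is applied componentwise. Let $f:\mathbb{R}^d\to\mathbb{R}$ have continuous partial derivatives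 $\partial^{\boldsymbol\lambda}f$ for all $\boldsymbol\lambda\in\mathbb{N}_0^d$ with $|\boldsymbol\lambda|\le d$, and suppose that for all such $\boldsymbol\lambda$ and every $B>0$ there is $C>0$ with $$|\partial^{\boldsymbol\lambda}f(\mathbf{x})|\le C\prod_{j=1}^d\min(F(x_j),1-F(x_j))^{-B}\quad\text{for all }\mathbf{x}\in\mathbb{R}^d.$$ Then $h=f\circ\tau:(0,1)^d\to\mathbb{R}$ satisfies the boundary growth condition: all mixed partial derivatives $\partial^v h$, $v\subseteq\{1,\dots,d\}$, exist, and for every $B>0$ there is a constant $C>0$ such that $$|\partial^v h(\mathbf{u})|\le C\prod_{j=1}^d[\min(u_j,1-u_j)]^{-B-\mathbf{1}\{j\in v\}}\quad\text{for all }v\subseteq\{1,\dots,d\},\ \mathbf{u}\in(0,1)^d.$$ Consequently, the scrambled net estimator $\hat\mu_n=\frac1n\sum_{i=1}^n h(\mathbf{u}_i)$ of $\mu=\int_{(0,1)^d}h(\mathbf{u})\,d\mathbf{u}$ has root mean square error $\big(\mathbb{E}[(\hat\mu_n-\mu)^2]\big)^{1/2}=O(n^{-1+\epsilon})$ as $n\to\infty$, for every $\epsilon>0$.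
   Context: For a multi-index $\boldsymbol\lambda\in\mathbb{N}_0^d$, $|\boldsymbol\lambda|=\sum_j\lambda_j$ and $\partial^{\boldsymbol\lambda}$ means differentiating $\lambda_j$ times in the variable $x_j$ for each $j$. For $v\subseteq\{1,\dots,d\}$, $\partial^v h$ is the partial derivative of $h$ taken once with respect to each variable $u_j$, $j\in v$, with $\partial^{\emptyset}h=h$. $\mathbf{1}\{j\in v\}$ equals $1$ if $j\in v$ and $0$ otherwise. The function $F=G^{-1}$ is the CDF of a distribution on $\mathbb{R}$. Scrambled net estimator: fix an integer base $b\ge2$ and a quality parameter $t\ge0$. A $(t,m,d)$-net in base $b$ is a set of $n=b^m$ points in $[0,1)^d$ such that every box $\prod_{j=1}^d[a_jb^{-k_j},(a_j+1)b^{-k_j})$ with integers $k_j\ge0$, $0\le a_j<b^{k_j}$ and $\sum_jk_j=m-t$ contains exactly $b^t$ of the points. Owen's nested uniform scrambling randomizes the net by applying, independently for each coordinate, uniformly random permutations of $\{0,\dots,b-1\}$ to the base-$b$ digits, where the permutation applied to the $k$-th digit depends on the preceding $k-1$ (unscrambled) digits and all permutations are independent. After scrambling each point is uniformly distributed on the unit cube and the point set is almost surely still a $(t,m,d)$-net. The points $\mathbf{u}_1,\dots,\mathbf{u}_n$ are the points of such a scrambled (digital) $(t,m,d)$-net, $n=b^m$, with $b,t,d$ fixed and $m\to\infty$; the expectation is over the scrambling. The constant in $O(\cdot)$ may depend on everything except $n$. *)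

theory Defs
  imports "HOL-Probability.Probability" "HOL-Combinatorics.Permutations"
    "HOL-Library.Landau_Symbols"
begin

section \<open>Partial derivatives\<close>

text \<open>The coordinate set \<open>{1,\<dots>,d}\<close> is a finite linearly ordered type \<open>'d\<close>, so \<open>d = CARD('d)\<close>;
  the order is needed for lower triangular matrices.\<close>

definition has_partial :: "'d::finite \<Rightarrow> (real^'d \<Rightarrow> real) \<Rightarrow> real^'d \<Rightarrow> bool" where
  "has_partial j h x \<longleftrightarrow> (\<lambda>s. h (x + s *\<^sub>R axis j 1)) field_differentiable (at 0)"

definition partial :: "'d::finite \<Rightarrow> (real^'d \<Rightarrow> real) \<Rightarrow> real^'d \<Rightarrow> real" where
  "partial j h x = deriv (\<lambda>s. h (x + s *\<^sub>R axis j 1)) 0"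

text \<open>Iterated partial derivatives along a list of variables (the last entry is applied first).
  On an open set \<open>S\<close> they depend only on the values of \<open>h\<close> on \<open>S\<close>.\<close>

primrec partials :: "'d::finite list \<Rightarrow> (real^'d \<Rightarrow> real) \<Rightarrow> real^'d \<Rightarrow> real" where
  "partials [] h = h"
| "partials (j # js) h = partial j (partials js h)"

primrec partials_exist_on :: "(real^'d) set \<Rightarrow> 'd::finite list \<Rightarrow> (real^'d \<Rightarrow> real) \<Rightarrow> bool" where
  "partials_exist_on S [] h \<longleftrightarrow> True"
| "partials_exist_on S (j # js) h \<longleftrightarrow>
     partials_exist_on S js h \<and> (\<forall>x\<in>S. has_partial j (partials js h) x)"

text \<open>For the multi-index derivative the order of differentiation is fixed by the order of \<open>'d\<close>.
  Wherever it is used, either all orders agree by Schwarz's theorem (\<open>cont_partials\<close>) or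
  agreement of all orders is stated (\<open>mixed_partials_exist_on\<close>).\<close>

definition multi_partial ::
    "('d \<Rightarrow> nat) \<Rightarrow> (real^'d::{finite,linorder} \<Rightarrow> real) \<Rightarrow>
      real^'d::{finite,linorder} \<Rightarrow> real" where
  "multi_partial l h =
     partials (concat (map (\<lambda>j. replicate (l j) j) (sorted_list_of_set UNIV))) h"

definition mixed_partial ::
    "'d set \<Rightarrow> (real^'d::{finite,linorder} \<Rightarrow> real) \<Rightarrow>
      real^'d::{finite,linorder} \<Rightarrow> real" where
  "mixed_partial v h = multi_partial (\<lambda>j. of_bool (j \<in> v)) h"

definition cont_partials :: "nat \<Rightarrow> (real^'d::finite \<Rightarrow> real) \<Rightarrow> bool" where
  "cont_partials n f \<longleftrightarrow>
     (\<forall>js. length js \<le> n \<longrightarrow> partials_exist_on UNIV js f \<and> continuous_on UNIV (partials js f))"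

definition mixed_partials_exist_on ::
    "(real^'d::{finite,linorder}) set \<Rightarrow> (real^'d::{finite,linorder} \<Rightarrow> real) \<Rightarrow> bool" where
  "mixed_partials_exist_on S h \<longleftrightarrow>
     (\<forall>js. distinct js \<longrightarrow> partials_exist_on S js h \<and>
            (\<forall>u\<in>S. partials js h u = mixed_partial (set js) h u))"

definition cont_derivs :: "nat \<Rightarrow> (real \<Rightarrow> real) \<Rightarrow> bool" where
  "cont_derivs n T \<longleftrightarrow>
     (\<forall>m<n. \<forall>z. (deriv ^^ m) T field_differentiable (at z)) \<and>
     (\<forall>m\<le>n. continuous_on UNIV ((deriv ^^ m) T))"

definition increasing_diffeo_on :: "real set \<Rightarrow> (real \<Rightarrow> real) \<Rightarrow> bool" where
  "increasing_diffeo_on S g \<longleftrightarrow>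
     bij_betw g S UNIV \<and> strict_mono_on S g \<and> (\<forall>u\<in>S. g field_differentiable (at u))"


section \<open>The transformation and the boundary growth condition\<close>

definition open_cube :: "(real^'d::finite) set" where
  "open_cube = {u. \<forall>j. 0 < u $ j \<and> u $ j < 1}"

definition layer :: "real^'d^'d \<Rightarrow> ('d \<Rightarrow> real \<Rightarrow> real) \<Rightarrow> real^'d::finite \<Rightarrow> real^'d" where
  "layer A S x = (\<chi> i. S i ((A *v x) $ i))"

primrec layers ::
    "(nat \<Rightarrow> real^'d^'d) \<Rightarrow> (nat \<Rightarrow> 'd \<Rightarrow> real \<Rightarrow> real) \<Rightarrow> nat \<Rightarrow> real^'d::finite \<Rightarrow> real^'d" where
  "layers L T 0 = id"
| "layers L T (Suc k) = layer (L (Suc k)) (T (Suc k)) \<circ> layers L T k"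

definition flow ::
    "(real \<Rightarrow> real) \<Rightarrow> (nat \<Rightarrow> real^'d^'d) \<Rightarrow> (nat \<Rightarrow> 'd \<Rightarrow> real \<Rightarrow> real) \<Rightarrow> nat \<Rightarrow>
      real^'d::finite \<Rightarrow> real^'d" where
  "flow G L T K u = layers L T K (\<chi> j. G (u $ j))"

definition boundary_growth :: "(real^'d::{finite,linorder} \<Rightarrow> real) \<Rightarrow> bool" where
  "boundary_growth h \<longleftrightarrow>
     mixed_partials_exist_on open_cube h \<and>
     (\<forall>B>0. \<exists>C>0. \<forall>v. \<forall>u\<in>open_cube.
        \<bar>mixed_partial v h u\<bar> \<le>
          C * (\<Prod>j\<in>UNIV. min (u $ j) (1 - u $ j) powr (- B - of_bool (j \<in> v))))"


section \<open>Scrambled nets\<close>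

text \<open>A net is an indexed family, so coinciding points count with multiplicity.\<close>

definition tmd_net :: "nat \<Rightarrow> nat \<Rightarrow> nat \<Rightarrow> (nat \<Rightarrow> real^'d::finite) \<Rightarrow> bool" where
  "tmd_net b t m x \<longleftrightarrow>
     (\<forall>i<b ^ m. \<forall>j. 0 \<le> x i $ j \<and> x i $ j < 1) \<and>
     (\<forall>k a :: 'd \<Rightarrow> nat. (\<Sum>j\<in>UNIV. k j) + t = m \<and> (\<forall>j. a j < b ^ k j) \<longrightarrow>
        card {i. i < b ^ m \<and>
          (\<forall>j. real (a j) / real b ^ k j \<le> x i $ j \<and> x i $ j < (real (a j) + 1) / real b ^ k j)}
        = b ^ t)"

text \<open>Digit \<open>k\<close> (counted from 0) of \<open>x \<in> [0,1)\<close> is the coefficient of \<open>b\<close> to the power \<open>-(k+1)\<close>.\<close>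

definition digit :: "nat \<Rightarrow> real \<Rightarrow> nat \<Rightarrow> nat" where
  "digit b x k = nat (\<lfloor>real b ^ Suc k * x\<rfloor> mod int b)"

text \<open>\<open>p (j, w)\<close> is the permutation applied in coordinate \<open>j\<close> to the digit that follows the
  unscrambled digits \<open>w\<close>.\<close>

definition scramble ::
    "nat \<Rightarrow> ('d \<times> nat list \<Rightarrow> nat \<Rightarrow> nat) \<Rightarrow> real^'d::finite \<Rightarrow> real^'d" where
  "scramble b p x =
     (\<chi> j. \<Sum>k. real (p (j, map (digit b (x $ j)) [0..<k]) (digit b (x $ j) k)) / real b ^ Suc k)"

definition digit_perms :: "nat \<Rightarrow> (nat \<Rightarrow> nat) set" where
  "digit_perms b = {p. p permutes {..<b}}"

definition nested_uniform_scrambling ::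
    "nat \<Rightarrow> 'w measure \<Rightarrow> ('d::finite \<times> nat list \<Rightarrow> 'w \<Rightarrow> nat \<Rightarrow> nat) \<Rightarrow> bool" where
  "nested_uniform_scrambling b M X \<longleftrightarrow>
     prob_space M \<and>
     prob_space.indep_vars M (\<lambda>_. count_space (digit_perms b)) X (UNIV \<times> lists {..<b}) \<and>
     (\<forall>i \<in> UNIV \<times> lists {..<b}.
        distr M (count_space (digit_perms b)) (X i) = uniform_count_measure (digit_perms b))"

definition net_estimator ::
    "nat \<Rightarrow> nat \<Rightarrow> (nat \<Rightarrow> real^'d) \<Rightarrow> ('d \<times> nat list \<Rightarrow> 'w \<Rightarrow> nat \<Rightarrow> nat) \<Rightarrow>
      (real^'d::finite \<Rightarrow> real) \<Rightarrow> 'w \<Rightarrow> real" where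
  "net_estimator b m x X h \<omega> =
     (\<Sum>i<b ^ m. h (scramble b (\<lambda>jw. X jw \<omega>) (x i))) / real (b ^ m)"

end

theory Submission
  imports Defs "HOL-Real_Asymp.Real_Asymp"
begin

text \<open>The proof has an analytic and a probabilistic half.

  \<^bold>\<open>Boundary growth.\<close> Call a smooth function subpolynomial if it and its partial derivatives up to order \<open>d\<close> are
  bounded by every negative power of the tail weight \<open>\<mu> = min F (1 - F)\<close> of the coordinates. This class is stable under
  composition with a layer (\<open>subpoly_partials_layer\<close>): derivatives of the composition are sums of products of
  subpolynomial functions, the tail condition on the activation turns \<open>\<mu>\<close> of its value into a power of \<open>\<mu>\<close>, and log-concavity
  and symmetry of \<open>F\<close> bound \<open>\<mu>\<close> at a normalised linear combination from below by the product of the \<open>\<mu> (x\<^sub>j)\<close>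
  (\<open>tail_weight_linear\<close>). Peeling off the layers, \<open>h\<close> is a subpolynomial function of \<open>(G (u\<^sub>1), \<dots>, G (u\<^sub>d))\<close>. As
  \<open>F (G u) = u\<close>, the weight becomes the distance to the boundary, and each differentiation costs one factor \<open>G'\<close>
  (\<open>boundary_growth_compose\<close>).

  \<^bold>\<open>Rate.\<close> Replace in each coordinate \<open>j\<close> the scrambled digits from position \<open>k\<^sub>j\<close> on by an independent uniform remainder and
  average over it. Telescoping over the levels \<open>k\<^sub>j\<close> in every coordinate writes the value of \<open>h\<close> at a scrambled
  point as a finite sum of details indexed by level vectors \<open>\<kappa>\<close> (\<open>sum_detail\<close>), as in the nested analysis of
  variance for scrambled nets. Three facts finish the proof.
  \<^item> If \<open>\<bar>\<kappa>\<bar> \<le> m - t\<close> and \<open>\<kappa> \<noteq> 0\<close>, the details sum to zero over the net, because the net is balanced on the cells involved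
    (\<open>sum_detail_eq_0\<close>); \<open>\<kappa> = 0\<close> gives the integral.
  \<^item> For \<open>\<bar>\<kappa>\<bar> > m - t\<close>, the details at two points are uncorrelated unless the points share the cell of level \<open>\<kappa> - 1\<close>
    (\<open>detail_orthogonal\<close>), and such a cell has at most \<open>b ^ (t + d)\<close> points. The sum over \<open>n\<close> points therefore has a
    second moment of order \<open>n\<close> times that of one detail.
  \<^item> A detail is an average of mixed differences of \<open>h\<close> at distance \<open>b ^ (1 - \<kappa>\<^sub>j)\<close> in coordinate \<open>j\<close>. Boundary growth bounds such
    differences by a constant times \<open>b powr (- \<theta> * \<bar>\<kappa>\<bar>)\<close> and square-integrable weights, for every \<open>\<theta> < 1/2\<close>
    (\<open>boundary_growth_imp_hoelder_growth\<close>, \<open>detail_second_moment\<close>).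

  With \<open>(m + 2) ^ d\<close> levels at most, the mean square error is of order \<open>n powr (- 1 - 2 * \<theta>)\<close> up to powers of \<open>m\<close>, that is
  of \<open>log n\<close>.\<close>

section \<open>Calculus of iterated partial derivatives\<close>

lemma has_partial_DERIV:
  assumes "has_partial j h (x :: real^'n)"
  shows "((\<lambda>s. h (x + s *\<^sub>R axis j 1)) has_field_derivative partial j h x) (at 0)"
  using assms unfolding has_partial_def partial_def
  by (simp add: DERIV_deriv_iff_field_differentiable)

lemma DERIV_has_partial:
  assumes "((\<lambda>s. h ((x :: real^'n) + s *\<^sub>R axis j 1)) has_field_derivative D) (at 0)"
  shows "has_partial j h x" "partial j h x = D"
  using assms unfolding has_partial_def partial_def
  by (auto simp: field_differentiable_def DERIV_imp_deriv)

lemma DERIV_along_axis: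
  assumes "has_partial j h (y + s *\<^sub>R axis j 1 :: real^'n)"
  shows "((\<lambda>s. h (y + s *\<^sub>R axis j 1)) has_field_derivative partial j h (y + s *\<^sub>R axis j 1)) (at s)"
proof -
  define g where "g r = h ((y + s *\<^sub>R axis j 1) + r *\<^sub>R axis j 1)" for r
  have g: "(g has_field_derivative partial j h (y + s *\<^sub>R axis j 1)) (at (s - s))"
    using has_partial_DERIV[OF assms] by (simp add: g_def[abs_def])
  have "((\<lambda>r. g (r - s)) has_field_derivative partial j h (y + s *\<^sub>R axis j 1) * 1) (at s)"
    by (rule DERIV_chain2[of g _ "\<lambda>r. r - s", OF g]) (auto intro!: derivative_eq_intros)
  then have "((\<lambda>r. h ((y + s *\<^sub>R axis j 1) + (r - s) *\<^sub>R axis j 1)) has_field_derivative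
      partial j h (y + s *\<^sub>R axis j 1)) (at s)"
    by (simp add: g_def[abs_def])
  then show ?thesis by (simp add: algebra_simps)
qed

lemma partial_cong_open:
  fixes h g :: "real^'n \<Rightarrow> real"
  assumes S: "open S" "x \<in> S" and eq: "\<And>y. y \<in> S \<Longrightarrow> h y = g y" and g: "has_partial j g x"
  shows "has_partial j h x" "partial j h x = partial j g x"
proof -
  have "open ((\<lambda>s. x + s *\<^sub>R axis j 1 :: real^'n) -` S)"
    by (rule open_vimage[OF S(1)]) (intro continuous_intros)
  moreover have "0 \<in> (\<lambda>s. x + s *\<^sub>R axis j 1 :: real^'n) -` S" using S by simp
  ultimately have "((\<lambda>s. h (x + s *\<^sub>R axis j 1)) has_field_derivative partial j g x) (at 0)"
    by (intro has_field_derivative_transform_within_open[OF has_partial_DERIV[OF g]]) (auto simp: eq)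
  then show "has_partial j h x" "partial j h x = partial j g x"
    by (simp_all add: DERIV_has_partial)
qed

lemma partials_append: "partials (js @ ks) h = partials js (partials ks h)"
  by (induction js) auto

lemma partials_exist_on_append:
  "partials_exist_on S (js @ ks) h \<longleftrightarrow> partials_exist_on S ks h \<and> partials_exist_on S js (partials ks h)"
  by (induction js) (auto simp: partials_append)

text \<open>Changing the coordinates one at a time, the mean value inequality controls each step; continuity
  of the partial derivatives at \<open>x\<close> makes the intermediate point irrelevant.\<close>

lemma continuous_partials_imp_has_derivative:
  fixes f :: "real^'n \<Rightarrow> real"
  assumes ex: "\<And>j y. has_partial j f y" and cont: "\<And>j. isCont (partial j f) x"
  shows "(f has_derivative (\<lambda>v. \<Sum>j\<in>UNIV. v $ j * partial j f x)) (at x)"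
proof -
  define P where "P J v = (\<Sum>j\<in>J. (v $ j) *\<^sub>R axis j 1 :: real^'n)" for J and v :: "real^'n"
  have P_nth: "P J v $ i = (if i \<in> J then v $ i else 0)" if "finite J" for J v i
    using that by (auto simp: P_def axis_def if_distrib if_distribR sum.delta' cong: if_cong)
  have step: "\<exists>\<delta>>0. \<forall>v. norm v < \<delta> \<longrightarrow>
      \<bar>f (x + P J v) - f x - (\<Sum>j\<in>J. v $ j * partial j f x)\<bar> \<le> e * norm v"
    if "finite J" "e > 0" for J e using that
  proof (induction J arbitrary: e)
    case empty then show ?case by (auto simp: P_def intro!: exI[of _ 1])
  next
    case (insert i J)
    from insert.IH[of "e/2"] insert.prems obtain \<delta>1 where \<delta>1: "\<delta>1 > 0"
      "\<And>v. norm v < \<delta>1 \<Longrightarrow> \<bar>f (x + P J v) - f x - (\<Sum>j\<in>J. v $ j * partial j f x)\<bar> \<le> e/2 * norm v"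
      by auto
    from cont[of i, unfolded continuous_at_eps_delta, rule_format, of "e/2"] insert.prems
    obtain \<delta>2 where \<delta>2: "\<delta>2 > 0" "\<And>y. dist y x < \<delta>2 \<Longrightarrow> dist (partial i f y) (partial i f x) < e/2"
      by auto
    show ?case
    proof (intro exI[of _ "min \<delta>1 \<delta>2"] conjI allI impI)
      fix v :: "real^'n" assume v: "norm v < min \<delta>1 \<delta>2"
      define \<phi> where "\<phi> s = f (x + P J v + s *\<^sub>R axis i 1) - s * partial i f x" for s
      have bd: "norm (\<phi> (v $ i) - \<phi> 0) \<le> e/2 * norm (v $ i - 0)"
      proof (rule field_differentiable_bound[where S = "closed_segment 0 (v $ i)"])
        fix s assume s: "s \<in> closed_segment 0 (v $ i)"
        then have s': "\<bar>s\<bar> \<le> \<bar>v $ i\<bar>" by (auto simp: closed_segment_eq_real_ivl split: if_splits)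
        show "(\<phi> has_field_derivative (partial i f (x + P J v + s *\<^sub>R axis i 1) - partial i f x))
            (at s within closed_segment 0 (v $ i))"
          unfolding \<phi>_def
          by (rule has_field_derivative_at_within)
             (auto intro!: derivative_eq_intros DERIV_along_axis ex)
        have "norm (P J v + s *\<^sub>R axis i 1) \<le> norm v"
          by (rule norm_le_componentwise_cart)
             (use s' insert.hyps in \<open>auto simp: P_nth axis_def\<close>)
        then have "dist (x + P J v + s *\<^sub>R axis i 1) x < \<delta>2"
          using v by (simp add: dist_norm algebra_simps)
        from \<delta>2(2)[OF this] show "norm (partial i f (x + P J v + s *\<^sub>R axis i 1) - partial i f x) \<le> e/2"
          by (simp add: dist_real_def)
      qed auto
      have "norm (v $ i) \<le> norm v" by (simp add: component_le_norm_cart)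
      then have "e/2 * norm (v $ i) \<le> e/2 * norm v" using insert.prems by (intro mult_left_mono) auto
      with bd have bd': "\<bar>\<phi> (v $ i) - \<phi> 0\<bar> \<le> e/2 * norm v" by simp
      have eq: "f (x + P (insert i J) v) - f x - (\<Sum>j\<in>insert i J. v $ j * partial j f x) =
          (\<phi> (v $ i) - \<phi> 0) + (f (x + P J v) - f x - (\<Sum>j\<in>J. v $ j * partial j f x))"
        using insert.hyps by (simp add: \<phi>_def P_def algebra_simps)
      show "\<bar>f (x + P (insert i J) v) - f x - (\<Sum>j\<in>insert i J. v $ j * partial j f x)\<bar> \<le> e * norm v"
        unfolding eq using bd' \<delta>1(2)[of v] v by (auto simp: abs_if split: if_splits)
    qed (use \<delta>1 \<delta>2 in auto)
  qed
  have PU: "P UNIV v = v" for v by (simp add: vec_eq_iff P_nth)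
  show ?thesis
    unfolding has_derivative_at_alt
  proof (intro conjI allI impI)
    show "bounded_linear (\<lambda>v. \<Sum>j\<in>UNIV. v $ j * partial j f x)"
      by (intro bounded_linear_sum bounded_linear_mult_const bounded_linear_vec_nth)
    fix e :: real assume "e > 0"
    from step[of UNIV, OF _ this] obtain \<delta> where \<delta>: "\<delta> > 0"
      "\<And>v. norm v < \<delta> \<Longrightarrow> \<bar>f (x + v) - f x - (\<Sum>j\<in>UNIV. v $ j * partial j f x)\<bar> \<le> e * norm v"
      by (auto simp: PU)
    show "\<exists>d>0. \<forall>y. norm (y - x) < d \<longrightarrow>
        norm (f y - f x - (\<Sum>j\<in>UNIV. (y - x) $ j * partial j f x)) \<le> e * norm (y - x)"
      using \<delta>(1) \<delta>(2)[of "_ - x"] by (intro exI[of _ \<delta>]) auto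
  qed
qed

text \<open>The second difference is compared with its bilinear prediction by the mean value inequality,
  first in the direction of \<open>i\<close> and then, for the resulting difference of first derivatives, in the
  direction of \<open>j\<close>.\<close>

lemma second_difference_approx:
  fixes f :: "real^'n \<Rightarrow> real"
  assumes ex: "\<And>y. has_partial i f y" "\<And>y. has_partial j (partial i f) y"
    and cont: "isCont (partial j (partial i f)) x" and e: "e > 0"
  shows "\<exists>\<delta>>0. \<forall>s t. \<bar>s\<bar> < \<delta> \<longrightarrow> \<bar>t\<bar> < \<delta> \<longrightarrow>
    \<bar>f (x + s *\<^sub>R axis i 1 + t *\<^sub>R axis j 1) - f (x + s *\<^sub>R axis i 1) - f (x + t *\<^sub>R axis j 1) + f x
      - s * t * partial j (partial i f) x\<bar> \<le> e * \<bar>t\<bar> * \<bar>s\<bar>"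
proof -
  define A where "A = partial j (partial i f) x"
  from cont[unfolded continuous_at_eps_delta, rule_format, OF e]
  obtain \<delta> where \<delta>: "\<delta> > 0" "\<And>y. dist y x < \<delta> \<Longrightarrow> dist (partial j (partial i f) y) A < e"
    by (auto simp: A_def)
  show ?thesis
  proof (intro exI[of _ "\<delta>/2"] conjI allI impI)
    fix s t :: real assume st: "\<bar>s\<bar> < \<delta>/2" "\<bar>t\<bar> < \<delta>/2"
    define \<phi> where "\<phi> s = f (x + t *\<^sub>R axis j 1 + s *\<^sub>R axis i 1) - f (x + s *\<^sub>R axis i 1) - s * t * A" for s
    have "norm (\<phi> s - \<phi> 0) \<le> e * \<bar>t\<bar> * norm (s - 0)"
    proof (rule field_differentiable_bound[where S = "closed_segment 0 s"])
      fix s' assume s': "s' \<in> closed_segment 0 s"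
      then have s'': "\<bar>s'\<bar> < \<delta>/2" using st by (auto simp: closed_segment_eq_real_ivl split: if_splits)
      show "(\<phi> has_field_derivative (partial i f (x + t *\<^sub>R axis j 1 + s' *\<^sub>R axis i 1) -
          partial i f (x + s' *\<^sub>R axis i 1) - t * A)) (at s' within closed_segment 0 s)"
        unfolding \<phi>_def
        by (rule has_field_derivative_at_within) (auto intro!: derivative_eq_intros DERIV_along_axis ex)
      define \<psi> where "\<psi> t = partial i f (x + s' *\<^sub>R axis i 1 + t *\<^sub>R axis j 1) - t * A" for t
      have "norm (\<psi> t - \<psi> 0) \<le> e * norm (t - 0)"
      proof (rule field_differentiable_bound[where S = "closed_segment 0 t"])
        fix t' assume t': "t' \<in> closed_segment 0 t"
        then have t'': "\<bar>t'\<bar> < \<delta>/2" using st by (auto simp: closed_segment_eq_real_ivl split: if_splits)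
        show "(\<psi> has_field_derivative (partial j (partial i f) (x + s' *\<^sub>R axis i 1 + t' *\<^sub>R axis j 1) - A))
            (at t' within closed_segment 0 t)"
          unfolding \<psi>_def
          by (rule has_field_derivative_at_within) (auto intro!: derivative_eq_intros DERIV_along_axis ex)
        have "norm (s' *\<^sub>R axis i 1 + t' *\<^sub>R axis j 1 :: real^'n) \<le> \<bar>s'\<bar> + \<bar>t'\<bar>"
          by (rule order_trans[OF norm_triangle_ineq]) simp
        also have "\<dots> < \<delta>" using s'' t'' by simp
        finally have "dist (x + s' *\<^sub>R axis i 1 + t' *\<^sub>R axis j 1) x < \<delta>"
          by (simp add: dist_norm add.assoc)
        from \<delta>(2)[OF this] show "norm (partial j (partial i f) (x + s' *\<^sub>R axis i 1 + t' *\<^sub>R axis j 1) - A) \<le> e"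
          by (simp add: dist_real_def)
      qed auto
      then show "norm (partial i f (x + t *\<^sub>R axis j 1 + s' *\<^sub>R axis i 1) -
          partial i f (x + s' *\<^sub>R axis i 1) - t * A) \<le> e * \<bar>t\<bar>"
        by (simp add: \<psi>_def algebra_simps)
    qed auto
    then show "\<bar>f (x + s *\<^sub>R axis i 1 + t *\<^sub>R axis j 1) - f (x + s *\<^sub>R axis i 1) - f (x + t *\<^sub>R axis j 1) + f x
      - s * t * partial j (partial i f) x\<bar> \<le> e * \<bar>t\<bar> * \<bar>s\<bar>"
      by (simp add: \<phi>_def A_def algebra_simps)
  qed (use \<delta> in auto)
qed

text \<open>Schwarz's theorem: both mixed derivatives are the limit of the same second difference.\<close>

lemma partial_commute:
  fixes f :: "real^'n \<Rightarrow> real"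
  assumes ex: "\<And>y. has_partial i f y" "\<And>y. has_partial j f y"
      "\<And>y. has_partial j (partial i f) y" "\<And>y. has_partial i (partial j f) y"
    and cont: "isCont (partial j (partial i f)) x" "isCont (partial i (partial j f)) x"
  shows "partial j (partial i f) x = partial i (partial j f) x"
proof (rule ccontr)
  let ?A = "partial j (partial i f) x" and ?B = "partial i (partial j f) x"
  assume ne: "?A \<noteq> ?B"
  define e where "e = \<bar>?A - ?B\<bar> / 4"
  have e: "e > 0" using ne by (simp add: e_def)
  obtain \<delta>1 where \<delta>1: "\<delta>1 > 0" "\<And>s t. \<bar>s\<bar> < \<delta>1 \<Longrightarrow> \<bar>t\<bar> < \<delta>1 \<Longrightarrow>
    \<bar>f (x + s *\<^sub>R axis i 1 + t *\<^sub>R axis j 1) - f (x + s *\<^sub>R axis i 1) - f (x + t *\<^sub>R axis j 1) + f x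
      - s * t * ?A\<bar> \<le> e * \<bar>t\<bar> * \<bar>s\<bar>"
    using second_difference_approx[OF ex(1,3) cont(1) e] by blast
  obtain \<delta>2 where \<delta>2: "\<delta>2 > 0" "\<And>s t. \<bar>s\<bar> < \<delta>2 \<Longrightarrow> \<bar>t\<bar> < \<delta>2 \<Longrightarrow>
    \<bar>f (x + s *\<^sub>R axis j 1 + t *\<^sub>R axis i 1) - f (x + s *\<^sub>R axis j 1) - f (x + t *\<^sub>R axis i 1) + f x
      - s * t * ?B\<bar> \<le> e * \<bar>t\<bar> * \<bar>s\<bar>"
    using second_difference_approx[OF ex(2,4) cont(2) e] by blast
  define r where "r = min \<delta>1 \<delta>2 / 2"
  have r: "r > 0" "\<bar>r\<bar> < \<delta>1" "\<bar>r\<bar> < \<delta>2" using \<delta>1 \<delta>2 by (auto simp: r_def)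
  define S where "S = f (x + r *\<^sub>R axis i 1 + r *\<^sub>R axis j 1) - f (x + r *\<^sub>R axis i 1) - f (x + r *\<^sub>R axis j 1) + f x"
  have "f (x + r *\<^sub>R axis j 1 + r *\<^sub>R axis i 1) - f (x + r *\<^sub>R axis j 1) - f (x + r *\<^sub>R axis i 1) + f x = S"
    by (simp add: S_def algebra_simps)
  with \<delta>1(2)[OF r(2) r(2)] \<delta>2(2)[OF r(3) r(3)]
  have "\<bar>S - r * r * ?A\<bar> \<le> e * r * r" "\<bar>S - r * r * ?B\<bar> \<le> e * r * r"
    using r by (simp_all add: S_def)
  then have "\<bar>r * r * ?A - r * r * ?B\<bar> \<le> 2 * (e * r * r)" by linarith
  moreover have "r * r * ?A - r * r * ?B = (r * r) * (?A - ?B)" by (simp add: algebra_simps)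
  ultimately have "(r * r) * \<bar>?A - ?B\<bar> \<le> (r * r) * (2 * e)"
    using r by (simp add: abs_mult mult_ac)
  then have "\<bar>?A - ?B\<bar> \<le> 2 * e" using r by (simp add: mult_le_cancel_left_pos)
  then show False using e by (simp add: e_def)
qed

lemma cont_partialsD:
  assumes "cont_partials n f" "length js \<le> n"
  shows "partials_exist_on UNIV js f" "continuous_on UNIV (partials js f)"
  using assms by (auto simp: cont_partials_def)

lemma partials_swap:
  assumes "cont_partials n f" "length js + 2 \<le> n"
  shows "partials (i # j # js) f = partials (j # i # js) f"
proof
  fix x
  have ex: "partials_exist_on UNIV (a # b # js) f" "continuous_on UNIV (partials (a # b # js) f)" for a b
    using cont_partialsD[OF assms(1), of "a # b # js"] assms(2) by auto
  show "partials (i # j # js) f x = partials (j # i # js) f x"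
    using ex[of i j] ex[of j i] ex(2)[of i j, unfolded continuous_on_eq_continuous_at[OF open_UNIV]]
      ex(2)[of j i, unfolded continuous_on_eq_continuous_at[OF open_UNIV]]
    by (auto intro!: partial_commute)
qed

lemma partials_move_front:
  assumes "cont_partials n f" "length (xs @ a # ys) \<le> n"
  shows "partials (xs @ a # ys) f = partials (a # xs @ ys) f"
  using assms(2)
proof (induction xs)
  case (Cons x xs)
  have "partials (x # xs @ a # ys) f = partials (x # a # xs @ ys) f"
    using Cons by simp
  also have "\<dots> = partials (a # x # xs @ ys) f"
    using Cons.prems by (intro partials_swap[OF assms(1)]) auto
  finally show ?case by simp
qed auto

text \<open>Bringing the matching entry to the front by adjacent swaps reduces the length by one.\<close>

lemma partials_perm:
  assumes "cont_partials n f" "length js \<le> n" "mset js = mset ks"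
  shows "partials js f = partials ks f"
  using assms(2,3)
proof (induction js arbitrary: ks)
  case (Cons a js)
  then obtain xs ys where ks: "ks = xs @ a # ys"
    by (metis list.set_intros(1) mset_eq_setD split_list)
  have "mset js = mset (xs @ ys)" using Cons.prems by (simp add: ks)
  then have "partials js f = partials (xs @ ys) f" using Cons by auto
  moreover have "length ks \<le> n" using Cons.prems by (metis size_mset)
  ultimately show ?case
    using partials_move_front[OF assms(1), of xs a ys] by (simp add: ks)
qed auto

lemma count_mset_multi_index:
  "mset (concat (map (\<lambda>j. replicate (l j) j) (sorted_list_of_set (UNIV :: 'n::{finite,linorder} set)))) =
    (\<Sum>j\<in>UNIV. replicate_mset (l j) j)"
proof -
  have *: "mset (concat (map (\<lambda>j. replicate (l j) j) xs)) = (\<Sum>j\<leftarrow>xs. replicate_mset (l j) j)" for xs :: "'n list"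
    by (induction xs) auto
  have "(\<Sum>j\<leftarrow>sorted_list_of_set UNIV. replicate_mset (l j) j) =
      (\<Sum>j\<in>set (sorted_list_of_set (UNIV :: 'n set)). replicate_mset (l j) j)"
    by (rule sum_list_distinct_conv_sum_set) simp
  then show ?thesis by (simp add: *)
qed

lemma partials_eq_multi_partial:
  fixes f :: "real^'n::{finite,linorder} \<Rightarrow> real"
  assumes "cont_partials n f" "length js \<le> n"
  shows "partials js f = multi_partial (count (mset js)) f"
  unfolding multi_partial_def
proof (rule partials_perm[OF assms])
  show "mset js = mset (concat (map (\<lambda>j. replicate (count (mset js) j) j) (sorted_list_of_set UNIV)))"
    unfolding count_mset_multi_index
    by (rule multiset_eqI) (simp add: count_sum if_distrib sum.delta cong: if_cong)
qed

section \<open>Smooth functions of subpolynomial growth\<close>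

text \<open>The weight \<open>\<mu>\<close> will be the smaller of the two tails of \<open>F\<close>. Demanding the bound for every
  exponent \<open>B > 0\<close> is what makes the class an algebra and stable under replacing \<open>\<mu>\<close> by a power of itself.\<close>

definition subpoly :: "(real \<Rightarrow> real) \<Rightarrow> (real^'n \<Rightarrow> real) \<Rightarrow> bool" where
  "subpoly \<mu> g \<longleftrightarrow> continuous_on UNIV g \<and>
     (\<forall>B>0. \<exists>C>0. \<forall>x. \<bar>g x\<bar> \<le> C * (\<Prod>j\<in>UNIV. \<mu> (x $ j) powr (- B)))"

text \<open>The recursion peels off one derivative instead of speaking of multi-indices. The product and
  chain rules then yield closure under products and composition by plain inductions.\<close>

primrec subpoly_partials :: "(real \<Rightarrow> real) \<Rightarrow> nat \<Rightarrow> (real^'n \<Rightarrow> real) \<Rightarrow> bool" where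
  "subpoly_partials \<mu> 0 g \<longleftrightarrow> subpoly \<mu> g"
| "subpoly_partials \<mu> (Suc n) g \<longleftrightarrow> subpoly \<mu> g \<and>
     (\<forall>j. (\<forall>x. has_partial j g x) \<and> subpoly_partials \<mu> n (partial j g))"

lemma subpolyI:
  assumes "continuous_on UNIV g"
    and "\<And>B. B > 0 \<Longrightarrow> \<exists>C. \<forall>x. \<bar>g x\<bar> \<le> C * (\<Prod>j\<in>UNIV. \<mu> (x $ j) powr (- B))"
  shows "subpoly \<mu> g"
  unfolding subpoly_def
proof (intro conjI allI impI)
  fix B :: real assume "B > 0"
  with assms(2) obtain C where C: "\<And>x. \<bar>g x\<bar> \<le> C * (\<Prod>j\<in>UNIV. \<mu> (x $ j) powr (- B))" by blast
  have "\<bar>g x\<bar> \<le> (\<bar>C\<bar> + 1) * (\<Prod>j\<in>UNIV. \<mu> (x $ j) powr (- B))" for x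
    by (rule order_trans[OF C]) (auto intro!: mult_right_mono prod_nonneg)
  then show "\<exists>C>0. \<forall>x. \<bar>g x\<bar> \<le> C * (\<Prod>j\<in>UNIV. \<mu> (x $ j) powr (- B))"
    by (intro exI[of _ "\<bar>C\<bar> + 1"]) auto
qed (rule assms)

lemma subpoly_add:
  assumes "subpoly \<mu> f" "subpoly \<mu> g"
  shows "subpoly \<mu> (\<lambda>x. f x + g x)"
proof (rule subpolyI)
  show "continuous_on UNIV (\<lambda>x. f x + g x)"
    using assms by (auto simp: subpoly_def intro!: continuous_on_add)
  fix B :: real assume "B > 0"
  with assms obtain C D where
    C: "\<And>x. \<bar>f x\<bar> \<le> C * (\<Prod>j\<in>UNIV. \<mu> (x $ j) powr (- B))" and
    D: "\<And>x. \<bar>g x\<bar> \<le> D * (\<Prod>j\<in>UNIV. \<mu> (x $ j) powr (- B))"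
    unfolding subpoly_def by blast
  have "\<bar>f x + g x\<bar> \<le> (C + D) * (\<Prod>j\<in>UNIV. \<mu> (x $ j) powr (- B))" for x
    using C[of x] D[of x] by (simp add: algebra_simps)
  then show "\<exists>C. \<forall>x. \<bar>f x + g x\<bar> \<le> C * (\<Prod>j\<in>UNIV. \<mu> (x $ j) powr (- B))" by blast
qed

lemma subpoly_mult:
  assumes "subpoly \<mu> f" "subpoly \<mu> g"
  shows "subpoly \<mu> (\<lambda>x. f x * g x)"
proof (rule subpolyI)
  show "continuous_on UNIV (\<lambda>x. f x * g x)"
    using assms by (auto simp: subpoly_def intro!: continuous_on_mult)
  fix B :: real assume "B > 0"
  \<comment> \<open>each factor is given half of the exponent\<close>
  then have "B / 2 > 0" by simp
  with assms obtain C D where pos: "C > 0" "D > 0" and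
    C: "\<And>x. \<bar>f x\<bar> \<le> C * (\<Prod>j\<in>UNIV. \<mu> (x $ j) powr (- (B/2)))" and
    D: "\<And>x. \<bar>g x\<bar> \<le> D * (\<Prod>j\<in>UNIV. \<mu> (x $ j) powr (- (B/2)))"
    unfolding subpoly_def by meson
  have "\<bar>f x * g x\<bar> \<le> (C * D) * (\<Prod>j\<in>UNIV. \<mu> (x $ j) powr (- B))" for x
  proof -
    let ?p = "\<Prod>j\<in>UNIV. \<mu> (x $ j) powr (- (B/2))"
    have "\<bar>f x * g x\<bar> \<le> (C * ?p) * (D * ?p)"
      unfolding abs_mult by (rule mult_mono[OF C D]) (use pos in \<open>auto intro!: mult_nonneg_nonneg prod_nonneg\<close>)
    also have "\<dots> = (C * D) * (?p * ?p)" by simp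
    also have "?p * ?p = (\<Prod>j\<in>UNIV. \<mu> (x $ j) powr (- B))"
      by (simp add: prod.distrib[symmetric] powr_add[symmetric])
    finally show ?thesis .
  qed
  then show "\<exists>C. \<forall>x. \<bar>f x * g x\<bar> \<le> C * (\<Prod>j\<in>UNIV. \<mu> (x $ j) powr (- B))" by blast
qed

lemma prod_powr_ge_1:
  fixes \<mu> :: "real \<Rightarrow> real"
  assumes "\<And>z. 0 < \<mu> z \<and> \<mu> z \<le> 1" "B \<ge> 0" "finite J"
  shows "1 \<le> (\<Prod>j\<in>J. \<mu> (x $ j) powr (- B))"
proof (rule prod_ge_1)
  fix j
  have "\<mu> (x $ j) powr B \<le> 1" "\<mu> (x $ j) powr B > 0"
    using assms(1)[of "x $ j"] assms(2) by (auto intro!: powr_le1)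
  then show "1 \<le> \<mu> (x $ j) powr (- B)" by (simp add: powr_minus one_le_inverse_iff)
qed

lemma subpoly_const:
  assumes "\<And>z. 0 < \<mu> z \<and> \<mu> z \<le> 1"
  shows "subpoly \<mu> (\<lambda>x :: real^'n. c)"
proof (rule subpolyI)
  fix B :: real assume B: "B > 0"
  have "\<bar>c\<bar> * 1 \<le> \<bar>c\<bar> * (\<Prod>j\<in>UNIV. \<mu> (x $ j) powr (- B))" for x :: "real^'n"
    using prod_powr_ge_1[of \<mu> B UNIV x] assms B by (intro mult_left_mono) auto
  then show "\<exists>C. \<forall>x :: real^'n. \<bar>c\<bar> \<le> C * (\<Prod>j\<in>UNIV. \<mu> (x $ j) powr (- B))"
    by (intro exI[of _ "\<bar>c\<bar>"]) simp
qed auto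

lemma subpoly_partials_imp_subpoly: "subpoly_partials \<mu> n g \<Longrightarrow> subpoly \<mu> g"
  by (cases n) auto

lemma subpoly_partials_Suc: "subpoly_partials \<mu> (Suc n) g \<Longrightarrow> subpoly_partials \<mu> n g"
proof (induction n arbitrary: g)
  case (Suc n)
  then show ?case unfolding subpoly_partials.simps(2)[of \<mu> "Suc n"] by auto
qed auto

lemma partial_add:
  assumes "has_partial j f x" "has_partial j g x"
  shows "has_partial j (\<lambda>x. f x + g x) x" "partial j (\<lambda>x. f x + g x) x = partial j f x + partial j g x"
  by (rule DERIV_has_partial, rule DERIV_add[OF has_partial_DERIV has_partial_DERIV]; fact)+

lemma partial_mult:
  assumes "has_partial j f x" "has_partial j g x"
  shows "has_partial j (\<lambda>x. f x * g x) x"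
    "partial j (\<lambda>x. f x * g x) x = partial j f x * g x + partial j g x * f x"
  using DERIV_mult[OF has_partial_DERIV[OF assms(1)] has_partial_DERIV[OF assms(2)]]
  by (auto dest: DERIV_has_partial)

lemma partial_const: "has_partial j (\<lambda>x. c) x" "partial j (\<lambda>x. c) x = 0"
  using DERIV_has_partial[of "\<lambda>x. c" x j 0] by auto

lemma subpoly_partials_const:
  assumes "\<And>z. 0 < \<mu> z \<and> \<mu> z \<le> 1"
  shows "subpoly_partials \<mu> n (\<lambda>x. c)"
proof (induction n arbitrary: c)
  case (Suc n)
  have *: "partial j (\<lambda>x. c) = (\<lambda>x. 0)" for j by (auto simp: partial_const)
  show ?case using Suc by (auto simp: subpoly_const[OF assms] partial_const *)
qed (auto simp: subpoly_const[OF assms])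

lemma subpoly_partials_add:
  "subpoly_partials \<mu> n f \<Longrightarrow> subpoly_partials \<mu> n g \<Longrightarrow> subpoly_partials \<mu> n (\<lambda>x. f x + g x)"
proof (induction n arbitrary: f g)
  case (Suc n)
  have "partial j (\<lambda>x. f x + g x) = (\<lambda>x. partial j f x + partial j g x)" for j
    using Suc.prems by (auto simp: partial_add)
  then show ?case using Suc by (auto simp: subpoly_add partial_add)
qed (auto simp: subpoly_add)

lemma subpoly_partials_mult:
  "subpoly_partials \<mu> n f \<Longrightarrow> subpoly_partials \<mu> n g \<Longrightarrow> subpoly_partials \<mu> n (\<lambda>x. f x * g x)"
proof (induction n arbitrary: f g)
  case (Suc n)
  have "partial j (\<lambda>x. f x * g x) = (\<lambda>x. partial j f x * g x + partial j g x * f x)" for j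
    using Suc.prems by (auto simp: partial_mult)
  then show ?case
    using Suc.prems Suc.prems[THEN subpoly_partials_Suc]
    by (auto simp: subpoly_mult partial_mult intro!: subpoly_partials_add Suc.IH)
qed (auto simp: subpoly_mult)

lemma subpoly_partials_sum:
  assumes "\<And>z. 0 < \<mu> z \<and> \<mu> z \<le> 1" "finite J" "\<And>i. i \<in> J \<Longrightarrow> subpoly_partials \<mu> n (f i)"
  shows "subpoly_partials \<mu> n (\<lambda>x. \<Sum>i\<in>J. f i x)"
  using assms(2,3)
  by (induction J) (auto intro!: subpoly_partials_const assms(1) subpoly_partials_add)

text \<open>Differentiating along one axis moves all coordinates of \<open>\<Phi>\<close>, so \<open>g\<close> has to be Frechet differentiable;
  this is where continuity of its partial derivatives enters.\<close>

lemma chain_rule_partial: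
  fixes \<Phi> :: "real^'n \<Rightarrow> real^'n"
  assumes g: "\<And>i y. has_partial i g y" "\<And>i. isCont (partial i g) (\<Phi> x)"
    and \<Phi>: "\<And>i. has_partial j (\<lambda>x. \<Phi> x $ i) x"
  shows "has_partial j (g \<circ> \<Phi>) x"
    "partial j (g \<circ> \<Phi>) x = (\<Sum>i\<in>UNIV. partial i g (\<Phi> x) * partial j (\<lambda>x. \<Phi> x $ i) x)"
proof -
  let ?D = "\<lambda>i. partial j (\<lambda>x. \<Phi> x $ i) x"
  have "((\<lambda>s. \<Phi> (x + s *\<^sub>R axis j 1)) has_derivative (\<lambda>s. \<chi> i. s * ?D i)) (at 0)"
  proof (subst has_derivative_componentwise_within, rule ballI)
    fix e :: "real^'n" assume "e \<in> Basis"
    then obtain i where e: "e = axis i 1" by (auto simp: Basis_vec_def)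
    show "((\<lambda>s. \<Phi> (x + s *\<^sub>R axis j 1) \<bullet> e) has_derivative (\<lambda>s. (\<chi> i. s * ?D i) \<bullet> e)) (at 0)"
      using has_partial_DERIV[OF \<Phi>[of i]]
      by (simp add: e inner_axis has_field_derivative_def mult_commute_abs)
  qed
  moreover have "(g has_derivative (\<lambda>v. \<Sum>i\<in>UNIV. v $ i * partial i g (\<Phi> x))) (at (\<Phi> (x + 0 *\<^sub>R axis j 1)))"
    using continuous_partials_imp_has_derivative[of g "\<Phi> x"] g by simp
  ultimately have "((\<lambda>s. g (\<Phi> (x + s *\<^sub>R axis j 1))) has_derivative
      (\<lambda>s. \<Sum>i\<in>UNIV. (\<chi> i. s * ?D i) $ i * partial i g (\<Phi> x))) (at 0)"
    by (drule_tac diff_chain_at) (auto simp: o_def)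
  moreover have "(\<lambda>s. \<Sum>i\<in>UNIV. (\<chi> i. s * ?D i) $ i * partial i g (\<Phi> x)) =
      (*) (\<Sum>i\<in>UNIV. partial i g (\<Phi> x) * ?D i)"
    by (auto simp: sum_distrib_left sum_distrib_right algebra_simps)
  ultimately have "((\<lambda>s. (g \<circ> \<Phi>) (x + s *\<^sub>R axis j 1)) has_field_derivative
      (\<Sum>i\<in>UNIV. partial i g (\<Phi> x) * ?D i)) (at 0)"
    by (simp add: has_field_derivative_def o_def)
  then show "has_partial j (g \<circ> \<Phi>) x"
    "partial j (g \<circ> \<Phi>) x = (\<Sum>i\<in>UNIV. partial i g (\<Phi> x) * ?D i)"
    by (simp_all add: DERIV_has_partial)
qed

text \<open>One differentiation turns \<open>g \<circ> \<Phi>\<close> into a sum of products whose factors are again a composition with \<open>\<Phi>\<close>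
  and a derivative of a component of \<open>\<Phi>\<close>, both with one derivative less.\<close>

lemma subpoly_partials_compose:
  fixes \<Phi> :: "real^'n \<Rightarrow> real^'n"
  assumes \<mu>: "\<And>z. 0 < \<mu> z \<and> \<mu> z \<le> 1"
    and \<Phi>: "\<And>g :: real^'n \<Rightarrow> real. subpoly \<mu> g \<Longrightarrow> subpoly \<mu> (g \<circ> \<Phi>)"
  shows "(\<And>i. subpoly_partials \<mu> n (\<lambda>x. \<Phi> x $ i)) \<Longrightarrow> subpoly_partials \<mu> n g \<Longrightarrow>
    subpoly_partials \<mu> n (g \<circ> \<Phi>)"
proof (induction n arbitrary: g)
  case (Suc n)
  have "isCont (partial i g) y" for i y
    using Suc.prems(2) subpoly_partials_imp_subpoly[of \<mu> n "partial i g"]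
    by (auto simp: subpoly_def continuous_on_eq_continuous_at)
  note chain = chain_rule_partial[of g \<Phi>, OF _ this]
  have ex: "has_partial i g y" "has_partial j (\<lambda>x. \<Phi> x $ i) x" for i j x y
    using Suc.prems by auto
  have eq: "partial j (g \<circ> \<Phi>) = (\<lambda>x. \<Sum>i\<in>UNIV. (partial i g \<circ> \<Phi>) x * partial j (\<lambda>x. \<Phi> x $ i) x)" for j
    by (rule ext) (simp add: chain(2)[OF ex])
  have 1: "subpoly_partials \<mu> n (partial i g \<circ> \<Phi>)" for i
    using Suc.prems subpoly_partials_Suc[OF Suc.prems(1)] by (intro Suc.IH) auto
  have 2: "subpoly_partials \<mu> n (\<lambda>x. partial j (\<lambda>x. \<Phi> x $ i) x)" for i j
    using Suc.prems(1)[of i] by simp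
  have "subpoly_partials \<mu> n (partial j (g \<circ> \<Phi>))" for j
    unfolding eq by (intro subpoly_partials_sum[OF \<mu>] subpoly_partials_mult 1 2 finite)
  moreover have "subpoly \<mu> (g \<circ> \<Phi>)" by (rule \<Phi>[OF subpoly_partials_imp_subpoly[OF Suc.prems(2)]])
  ultimately show ?case unfolding subpoly_partials.simps using chain(1)[OF ex] by blast
next
  case 0
  then show ?case unfolding subpoly_partials.simps by (intro \<Phi>)
qed

text \<open>The components of a layer are ridge functions: a function of one variable after a linear form.\<close>

lemma subpoly_partials_ridge:
  fixes a :: "real^'n \<Rightarrow> real"
  assumes \<mu>: "\<And>z. 0 < \<mu> z \<and> \<mu> z \<le> 1"
    and a: "\<And>x s j. a (x + s *\<^sub>R axis j 1) = a x + s * \<alpha> j"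
    and \<sigma>: "\<And>q z. q < N \<Longrightarrow> (\<sigma> q has_field_derivative \<sigma> (Suc q) z) (at z)"
    and growth: "\<And>q. q \<le> N \<Longrightarrow> subpoly \<mu> (\<lambda>x. \<sigma> q (a x))"
  shows "q + n \<le> N \<Longrightarrow> subpoly_partials \<mu> n (\<lambda>x. \<sigma> q (a x))"
proof (induction n arbitrary: q)
  case (Suc n)
  have D: "((\<lambda>s. \<sigma> q (a (x + s *\<^sub>R axis j 1))) has_field_derivative \<sigma> (Suc q) (a x) * \<alpha> j) (at 0)" for x j
    unfolding a
    by (rule DERIV_chain2[of "\<sigma> q"]) (use Suc.prems \<sigma>[of q] in \<open>auto intro!: derivative_eq_intros\<close>)
  have eq: "partial j (\<lambda>x. \<sigma> q (a x)) = (\<lambda>x. \<sigma> (Suc q) (a x) * \<alpha> j)" for j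
    using DERIV_has_partial(2)[OF D] by auto
  have "subpoly_partials \<mu> n (\<lambda>x. \<sigma> (Suc q) (a x) * \<alpha> j)" for j
    using Suc by (intro subpoly_partials_mult subpoly_partials_const \<mu>) auto
  then show ?case
    using growth[of q] Suc.prems DERIV_has_partial(1)[OF D] by (auto simp: eq)
next
  case 0
  then show ?case using growth[of q] by simp
qed

lemma subpoly_partials_iff:
  fixes g :: "real^'n \<Rightarrow> real"
  shows "subpoly_partials \<mu> n g \<longleftrightarrow>
    (\<forall>js. length js \<le> n \<longrightarrow> partials_exist_on UNIV js g \<and> subpoly \<mu> (partials js g))"
proof (induction n arbitrary: g)
  case (Suc n)
  show ?case (is "?L \<longleftrightarrow> ?R")
  proof
    assume L: ?L
    show ?R
    proof (intro allI impI)
      fix js :: "'n list" assume js: "length js \<le> Suc n"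
      show "partials_exist_on UNIV js g \<and> subpoly \<mu> (partials js g)"
      proof (cases js rule: rev_cases)
        case (snoc ks j)
        then show ?thesis using L js Suc.IH[of "partial j g"]
          by (auto simp: partials_append partials_exist_on_append)
      qed (use L in auto)
    qed
  next
    assume R: ?R
    have "partials_exist_on UNIV (js @ [j]) g \<and> subpoly \<mu> (partials (js @ [j]) g)" if "length js \<le> n" for js j
      using R that by auto
    moreover have "has_partial j g x" for j x using R[rule_format, of "[j]"] by auto
    ultimately show ?L using R[rule_format, of "[]"] Suc.IH
      by (auto simp: partials_append partials_exist_on_append)
  qed
qed auto

lemma subpoly_partials_imp_cont_partials:
  "subpoly_partials \<mu> n g \<Longrightarrow> cont_partials n g"
  by (auto simp: subpoly_partials_iff cont_partials_def subpoly_def)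

text \<open>Schwarz's theorem reduces a bound for all orders of differentiation to one for multi-indices.\<close>

lemma subpoly_partialsI_multi_partial:
  fixes f :: "real^'n::{finite,linorder} \<Rightarrow> real"
  assumes f: "cont_partials n f"
    and growth: "\<And>l B. (\<Sum>j\<in>UNIV. l j) \<le> n \<Longrightarrow> B > 0 \<Longrightarrow>
      \<exists>C>0. \<forall>x. \<bar>multi_partial l f x\<bar> \<le> C * (\<Prod>j\<in>UNIV. \<mu> (x $ j) powr (- B))"
  shows "subpoly_partials \<mu> n f"
  unfolding subpoly_partials_iff
proof (intro allI impI conjI)
  fix js :: "'n list" assume js: "length js \<le> n"
  show "partials_exist_on UNIV js f" using cont_partialsD[OF f js] by simp
  have "(\<Sum>j\<in>UNIV. count (mset js) j) = size (mset js)"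
    unfolding size_multiset_overloaded_eq
    by (rule sum.mono_neutral_right) (auto simp: not_in_iff)
  then have "(\<Sum>j\<in>UNIV. count (mset js) j) \<le> n" using js by simp
  note * = growth[OF this]
  show "subpoly \<mu> (partials js f)"
    unfolding subpoly_def using cont_partialsD[OF f js] *
    unfolding partials_eq_multi_partial[OF f js] by auto
qed


section \<open>The layers preserve subpolynomial growth\<close>

text \<open>By log-concavity with the weights \<open>\<bar>a\<^sub>j\<bar>\<close>, applied to the points \<open>\<plusminus>x\<^sub>j\<close>, the logarithm of \<open>F\<close> at the linear
  combination is at least a mean of the \<open>ln (\<mu> (x\<^sub>j))\<close>, hence at least their sum, all of them being
  negative. Symmetry of \<open>F\<close> transfers this to the other tail.\<close>

lemma tail_weight_linear:
  fixes F :: "real \<Rightarrow> real" and a :: "real^'n" and x :: "real^'n"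
  defines "\<mu> \<equiv> \<lambda>z. min (F z) (1 - F z)"
  assumes F: "\<And>z. 0 < F z \<and> F z < 1" and sym: "\<And>z. F z + F (- z) = 1"
    and conc: "concave_on UNIV (\<lambda>x. ln (F x))"
    and a: "(\<Sum>j\<in>UNIV. \<bar>a $ j\<bar>) = 1"
  shows "(\<Prod>j\<in>UNIV. \<mu> (x $ j)) \<le> \<mu> (\<Sum>j\<in>UNIV. a $ j * x $ j)"
proof -
  have \<mu>01: "0 < \<mu> z" "\<mu> z \<le> 1" for z using F[of z] by (auto simp: \<mu>_def)
  have F_neg: "F (- z) = 1 - F z" for z using sym[of z] by simp
  have \<mu>_le: "\<mu> z \<le> F (s * z)" if "s \<in> {1,-1}" for s z using that by (auto simp: \<mu>_def F_neg)
  have key: "(\<Prod>j\<in>UNIV. \<mu> (x $ j)) \<le> F (\<Sum>j\<in>UNIV. \<bar>a $ j\<bar> * (s j * x $ j))" if s: "\<And>j. s j \<in> {1,-1}" for s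
  proof -
    have "(\<Sum>j\<in>UNIV. \<bar>a $ j\<bar> * ln (F (s j * x $ j))) \<le> ln (F (\<Sum>j\<in>UNIV. \<bar>a $ j\<bar> *\<^sub>R (s j * x $ j)))"
      using convex_on_sum[of UNIV UNIV "\<lambda>x. - ln (F x)" "\<lambda>j. \<bar>a $ j\<bar>" "\<lambda>j. s j * x $ j"] conc a
      by (auto simp: concave_on_def sum_negf)
    moreover have "ln (\<mu> (x $ j)) \<le> \<bar>a $ j\<bar> * ln (F (s j * x $ j))" for j
    proof -
      have le1: "\<bar>a $ j\<bar> \<le> 1" unfolding a[symmetric] by (rule member_le_sum) auto
      have "ln (\<mu> (x $ j)) \<le> \<bar>a $ j\<bar> * ln (\<mu> (x $ j))"
        using mult_right_mono_neg[OF le1, of "ln (\<mu> (x $ j))"] \<mu>01[of "x $ j"] by simp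
      also have "\<dots> \<le> \<bar>a $ j\<bar> * ln (F (s j * x $ j))"
        using \<mu>_le[OF s[of j], of "x $ j"] \<mu>01[of "x $ j"] F by (intro mult_left_mono) auto
      finally show ?thesis .
    qed
    then have "(\<Sum>j\<in>UNIV. ln (\<mu> (x $ j))) \<le> (\<Sum>j\<in>UNIV. \<bar>a $ j\<bar> * ln (F (s j * x $ j)))"
      by (rule sum_mono)
    moreover have "(\<Sum>j\<in>UNIV. ln (\<mu> (x $ j))) = ln (\<Prod>j\<in>UNIV. \<mu> (x $ j))"
      by (rule ln_prod[symmetric]) (simp_all add: \<mu>01(1)[THEN less_imp_neq, THEN not_sym])
    ultimately have "ln (\<Prod>j\<in>UNIV. \<mu> (x $ j)) \<le> ln (F (\<Sum>j\<in>UNIV. \<bar>a $ j\<bar> * (s j * x $ j)))"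
      by simp
    then show ?thesis
      using F by (subst (asm) ln_le_cancel_iff) (auto intro!: prod_pos simp: \<mu>01)
  qed
  have "(\<Sum>j\<in>UNIV. a $ j * x $ j) = (\<Sum>j\<in>UNIV. \<bar>a $ j\<bar> * ((if a $ j \<ge> 0 then 1 else -1) * x $ j))"
    by (intro sum.cong) auto
  moreover have "- (\<Sum>j\<in>UNIV. a $ j * x $ j) = (\<Sum>j\<in>UNIV. \<bar>a $ j\<bar> * ((if a $ j \<ge> 0 then -1 else 1) * x $ j))"
    unfolding sum_negf[symmetric] by (intro sum.cong) auto
  ultimately have "(\<Prod>j\<in>UNIV. \<mu> (x $ j)) \<le> F (\<Sum>j\<in>UNIV. a $ j * x $ j)"
      "(\<Prod>j\<in>UNIV. \<mu> (x $ j)) \<le> F (- (\<Sum>j\<in>UNIV. a $ j * x $ j))"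
    using key[of "\<lambda>j. if a $ j \<ge> 0 then 1 else -1"] key[of "\<lambda>j. if a $ j \<ge> 0 then -1 else 1"] by auto
  then show ?thesis unfolding \<mu>_def by (simp add: F_neg)
qed

text \<open>The tail condition replaces \<open>\<mu> (S i y)\<close> by a power of \<open>\<mu> y\<close>, and \<open>\<mu>\<close> at a linear form is at least the product of
  the \<open>\<mu> (x\<^sub>j)\<close>. Both losses only multiply the exponent, in total by the sum of the \<open>B1 i\<close>, so they are absorbed
  by starting from a smaller exponent.\<close>

lemma subpoly_layer:
  fixes A :: "real^'n^'n" and S :: "'n \<Rightarrow> real \<Rightarrow> real"
  assumes \<mu>: "\<And>z. 0 < \<mu> z \<and> \<mu> z \<le> 1"
    and lin: "\<And>i x. (\<Prod>j\<in>UNIV. \<mu> (x $ j)) \<le> \<mu> ((A *v x) $ i)"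
    and tail: "\<And>i. \<exists>B>0. \<exists>C>0. \<forall>y. inverse (\<mu> (S i y)) \<le> C * \<mu> y powr (- B)"
    and cont: "\<And>i. continuous_on UNIV (S i)"
    and g: "subpoly \<mu> g"
  shows "subpoly \<mu> (g \<circ> layer A S)"
proof (rule subpolyI)
  have "continuous_on UNIV (layer A S)"
    unfolding layer_def
    by (intro continuous_on_vec_lambda continuous_on_compose2[OF cont])
       (auto simp: matrix_vector_mult_def intro!: continuous_intros)
  then show "continuous_on UNIV (g \<circ> layer A S)"
    using g by (intro continuous_on_compose) (auto simp: subpoly_def intro: continuous_on_subset)
  from tail obtain B1 C1 where BC: "\<And>i. B1 i > 0" "\<And>i. C1 i > 0"
    "\<And>i y. inverse (\<mu> (S i y)) \<le> C1 i * \<mu> y powr (- B1 i)" by metis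
  fix B :: real assume B: "B > 0"
  define b where "b = (\<Sum>i\<in>UNIV. B1 i)"
  have b: "b > 0" unfolding b_def using BC by (intro sum_pos) auto
  define \<beta> where "\<beta> = B / b"
  have \<beta>: "\<beta> > 0" using B b by (simp add: \<beta>_def)
  from g \<beta> obtain C where C: "C > 0" "\<And>x. \<bar>g x\<bar> \<le> C * (\<Prod>j\<in>UNIV. \<mu> (x $ j) powr (- \<beta>))"
    unfolding subpoly_def by blast
  have bound: "\<bar>(g \<circ> layer A S) x\<bar> \<le> (C * (\<Prod>i\<in>UNIV. C1 i powr \<beta>)) * (\<Prod>j\<in>UNIV. \<mu> (x $ j) powr (- B))" for x
  proof -
    let ?p = "\<Prod>j\<in>UNIV. \<mu> (x $ j)"
    have p: "?p > 0" by (auto intro!: prod_pos simp: \<mu>)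
    have "\<mu> (S i y) powr (- \<beta>) \<le> C1 i powr \<beta> * ?p powr (- (B1 i * \<beta>))" if "y = (A *v x) $ i" for i y
    proof -
      have "\<mu> (S i y) powr (- \<beta>) = inverse (\<mu> (S i y)) powr \<beta>"
        using \<mu>[of "S i y"] by (simp add: powr_minus powr_divide inverse_eq_divide)
      also have "\<dots> \<le> (C1 i * \<mu> y powr (- B1 i)) powr \<beta>"
        using BC(3)[of i y] \<mu>[of "S i y"] \<beta> by (intro powr_mono2) auto
      also have "\<dots> = C1 i powr \<beta> * \<mu> y powr (- (B1 i * \<beta>))"
        using BC(2)[of i] \<mu>[of y] by (simp add: powr_mult powr_powr)
      also have "\<dots> \<le> C1 i powr \<beta> * ?p powr (- (B1 i * \<beta>))"
        using BC(1)[of i] \<beta> lin[of x i] p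
        by (intro mult_left_mono powr_mono2') (auto simp: that)
      finally show ?thesis .
    qed
    then have "(\<Prod>i\<in>UNIV. \<mu> (layer A S x $ i) powr (- \<beta>)) \<le>
        (\<Prod>i\<in>UNIV. C1 i powr \<beta> * ?p powr (- (B1 i * \<beta>)))"
      by (intro prod_mono) (auto simp: layer_def)
    also have "\<dots> = (\<Prod>i\<in>UNIV. C1 i powr \<beta>) * ?p powr (\<Sum>i\<in>UNIV. - (B1 i * \<beta>))"
      using p by (simp only: prod.distrib powr_sum[OF less_imp_neq[OF p, symmetric]])
    also have "(\<Sum>i\<in>UNIV. - (B1 i * \<beta>)) = - B"
    proof -
      have "(\<Sum>i\<in>UNIV. B1 i * \<beta>) = b * \<beta>" by (simp add: sum_distrib_right b_def)
      then show ?thesis using b by (simp add: sum_negf \<beta>_def)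
    qed
    also have "?p powr (- B) = (\<Prod>j\<in>UNIV. \<mu> (x $ j) powr (- B))"
      by (rule prod_powr_distrib)
    finally have "C * (\<Prod>i\<in>UNIV. \<mu> (layer A S x $ i) powr (- \<beta>)) \<le>
       C * ((\<Prod>i\<in>UNIV. C1 i powr \<beta>) * (\<Prod>j\<in>UNIV. \<mu> (x $ j) powr (- B)))"
      using C(1) by (intro mult_left_mono) auto
    then show ?thesis using C(2)[of "layer A S x"] by (simp add: mult.assoc)
  qed
  then show "\<exists>C. \<forall>x. \<bar>(g \<circ> layer A S) x\<bar> \<le> C * (\<Prod>j\<in>UNIV. \<mu> (x $ j) powr (- B))" by blast
qed

lemma subpoly_partials_layer:
  fixes A :: "real^'n^'n" and S :: "'n \<Rightarrow> real \<Rightarrow> real"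
  assumes \<mu>: "\<And>z. 0 < \<mu> z \<and> \<mu> z \<le> 1"
    and lin: "\<And>i x. (\<Prod>j\<in>UNIV. \<mu> (x $ j)) \<le> \<mu> ((A *v x) $ i)"
    and tail: "\<And>i. \<exists>B>0. \<exists>C>0. \<forall>y. inverse (\<mu> (S i y)) \<le> C * \<mu> y powr (- B)"
    and S: "\<And>i. cont_derivs N (S i)"
    and growth: "\<And>i B. B > 0 \<Longrightarrow> \<exists>C. \<forall>m\<le>N. \<forall>z. \<bar>(deriv ^^ m) (S i) z\<bar> \<le> C * \<mu> z powr (- B)"
    and g: "subpoly_partials \<mu> N g"
  shows "subpoly_partials \<mu> N (g \<circ> layer A S)"
proof (rule subpoly_partials_compose[OF \<mu> _ _ g])
  have cont: "continuous_on UNIV ((deriv ^^ m) (S i))" if "m \<le> N" for m i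
    using S that by (auto simp: cont_derivs_def)
  show "subpoly \<mu> (g \<circ> layer A S)" if "subpoly \<mu> g" for g
    using subpoly_layer[OF \<mu> lin tail _ that] cont[of 0] by auto
  fix i
  have "subpoly_partials \<mu> N (\<lambda>x. (deriv ^^ 0) (S i) ((A *v x) $ i))"
  proof (rule subpoly_partials_ridge[where \<alpha> = "\<lambda>j. A $ i $ j" and N = N and \<sigma> = "\<lambda>m. (deriv ^^ m) (S i)"])
    show "(A *v (x + s *\<^sub>R axis j 1)) $ i = (A *v x) $ i + s * A $ i $ j" for x s j
      by (simp add: matrix_vector_right_distrib matrix_vector_mult_scaleR matrix_vector_mult_basis column_def)
    show "((deriv ^^ q) (S i) has_field_derivative (deriv ^^ Suc q) (S i) z) (at z)" if "q < N" for q z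
      using S[of i] that by (simp add: cont_derivs_def DERIV_deriv_iff_field_differentiable)
    fix q assume q: "q \<le> N"
    show "subpoly \<mu> (\<lambda>x. (deriv ^^ q) (S i) ((A *v x) $ i))"
    proof (rule subpolyI)
      show "continuous_on UNIV (\<lambda>x. (deriv ^^ q) (S i) ((A *v x) $ i))"
        by (rule continuous_on_compose2[OF cont[OF q]])
           (auto simp: matrix_vector_mult_def intro!: continuous_intros)
      fix B :: real assume B: "B > 0"
      from growth[OF this, of i] q obtain C where C: "\<And>z. \<bar>(deriv ^^ q) (S i) z\<bar> \<le> C * \<mu> z powr (- B)"
        by blast
      have "\<bar>(deriv ^^ q) (S i) ((A *v x) $ i)\<bar> \<le> \<bar>C\<bar> * (\<Prod>j\<in>UNIV. \<mu> (x $ j) powr (- B))" for x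
      proof -
        let ?y = "(A *v x) $ i"
        have "\<bar>(deriv ^^ q) (S i) ?y\<bar> \<le> \<bar>C\<bar> * \<mu> ?y powr (- B)"
          using C[of ?y] by (rule order_trans) (auto intro!: mult_right_mono)
        also have "\<dots> \<le> \<bar>C\<bar> * (\<Prod>j\<in>UNIV. \<mu> (x $ j)) powr (- B)"
          using lin[of x i] B \<mu> by (intro mult_left_mono powr_mono2') (auto intro!: prod_pos)
        also have "(\<Prod>j\<in>UNIV. \<mu> (x $ j)) powr (- B) = (\<Prod>j\<in>UNIV. \<mu> (x $ j) powr (- B))"
          by (rule prod_powr_distrib)
        finally show ?thesis .
      qed
      then show "\<exists>C. \<forall>x. \<bar>(deriv ^^ q) (S i) ((A *v x) $ i)\<bar> \<le> C * (\<Prod>j\<in>UNIV. \<mu> (x $ j) powr (- B))"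
        by blast
    qed
  qed (use \<mu> in auto)
  then show "subpoly_partials \<mu> N (\<lambda>x. layer A S x $ i)" by (simp add: layer_def)
qed

section \<open>Boundary growth of the transformed integrand\<close>

lemma open_open_cube: "open (open_cube :: (real^'n) set)"
proof -
  have "open_cube = box (0 :: real^'n) (\<chi> j. 1)"
    by (auto simp: open_cube_def mem_box_cart)
  then show ?thesis by (metis open_box)
qed

lemma mixed_partial_eq_partials:
  fixes v :: "'n::{finite,linorder} set"
  obtains ks where "distinct ks" "set ks = v" "mixed_partial v = partials ks"
proof
  let ?xs = "sorted_list_of_set (UNIV :: 'n set)" and ?ks = "filter (\<lambda>j. j \<in> v) (sorted_list_of_set UNIV)"
  show "distinct ?ks" "set ?ks = v" by auto
  have "concat (map (\<lambda>j. replicate (of_bool (j \<in> v)) j) xs) = filter (\<lambda>j. j \<in> v) xs" for xs :: "'n list"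
    by (induction xs) auto
  then show "mixed_partial v = partials ?ks"
    by (intro ext) (simp add: mixed_partial_def multi_partial_def)
qed

lemma length_distinct_le_CARD:
  "distinct (js :: 'n::finite list) \<Longrightarrow> length js \<le> CARD('n)"
  by (metis card_mono distinct_card finite subset_UNIV)

text \<open>Each variable enters through its own \<open>G (u\<^sub>k)\<close> and is differentiated at most once, so every differentiation
  contributes exactly one factor \<open>G'\<close> and second derivatives of \<open>G\<close> never appear.\<close>

lemma partials_compose_coordinatewise:
  fixes g :: "real^'n \<Rightarrow> real"
  assumes g: "\<And>js. distinct js \<Longrightarrow> partials_exist_on UNIV js g"
    and G: "\<And>u. 0 < u \<Longrightarrow> u < 1 \<Longrightarrow> (G has_field_derivative G' u) (at u)"
  shows "distinct js \<Longrightarrow> partials_exist_on open_cube js (\<lambda>u. g (\<chi> j. G (u $ j))) \<and>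
    (\<forall>u\<in>open_cube. partials js (\<lambda>u. g (\<chi> j. G (u $ j))) u =
      partials js g (\<chi> j. G (u $ j)) * (\<Prod>j\<in>set js. G' (u $ j)))"
proof (induction js)
  case (Cons k js)
  let ?h = "\<lambda>u. g (\<chi> j. G (u $ j))"
  let ?p = "\<lambda>u. partials js g (\<chi> j. G (u $ j)) * (\<Prod>j\<in>set js. G' (u $ j))"
  have k: "k \<notin> set js" using Cons.prems by auto
  have ex: "has_partial k (partials js g) x" for x
    using g[OF Cons.prems] by simp
  have D: "((\<lambda>s. ?p (u + s *\<^sub>R axis k 1)) has_field_derivative
      partials (k # js) g (\<chi> j. G (u $ j)) * (\<Prod>j\<in>set (k # js). G' (u $ j))) (at 0)"
    if u: "u \<in> open_cube" for u
  proof -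
    let ?y = "\<chi> j. G (u $ j)"
    have 1: "(\<chi> j. G ((u + s *\<^sub>R axis k 1) $ j)) = ?y + (G (u $ k + s) - G (u $ k)) *\<^sub>R axis k 1" for s
      by (auto simp: vec_eq_iff axis_def)
    have 2: "(\<Prod>j\<in>set js. G' ((u + s *\<^sub>R axis k 1) $ j)) = (\<Prod>j\<in>set js. G' (u $ j))" for s
      by (intro prod.cong) (use k in \<open>auto simp: axis_def\<close>)
    have "((\<lambda>s. G (u $ k + s) - G (u $ k)) has_field_derivative G' (u $ k)) (at 0)"
      using DERIV_shift[of G "G' (u $ k)" 0 "u $ k"] G[of "u $ k"] u
      by (auto simp: open_cube_def add.commute intro!: derivative_eq_intros)
    moreover have "((\<lambda>s. partials js g (?y + s *\<^sub>R axis k 1)) has_field_derivative partial k (partials js g) ?y)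
       (at (G (u $ k + 0) - G (u $ k)))"
      using has_partial_DERIV[OF ex[of ?y]] by simp
    ultimately have "((\<lambda>s. partials js g (?y + (G (u $ k + s) - G (u $ k)) *\<^sub>R axis k 1)) has_field_derivative
        partial k (partials js g) ?y * G' (u $ k)) (at 0)"
      by (intro DERIV_chain2[of "\<lambda>s. partials js g (?y + s *\<^sub>R axis k 1)" _
          "\<lambda>s. G (u $ k + s) - G (u $ k)"])
    then have "((\<lambda>s. partials js g (?y + (G (u $ k + s) - G (u $ k)) *\<^sub>R axis k 1) * (\<Prod>j\<in>set js. G' (u $ j)))
        has_field_derivative partial k (partials js g) ?y * G' (u $ k) * (\<Prod>j\<in>set js. G' (u $ j))) (at 0)"
      by (rule DERIV_cmult_right)
    then show ?thesis unfolding 1 2 using k by (simp add: mult.assoc)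
  qed
  note P = DERIV_has_partial[OF D]
  have IH: "partials_exist_on open_cube js ?h" "\<And>u. u \<in> open_cube \<Longrightarrow> partials js ?h u = ?p u"
    using Cons by auto
  have "has_partial k (partials js ?h) u \<and> partial k (partials js ?h) u =
      partials (k # js) g (\<chi> j. G (u $ j)) * (\<Prod>j\<in>set (k # js). G' (u $ j))" if "u \<in> open_cube" for u
    using partial_cong_open[OF open_open_cube that IH(2) P(1)[OF that]] P(2)[OF that] by simp
  then show ?case using IH(1) by simp
qed auto

text \<open>Since \<open>F (G u) = u\<close>, subpolynomial growth in the tail weight of \<open>F\<close> becomes subpolynomial growth
  in the distance to the boundary, and each differentiation contributes one factor \<open>G'\<close>.\<close>

lemma boundary_growth_compose:
  fixes g :: "real^'n::{finite,linorder} \<Rightarrow> real"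
  assumes \<mu>: "\<And>u. u \<in> {0<..<1} \<Longrightarrow> \<mu> (G u) = min u (1 - u)"
    and G: "\<And>u. u \<in> {0<..<1} \<Longrightarrow> (G has_field_derivative G' u) (at u)"
    and growth: "\<And>B. B > 0 \<Longrightarrow> \<exists>C>0. \<forall>u\<in>{0<..<1}. \<bar>G' u\<bar> \<le> C * min u (1 - u) powr (- 1 - B)"
    and g: "subpoly_partials \<mu> CARD('n) g"
  shows "boundary_growth (\<lambda>u. g (\<chi> j. G (u $ j)))"
proof -
  let ?h = "\<lambda>u. g (\<chi> j. G (u $ j))"
  have g': "partials_exist_on UNIV js g \<and> subpoly \<mu> (partials js g)" if "distinct js" for js
    using g length_distinct_le_CARD[OF that] by (auto simp: subpoly_partials_iff)
  note P = partials_compose_coordinatewise[of g G G', OF _ G]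
  have P1: "partials_exist_on open_cube js ?h" if "distinct js" for js
    using P[OF _ _ that] g' by auto
  have P2: "partials js ?h u = partials js g (\<chi> j. G (u $ j)) * (\<Prod>j\<in>set js. G' (u $ j))"
    if "distinct js" "u \<in> open_cube" for js u
    using P[OF _ _ that(1)] g' that(2) by auto
  have mixed: "mixed_partials_exist_on open_cube ?h"
    unfolding mixed_partials_exist_on_def
  proof (intro allI impI conjI ballI)
    fix js :: "'n list" assume js: "distinct js"
    show "partials_exist_on open_cube js ?h" by (rule P1[OF js])
    fix u :: "(real, 'n) vec" assume u: "u \<in> open_cube"
    obtain ks where ks: "distinct ks" "set ks = set js" "mixed_partial (set js) = partials ks"
      by (rule mixed_partial_eq_partials)
    have "partials js g = partials ks g"
      using ks js by (intro partials_perm[OF subpoly_partials_imp_cont_partials[OF g]] length_distinct_le_CARD)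
        (simp_all add: set_eq_iff_mset_eq_distinct)
    then show "partials js ?h u = mixed_partial (set js) ?h u"
      using P2[OF js u] P2[OF ks(1) u] by (simp add: ks)
  qed
  have bound: "\<exists>C>0. \<forall>u\<in>open_cube. \<bar>mixed_partial v ?h u\<bar> \<le>
      C * (\<Prod>j\<in>UNIV. min (u $ j) (1 - u $ j) powr (- B - of_bool (j \<in> v)))"
    if B: "B > 0" for B and v :: "'n set"
  proof -
    obtain ks where ks: "distinct ks" "set ks = v" "mixed_partial v = partials ks"
      by (rule mixed_partial_eq_partials)
    have B2: "B / 2 > 0" using B by simp
    from g'[OF ks(1)] B2 obtain C1 where C1: "C1 > 0"
      "\<And>x. \<bar>partials ks g x\<bar> \<le> C1 * (\<Prod>j\<in>UNIV. \<mu> (x $ j) powr (- (B/2)))"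
      unfolding subpoly_def by blast
    from growth[OF B2] obtain C2 where C2: "C2 > 0"
      "\<And>u. u \<in> {0<..<1} \<Longrightarrow> \<bar>G' u\<bar> \<le> C2 * min u (1 - u) powr (- 1 - B/2)" by blast
    have "\<bar>mixed_partial v ?h u\<bar> \<le> (C1 * C2 ^ card v) *
        (\<Prod>j\<in>UNIV. min (u $ j) (1 - u $ j) powr (- B - of_bool (j \<in> v)))" if u: "u \<in> open_cube" for u
    proof -
      let ?w = "\<lambda>j. min (u $ j) (1 - u $ j)"
      have uj: "u $ j \<in> {0<..<1}" for j using u by (auto simp: open_cube_def)
      have w: "0 < ?w j" "?w j \<le> 1" for j using uj[of j] by auto
      have "\<bar>mixed_partial v ?h u\<bar> = \<bar>partials ks g (\<chi> j. G (u $ j))\<bar> * (\<Prod>j\<in>v. \<bar>G' (u $ j)\<bar>)"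
        by (simp add: ks P2[OF ks(1) u] abs_mult abs_prod)
      also have "\<dots> \<le> (C1 * (\<Prod>j\<in>UNIV. ?w j powr (- (B/2)))) * (\<Prod>j\<in>v. C2 * ?w j powr (- 1 - B/2))"
      proof (intro mult_mono prod_mono conjI)
        show "\<bar>partials ks g (\<chi> j. G (u $ j))\<bar> \<le> C1 * (\<Prod>j\<in>UNIV. ?w j powr (- (B/2)))"
          using C1(2)[of "\<chi> j. G (u $ j)"] \<mu>[OF uj] by simp
      qed (use C1 C2 uj in \<open>auto intro!: mult_nonneg_nonneg prod_nonneg\<close>)
      also have "(\<Prod>j\<in>v. C2 * ?w j powr (- 1 - B/2)) = C2 ^ card v * (\<Prod>j\<in>UNIV. if j \<in> v then ?w j powr (- 1 - B/2) else 1)"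
        by (simp add: prod.distrib prod.If_cases)
      also have "(C1 * (\<Prod>j\<in>UNIV. ?w j powr (- (B/2)))) * \<dots> =
          (C1 * C2 ^ card v) * (\<Prod>j\<in>UNIV. ?w j powr (- (B/2)) * (if j \<in> v then ?w j powr (- 1 - B/2) else 1))"
        by (simp add: prod.distrib)
      also have "\<dots> \<le> (C1 * C2 ^ card v) * (\<Prod>j\<in>UNIV. ?w j powr (- B - of_bool (j \<in> v)))"
      proof (intro mult_left_mono prod_mono conjI)
        fix j
        show "?w j powr (- (B/2)) * (if j \<in> v then ?w j powr (- 1 - B/2) else 1) \<le> ?w j powr (- B - of_bool (j \<in> v))"
          using w[of j] B by (auto simp: powr_add[symmetric] intro!: powr_mono')
      qed (use C1 C2 in auto)
      finally show ?thesis .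
    qed
    then show ?thesis using C1 C2 by (intro exI[of _ "C1 * C2 ^ card v"]) auto
  qed
  show ?thesis
    unfolding boundary_growth_def
  proof (intro conjI mixed allI impI)
    fix B :: real assume "B > 0"
    define P where "P v C \<longleftrightarrow> C > 0 \<and> (\<forall>u\<in>open_cube. \<bar>mixed_partial v ?h u\<bar> \<le>
      C * (\<Prod>j\<in>UNIV. min (u $ j) (1 - u $ j) powr (- B - of_bool (j \<in> v))))" for v C
    have "\<exists>C. P v C" for v unfolding P_def by (rule bound[OF \<open>B > 0\<close>])
    then obtain C where "\<And>v. P v (C v)" by metis
    then have C: "\<And>v. C v > 0"
      "\<And>v u. u \<in> open_cube \<Longrightarrow> \<bar>mixed_partial v ?h u\<bar> \<le>
      C v * (\<Prod>j\<in>UNIV. min (u $ j) (1 - u $ j) powr (- B - of_bool (j \<in> v)))"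
      unfolding P_def by blast+
    have le: "C v \<le> (\<Sum>v\<in>UNIV. C v)" for v
      by (rule member_le_sum) (use C(1) in \<open>auto intro: less_imp_le\<close>)
    have "\<bar>mixed_partial v ?h u\<bar> \<le>
      (\<Sum>v\<in>UNIV. C v) * (\<Prod>j\<in>UNIV. min (u $ j) (1 - u $ j) powr (- B - of_bool (j \<in> v)))"
      if "u \<in> open_cube" for v u
      by (rule order_trans[OF C(2)[OF that] mult_right_mono[OF le]]) (auto intro!: prod_nonneg)
    moreover have "(\<Sum>v\<in>UNIV. C v) > 0" using C(1) by (intro sum_pos) auto
    ultimately show "\<exists>C>0. \<forall>v. \<forall>u\<in>open_cube. \<bar>mixed_partial v ?h u\<bar> \<le>
        C * (\<Prod>j\<in>UNIV. min (u $ j) (1 - u $ j) powr (- B - of_bool (j \<in> v)))" by blast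
  qed
qed

lemma inverse_diffeo_facts:
  assumes G: "increasing_diffeo_on {0<..<1} G" and F: "F = the_inv_into {0<..<1} G"
  shows "0 < F x \<and> F x < 1" "u \<in> {0<..<1} \<Longrightarrow> F (G u) = u"
    "u \<in> {0<..<1} \<Longrightarrow> (G has_field_derivative deriv G u) (at u)"
proof -
  have bij: "bij_betw G {0<..<1} UNIV" using G by (simp add: increasing_diffeo_on_def)
  have "F x \<in> {0<..<1}"
    unfolding F using bij by (intro the_inv_into_into[where B = "{0<..<1}"]) (auto simp: bij_betw_def)
  then show "0 < F x \<and> F x < 1" by auto
  show "F (G u) = u" if "u \<in> {0<..<1}"
    unfolding F using bij that by (intro the_inv_into_f_f) (auto simp: bij_betw_def)
  show "(G has_field_derivative deriv G u) (at u)" if "u \<in> {0<..<1}"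
    using G that by (simp add: increasing_diffeo_on_def DERIV_deriv_iff_field_differentiable)
qed

lemma boundary_growth_flow:
  fixes G F :: "real \<Rightarrow> real"
    and L :: "nat \<Rightarrow> real^'d::{finite,linorder}^'d::{finite,linorder}"
    and T :: "nat \<Rightarrow> 'd \<Rightarrow> real \<Rightarrow> real"
    and f :: "real^'d::{finite,linorder} \<Rightarrow> real"
  assumes G_diffeo: "increasing_diffeo_on {0<..<1} G"
    and F_def: "F = the_inv_into {0<..<1} G"
    and G_growth: "\<And>B. B > 0 \<Longrightarrow> \<exists>C>0. \<forall>u\<in>{0<..<1}. \<bar>deriv G u\<bar> \<le> C * min u (1 - u) powr (- 1 - B)"
    and F_log_concave: "concave_on UNIV (\<lambda>x. ln (F x))"
    and F_symmetric: "\<And>x. F x + F (- x) = 1"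
    and L_rows: "\<And>k i. k \<in> {1..K} \<Longrightarrow> (\<Sum>j\<in>UNIV. \<bar>L k $ i $ j\<bar>) = 1"
    and T_diffeo: "\<And>k i. k \<in> {1..K} \<Longrightarrow> increasing_diffeo_on UNIV (T k i)"
    and T_cont_derivs: "\<And>k i. k \<in> {1..K} \<Longrightarrow> cont_derivs CARD('d) (T k i)"
    and T_growth: "\<And>k i B. k \<in> {1..K} \<Longrightarrow> B > 0 \<Longrightarrow> \<exists>C. \<forall>m\<le>CARD('d). \<forall>z.
          \<bar>(deriv ^^ m) (T k i) z\<bar> \<le> C * min (F z) (1 - F z) powr (- B)"
    and T_tail: "\<And>k i. k \<in> {1..K} \<Longrightarrow> \<exists>B\<^sub>1>0. \<exists>C\<^sub>1>0. \<forall>z.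
          inverse (min (F z) (1 - F z)) \<le>
            C\<^sub>1 * min (F (inv (T k i) z)) (1 - F (inv (T k i) z)) powr (- B\<^sub>1)"
    and f_cont_partials: "cont_partials CARD('d) f"
    and f_growth: "\<And>l B. (\<Sum>j\<in>UNIV. l j) \<le> CARD('d) \<Longrightarrow> B > 0 \<Longrightarrow> \<exists>C>0. \<forall>x.
          \<bar>multi_partial l f x\<bar> \<le> C * (\<Prod>j\<in>UNIV. min (F (x $ j)) (1 - F (x $ j)) powr (- B))"
  shows "boundary_growth (f \<circ> flow G L T K)"
proof -
  define \<mu> where "\<mu> z = min (F z) (1 - F z)" for z
  note FG = inverse_diffeo_facts[OF G_diffeo F_def]
  have \<mu>: "0 < \<mu> z \<and> \<mu> z \<le> 1" for z using FG(1)[of z] by (auto simp: \<mu>_def)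
  have layers: "subpoly_partials \<mu> CARD('d) (g \<circ> layers L T k)"
    if "k \<le> K" "subpoly_partials \<mu> CARD('d) g" for g :: "(real, 'd) vec \<Rightarrow> real" and k using that
  proof (induction k arbitrary: g)
    case (Suc k)
    have k: "Suc k \<in> {1..K}" using Suc.prems by simp
    have lin: "(\<Prod>j\<in>UNIV. \<mu> (x $ j)) \<le> \<mu> ((L (Suc k) *v x) $ i)" for i x
      using tail_weight_linear[of F "L (Suc k) $ i" x, OF FG(1) F_symmetric F_log_concave L_rows[OF k]]
      by (simp add: \<mu>_def matrix_vector_mult_def)
    have tail: "\<exists>B>0. \<exists>C>0. \<forall>y. inverse (\<mu> (T (Suc k) i y)) \<le> C * \<mu> y powr (- B)" for i
    proof -
      have inj: "inj (T (Suc k) i)" using T_diffeo[OF k, of i] by (auto simp: increasing_diffeo_on_def bij_betw_def)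
      from T_tail[OF k, of i] obtain B C where "B > 0" "C > 0" and
        *: "\<And>z. inverse (\<mu> z) \<le> C * \<mu> (inv (T (Suc k) i) z) powr (- B)" unfolding \<mu>_def by blast
      with *[of "T (Suc k) i _"] show ?thesis by (auto simp: inv_f_f[OF inj])
    qed
    have "subpoly_partials \<mu> CARD('d) (g \<circ> layer (L (Suc k)) (T (Suc k)))"
      by (rule subpoly_partials_layer[OF \<mu> lin tail T_cont_derivs[OF k] T_growth[OF k, folded \<mu>_def] Suc.prems(2)])
    from Suc.IH[OF _ this] Suc.prems(1) show ?case by (simp add: o_assoc)
  qed simp
  have f: "subpoly_partials \<mu> CARD('d) f"
    by (rule subpoly_partialsI_multi_partial[OF f_cont_partials f_growth[folded \<mu>_def]])
  have "boundary_growth (\<lambda>u. (f \<circ> layers L T K) (\<chi> j. G (u $ j)))"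
    by (rule boundary_growth_compose[of \<mu> G "deriv G", OF _ FG(3) G_growth layers[OF order_refl f]])
       (simp_all add: \<mu>_def FG(2))
  then show ?thesis by (simp add: flow_def o_def)
qed

section \<open>Alternating differences\<close>

text \<open>The alternating sum over the vertices of the box spanned by \<open>y\<close> and \<open>z\<close> in the coordinates \<open>J\<close>, the others being
  those of \<open>x\<close>. It is polymorphic because it is applied both to points of the cube and to vectors of
  resolution levels.\<close>

definition alt :: "'i set \<Rightarrow> ('i \<Rightarrow> 'a) \<Rightarrow> ('i \<Rightarrow> 'a) \<Rightarrow> (('i \<Rightarrow> 'a) \<Rightarrow> real) \<Rightarrow> ('i \<Rightarrow> 'a) \<Rightarrow> real" where
  "alt J y z f x = (\<Sum>S\<in>Pow J. (-1) ^ card S * f (\<lambda>i. if i \<in> S then z i else if i \<in> J then y i else x i))"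

lemma alt_insert:
  assumes "finite J" "j \<notin> J"
  shows "alt (insert j J) y z f x = alt J y z f (x(j := y j)) - alt J y z f (x(j := z j))"
proof -
  have fin: "finite S" if "S \<in> Pow J" for S using that assms(1) by (auto intro: finite_subset)
  have inj: "inj_on (insert j) (Pow J)"
    using assms(2) unfolding inj_on_def by (metis Pow_iff insert_ident subsetD)
  let ?t = "\<lambda>S. (-1) ^ card S * f (\<lambda>i. if i \<in> S then z i else if i \<in> insert j J then y i else x i)"
  have "alt (insert j J) y z f x = sum ?t (Pow J) + sum ?t (insert j ` Pow J)"
    unfolding alt_def Pow_insert using assms by (intro sum.union_disjoint) auto
  also have "sum ?t (Pow J) = alt J y z f (x(j := y j))"
    unfolding alt_def
    by (intro sum.cong refl arg_cong2[of _ _ _ _ "(*)"] arg_cong[of _ _ f] ext) (use assms in auto)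
  also have "sum ?t (insert j ` Pow J) = (\<Sum>S\<in>Pow J. ?t (insert j S))"
    by (subst sum.reindex[OF inj]) simp
  also have "\<dots> = (\<Sum>S\<in>Pow J. - ((-1) ^ card S * f (\<lambda>i. if i \<in> S then z i else if i \<in> J then y i else (x(j := z j)) i)))"
  proof (intro sum.cong refl)
    fix S assume S: "S \<in> Pow J"
    then have "card (insert j S) = Suc (card S)" using assms fin[OF S] by (intro card_insert_disjoint) auto
    moreover have "(\<lambda>i. if i \<in> insert j S then z i else if i \<in> insert j J then y i else x i) =
        (\<lambda>i. if i \<in> S then z i else if i \<in> J then y i else (x(j := z j)) i)"
      using S assms by (intro ext) auto
    ultimately show "?t (insert j S) = - ((-1) ^ card S * f (\<lambda>i. if i \<in> S then z i else if i \<in> J then y i else (x(j := z j)) i))"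
      by simp
  qed
  also have "\<dots> = - alt J y z f (x(j := z j))" by (simp add: alt_def sum_negf)
  finally show ?thesis by (simp add: fun_upd_def)
qed

lemma alt_empty [simp]: "alt {} y z f x = f x"
  by (simp add: alt_def)

lemma alt_cong:
  assumes "\<And>i. i \<in> J \<Longrightarrow> y i = y' i" "\<And>i. i \<in> J \<Longrightarrow> z i = z' i" "\<And>i. i \<notin> J \<Longrightarrow> x i = x' i"
  shows "alt J y z f x = alt J y' z' f x'"
  unfolding alt_def
  by (intro sum.cong refl arg_cong2[of _ _ _ _ "(*)"] arg_cong[of _ _ f] ext) (use assms in auto)

text \<open>A monotone primitive \<open>W\<close> of the bound dominates increments; this is the mean value theorem in the form of Cauchy.\<close>

lemma derivative_comparison:
  fixes \<phi> W :: "real \<Rightarrow> real"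
  assumes d: "\<And>s. s \<in> {0<..<1} \<Longrightarrow> (\<phi> has_field_derivative \<phi>' s) (at s)"
      "\<And>s. s \<in> {0<..<1} \<Longrightarrow> (W has_field_derivative W' s) (at s)"
    and le: "\<And>s. s \<in> {0<..<1} \<Longrightarrow> \<bar>\<phi>' s\<bar> \<le> A * W' s"
    and ab: "a \<in> {0<..<1}" "b \<in> {0<..<1}" and A: "A \<ge> 0"
  shows "\<bar>\<phi> a - \<phi> b\<bar> \<le> A * \<bar>W a - W b\<bar>"
proof -
  have *: "\<bar>\<phi> a - \<phi> b\<bar> \<le> A * \<bar>W a - W b\<bar>" if "a \<le> b" "a \<in> {0<..<1}" "b \<in> {0<..<1}" for a b
  proof -
    have "A * W a - \<phi> a \<le> A * W b - \<phi> b"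
    proof (rule DERIV_nonneg_imp_nondecreasing[OF that(1)])
      fix s assume "a \<le> s" "s \<le> b"
      then have s: "s \<in> {0<..<1}" using that by auto
      show "\<exists>y. ((\<lambda>x. A * W x - \<phi> x) has_field_derivative y) (at s) \<and> 0 \<le> y"
        using d(1)[OF s] d(2)[OF s] le[OF s]
        by (intro exI[of _ "A * W' s - \<phi>' s"]) (auto intro!: derivative_eq_intros)
    qed
    moreover have "A * W a + \<phi> a \<le> A * W b + \<phi> b"
    proof (rule DERIV_nonneg_imp_nondecreasing[OF that(1)])
      fix s assume "a \<le> s" "s \<le> b"
      then have s: "s \<in> {0<..<1}" using that by auto
      show "\<exists>y. ((\<lambda>x. A * W x + \<phi> x) has_field_derivative y) (at s) \<and> 0 \<le> y"
        using d(1)[OF s] d(2)[OF s] le[OF s]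
        by (intro exI[of _ "A * W' s + \<phi>' s"]) (auto intro!: derivative_eq_intros)
    qed
    ultimately have "\<bar>\<phi> a - \<phi> b\<bar> \<le> A * (W b - W a)" by (simp add: algebra_simps abs_le_iff)
    also have "\<dots> \<le> A * \<bar>W a - W b\<bar>" using A by (intro mult_left_mono) auto
    finally show ?thesis .
  qed
  show ?thesis
    using *[of a b] *[of b a] ab by (cases "a \<le> b") (auto simp: abs_minus_commute)
qed

text \<open>Induction on the number of coordinates. As a function of the last coordinate, the difference in the
  remaining ones is differentiated by differentiating \<open>g\<close>; the induction hypothesis bounds this derivative,
  with \<open>W'\<close> as the weight of the last coordinate, and comparison with \<open>W\<close> finishes.\<close>

lemma alt_bound:
  fixes g :: "real^'n \<Rightarrow> real"
  assumes W: "\<And>s. s \<in> {0<..<1} \<Longrightarrow> (W has_field_derivative W' s) (at s)"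
    and W'_nonneg: "\<And>s. s \<in> {0<..<1} \<Longrightarrow> 0 \<le> W' s"
    and yz: "\<And>i. y i \<in> {0<..<1}" "\<And>i. z i \<in> {0<..<1}"
  shows "distinct js \<Longrightarrow> partials_exist_on open_cube js g \<Longrightarrow>
    (\<And>i s. i \<notin> set js \<Longrightarrow> s \<in> {0<..<1} \<Longrightarrow> 0 \<le> q i s) \<Longrightarrow>
    (\<And>u. u \<in> open_cube \<Longrightarrow> \<bar>partials js g u\<bar> \<le> (\<Prod>j\<in>set js. W' (u $ j)) * (\<Prod>j\<in>- set js. q j (u $ j))) \<Longrightarrow>
    (\<And>i. x i \<in> {0<..<1}) \<Longrightarrow>
    \<bar>alt (set js) y z (\<lambda>x. g (\<chi> i. x i)) x\<bar> \<le> (\<Prod>j\<in>set js. \<bar>W (y j) - W (z j)\<bar>) * (\<Prod>j\<in>- set js. q j (x j))"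
proof (induction js arbitrary: g q x rule: rev_induct)
  case Nil
  then show ?case using Nil(4)[of "\<chi> i. x i"] by (auto simp: open_cube_def)
next
  case (snoc j js)
  let ?J = "set js"
  have j: "j \<notin> ?J" and dist: "distinct js" using snoc.prems(1) by auto
  have ex: "partials_exist_on open_cube js (partial j g)" "\<And>u. u \<in> open_cube \<Longrightarrow> has_partial j g u"
    using snoc.prems(2) by (auto simp: partials_exist_on_append)
  define \<phi> where "\<phi> s = alt ?J y z (\<lambda>x. g (\<chi> i. x i)) (x(j := s))" for s
  define \<phi>' where "\<phi>' s = alt ?J y z (\<lambda>x. partial j g (\<chi> i. x i)) (x(j := s))" for s
  define A where "A = (\<Prod>j\<in>?J. \<bar>W (y j) - W (z j)\<bar>) * (\<Prod>i\<in>- ?J - {j}. q i (x i))"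
  have A: "A \<ge> 0" unfolding A_def using snoc.prems(3,5) by (intro mult_nonneg_nonneg prod_nonneg) auto
  have split: "(\<Prod>i\<in>- ?J. f i) = f j * (\<Prod>i\<in>- ?J - {j}. f i)" for f :: "'n \<Rightarrow> real"
    using j by (subst prod.remove[of _ j]) auto
  have D: "(\<phi> has_field_derivative \<phi>' s) (at s)" if s: "s \<in> {0<..<1}" for s
    unfolding \<phi>_def \<phi>'_def alt_def
  proof (intro DERIV_sum DERIV_cmult)
    fix S assume S: "S \<in> Pow ?J"
    define c where "c s = (\<chi> i. if i \<in> S then z i else if i \<in> ?J then y i else (x(j := s)) i)" for s
    have c: "c s = c 0 + s *\<^sub>R axis j 1" for s
      using S j by (auto simp: c_def vec_eq_iff axis_def)
    have "c s \<in> open_cube"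
      using yz snoc.prems(5) s by (auto simp: open_cube_def c_def)
    then have "((\<lambda>s. g (c 0 + s *\<^sub>R axis j 1)) has_field_derivative partial j g (c 0 + s *\<^sub>R axis j 1)) (at s)"
      using ex(2) by (intro DERIV_along_axis) (simp add: c[symmetric])
    then show "((\<lambda>s. g (\<chi> i. if i \<in> S then z i else if i \<in> ?J then y i else (x(j := s)) i)) has_field_derivative
        partial j g (\<chi> i. if i \<in> S then z i else if i \<in> ?J then y i else (x(j := s)) i)) (at s)"
      unfolding c_def[symmetric] c[symmetric] .
  qed
  have bd: "\<bar>\<phi>' s\<bar> \<le> A * W' s" if s: "s \<in> {0<..<1}" for s
  proof -
    let ?q = "q(j := \<lambda>s. \<bar>W' s\<bar>)"
    have "\<bar>\<phi>' s\<bar> \<le> (\<Prod>j\<in>?J. \<bar>W (y j) - W (z j)\<bar>) * (\<Prod>i\<in>- ?J. ?q i ((x(j := s)) i))"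
      unfolding \<phi>'_def
    proof (rule snoc.IH[OF dist ex(1)])
      show "0 \<le> ?q i s" if "i \<notin> ?J" "s \<in> {0<..<1}" for i s
        using snoc.prems(3)[of i s] that by auto
      show "(x(j := s)) i \<in> {0<..<1}" for i using snoc.prems(5)[of i] s by auto
      fix u :: "real^'n" assume u: "u \<in> open_cube"
      have "\<bar>partials js (partial j g) u\<bar> \<le> (\<Prod>i\<in>insert j ?J. W' (u $ i)) * (\<Prod>i\<in>- ?J - {j}. q i (u $ i))"
        using snoc.prems(4)[OF u] by (simp add: partials_append Compl_insert)
      also have "\<dots> = (\<Prod>i\<in>?J. W' (u $ i)) * (W' (u $ j) * (\<Prod>i\<in>- ?J - {j}. q i (u $ i)))"
        using j by simp
      finally have *: "\<bar>partials js (partial j g) u\<bar> \<le>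
         (\<Prod>i\<in>?J. W' (u $ i)) * (W' (u $ j) * (\<Prod>i\<in>- ?J - {j}. q i (u $ i)))" .
      have "(\<Prod>i\<in>- ?J. ?q i (u $ i)) = \<bar>W' (u $ j)\<bar> * (\<Prod>i\<in>- ?J - {j}. q i (u $ i))"
        unfolding split by simp
      moreover note W'_nonneg[of "u $ j"]
      ultimately show "\<bar>partials js (partial j g) u\<bar> \<le> (\<Prod>i\<in>?J. W' (u $ i)) * (\<Prod>i\<in>- ?J. ?q i (u $ i))"
        using * u by (auto simp: open_cube_def)
    qed
    also have "\<dots> = A * \<bar>W' s\<bar>" unfolding split A_def by simp
    finally show ?thesis using W'_nonneg[OF s] by simp
  qed
  have "\<bar>\<phi> (y j) - \<phi> (z j)\<bar> \<le> A * \<bar>W (y j) - W (z j)\<bar>"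
    by (rule derivative_comparison[OF D W bd yz A])
  moreover have "alt (set (js @ [j])) y z (\<lambda>x. g (\<chi> i. x i)) x = \<phi> (y j) - \<phi> (z j)"
    using alt_insert[OF finite_set j] by (simp add: \<phi>_def)
  ultimately show ?case using j by (simp add: A_def Compl_insert mult_ac)
qed


text \<open>For \<open>s - r \<ge> r\<close> the difference is at most its first term, otherwise the mean value theorem applies; both
  bounds are multiples of the interpolating right-hand side.\<close>

lemma powr_diff_hoelder:
  fixes s r :: real
  assumes "0 < r" "r \<le> s" "B > 0" "0 < \<theta>" "\<theta> \<le> 1"
  shows "(r powr (- B) - s powr (- B)) / B \<le> (1 + 1 / B) * (s - r) powr \<theta> * r powr (- (B + \<theta>))"
proof -
  have ratio: "((s - r) / r) powr \<theta> * r powr (- B) = (s - r) powr \<theta> * r powr (- (B + \<theta>))"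
    using assms by (simp add: powr_divide powr_diff powr_minus powr_add field_simps)
  have "(r powr (- B) - s powr (- B)) / B \<le> (1 + 1 / B) * (((s - r) / r) powr \<theta> * r powr (- B))"
  proof (cases "r \<le> s - r")
    case True
    then have "1 \<le> ((s - r) / r) powr \<theta>" using assms by (intro ge_one_powr_ge_zero) (auto simp: field_simps)
    then have "r powr (- B) \<le> ((s - r) / r) powr \<theta> * r powr (- B)"
      using mult_right_mono[of 1 "((s - r) / r) powr \<theta>" "r powr (- B)"] by simp
    moreover have "(r powr (- B) - s powr (- B)) / B \<le> r powr (- B) / B"
      using assms by (intro divide_right_mono) auto
    moreover have "r powr (- B) / B \<le> (1 + 1 / B) * r powr (- B)"
      using assms by (simp add: field_simps)
    moreover have "(1 + 1 / B) * r powr (- B) \<le> (1 + 1 / B) * (((s - r) / r) powr \<theta> * r powr (- B))"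
      using assms calculation(1) by (intro mult_left_mono) auto
    ultimately show ?thesis by linarith
  next
    case False
    have "(r powr (- B) - s powr (- B)) / B \<le> r powr (- B - 1) * (s - r)"
    proof (cases "r = s")
      case rs: False
      have "\<exists>x. r < x \<and> x < s \<and> s powr (- B) - r powr (- B) = (s - r) * (- B * x powr (- B - 1))"
      proof (rule MVT2)
        show "r < s" using assms rs by simp
        fix x assume "r \<le> x" "x \<le> s"
        then show "((\<lambda>x. x powr (- B)) has_real_derivative - B * x powr (- B - 1)) (at x)"
          using assms by (auto intro!: derivative_eq_intros)
      qed
      then obtain x where x: "r < x" "x < s" "s powr (- B) - r powr (- B) = (s - r) * (- B * x powr (- B - 1))"
        by blast
      have "(r powr (- B) - s powr (- B)) / B = (s - r) * x powr (- B - 1)"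
        using x(3) assms by (simp add: field_simps)
      also have "\<dots> \<le> (s - r) * r powr (- B - 1)"
        using x assms by (intro mult_left_mono powr_mono2') auto
      finally show ?thesis by (simp add: mult.commute)
    qed auto
    also have "\<dots> = r powr (- B) * ((s - r) / r) powr 1"
      using assms by (simp add: powr_diff)
    also have "\<dots> \<le> r powr (- B) * ((s - r) / r) powr \<theta>"
      using assms False by (intro mult_left_mono powr_mono') (auto simp: field_simps)
    also have "\<dots> \<le> (1 + 1 / B) * (((s - r) / r) powr \<theta> * r powr (- B))"
      using assms by (simp add: field_simps)
    finally show ?thesis .
  qed
  then show ?thesis unfolding ratio by (simp add: mult.assoc)
qed

text \<open>For \<open>0 < s < 1\<close> and \<open>\<gamma> \<ge> 0\<close> this is within a factor 2 of \<open>min s (1 - s) powr (- \<gamma>)\<close>; the sum spares case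
  distinctions on the nearer endpoint.\<close>

definition edge :: "real \<Rightarrow> real \<Rightarrow> real" where
  "edge \<gamma> s = s powr (- \<gamma>) + (1 - s) powr (- \<gamma>)"

lemma edge_nonneg: "0 \<le> edge \<gamma> s"
  by (simp add: edge_def)

text \<open>Trading the exponent: a singularity of order \<open>1 + B\<close> of the derivative is turned into
  the factor \<open>\<bar>y - z\<bar> powr \<theta>\<close> and a weight of order \<open>B + \<theta>\<close>, which is square integrable for \<open>B + \<theta> < 1/2\<close>.\<close>

lemma edge_primitive_hoelder:
  fixes y z :: real
  assumes yz: "y \<in> {0<..<1}" "z \<in> {0<..<1}" and B: "B > 0" and \<theta>: "0 < \<theta>" "\<theta> \<le> 1"
  defines "W \<equiv> \<lambda>s. ((1 - s) powr (- B) - s powr (- B)) / B"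
  shows "\<bar>W y - W z\<bar> \<le> (1 + 1 / B) * \<bar>y - z\<bar> powr \<theta> * (edge (B + \<theta>) y + edge (B + \<theta>) z)"
proof -
  have *: "\<bar>W y - W z\<bar> \<le> (1 + 1 / B) * \<bar>y - z\<bar> powr \<theta> * (edge (B + \<theta>) y + edge (B + \<theta>) z)"
    if le: "z \<le> y" and yz: "y \<in> {0<..<1}" "z \<in> {0<..<1}" for y z
  proof -
    let ?c = "(1 + 1 / B) * \<bar>y - z\<bar> powr \<theta>"
    have c: "?c \<ge> 0" using B by simp
    have 1: "(z powr (- B) - y powr (- B)) / B \<le> ?c * z powr (- (B + \<theta>))"
      using powr_diff_hoelder[of z y B \<theta>] assms le yz by simp
    have 2: "((1 - y) powr (- B) - (1 - z) powr (- B)) / B \<le> ?c * (1 - y) powr (- (B + \<theta>))"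
      using powr_diff_hoelder[of "1 - y" "1 - z" B \<theta>] assms le yz by simp
    have "y powr (- B) \<le> z powr (- B)" "(1 - z) powr (- B) \<le> (1 - y) powr (- B)"
      using le yz B by (auto intro!: powr_mono2')
    then have "(1 - z) powr (- B) - z powr (- B) \<le> (1 - y) powr (- B) - y powr (- B)" by linarith
    then have "W z \<le> W y" unfolding W_def using B by (intro divide_right_mono) auto
    then have "0 \<le> W y - W z" by simp
    then have "\<bar>W y - W z\<bar> = (z powr (- B) - y powr (- B)) / B + ((1 - y) powr (- B) - (1 - z) powr (- B)) / B"
      by (simp add: W_def diff_divide_distrib)
    also have "\<dots> \<le> ?c * (z powr (- (B + \<theta>)) + (1 - y) powr (- (B + \<theta>)))"
      using 1 2 by (simp add: algebra_simps)
    also have "\<dots> \<le> ?c * (edge (B + \<theta>) y + edge (B + \<theta>) z)"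
      using c by (intro mult_left_mono) (auto simp: edge_def)
    finally show ?thesis .
  qed
  show ?thesis
    using *[of y z] *[of z y] yz by (cases "z \<le> y") (auto simp: abs_minus_commute add.commute)
qed

text \<open>A derivative-free form of boundary growth: mixed differences in the coordinates \<open>J\<close> gain the factor
  \<open>\<bar>y\<^sub>j - z\<^sub>j\<bar> powr \<theta>\<close> in each of them, and all weights are square integrable if \<open>\<gamma> < 1/2\<close>.\<close>

definition hoelder_growth :: "real \<Rightarrow> real \<Rightarrow> real \<Rightarrow> (('d::finite \<Rightarrow> real) \<Rightarrow> real) \<Rightarrow> bool" where
  "hoelder_growth C \<theta> \<gamma> h \<longleftrightarrow> (\<forall>J y z x. (\<forall>i. y i \<in> {0<..<1} \<and> z i \<in> {0<..<1} \<and> x i \<in> {0<..<1}) \<longrightarrow>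
    \<bar>alt J y z h x\<bar> \<le> C * (\<Prod>j\<in>J. \<bar>y j - z j\<bar> powr \<theta> * (edge \<gamma> (y j) + edge \<gamma> (z j))) * (\<Prod>j\<in>- J. edge \<gamma> (x j)))"

text \<open>The primitive \<open>W\<close> of \<open>s powr (- B - 1) + (1 - s) powr (- B - 1)\<close> bounds the mixed differences, and its increments
  obey the Hoelder estimate.\<close>

lemma boundary_growth_imp_hoelder_growth:
  fixes h :: "real^'n::{finite,linorder} \<Rightarrow> real"
  assumes h: "boundary_growth h" and B: "B > 0" and \<theta>: "0 < \<theta>" "\<theta> \<le> 1"
  shows "\<exists>C>0. hoelder_growth C \<theta> (B + \<theta>) (\<lambda>s. h (\<chi> j. s j))"
proof -
  define W where "W s = ((1 - s) powr (- B) - s powr (- B)) / B" for s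
  define W' where "W' s = (1 - s) powr (- B - 1) + s powr (- B - 1)" for s
  have W: "(W has_field_derivative W' s) (at s)" if "s \<in> {0<..<1}" for s
    unfolding W_def[abs_def] W'_def using that B
    by (auto intro!: derivative_eq_intros simp: field_simps)
  from h B obtain C where C: "C > 0" "\<And>v u. u \<in> open_cube \<Longrightarrow> \<bar>mixed_partial v h u\<bar> \<le>
          C * (\<Prod>j\<in>UNIV. min (u $ j) (1 - u $ j) powr (- B - of_bool (j \<in> v)))"
    unfolding boundary_growth_def by blast
  have mixed: "partials_exist_on open_cube js h" "\<And>u. u \<in> open_cube \<Longrightarrow> partials js h u = mixed_partial (set js) h u"
    if "distinct js" for js
    using h that unfolding boundary_growth_def mixed_partials_exist_on_def by blast+
  define c where "c = 1 + 1 / B"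
  have c: "c \<ge> 1" using B by (simp add: c_def)
  have "hoelder_growth (C * c ^ CARD('n)) \<theta> (B + \<theta>) (\<lambda>s. h (\<chi> j. s j))"
    unfolding hoelder_growth_def
  proof (intro allI impI)
    fix J :: "'n set" and x y z :: "'n \<Rightarrow> real"
    assume "\<forall>i. y i \<in> {0<..<1} \<and> z i \<in> {0<..<1} \<and> x i \<in> {0<..<1}"
    then have y: "\<And>i. y i \<in> {0<..<1}" and z: "\<And>i. z i \<in> {0<..<1}" and x: "\<And>i. x i \<in> {0<..<1}" by auto
    obtain js where js: "set js = J" "distinct js" using finite_distinct_list[of J] by auto
    let ?e = "edge (B + \<theta>)"
    let ?g = "\<lambda>u. h u / C"
    have scale: "partials_exist_on open_cube ks ?g \<and> (\<forall>u\<in>open_cube. partials ks ?g u = partials ks h u / C)"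
      if "partials_exist_on open_cube ks h" for ks using that
    proof (induction ks)
      case (Cons k ks)
      have *: "((\<lambda>s. partials ks h (u + s *\<^sub>R axis k 1) / C) has_field_derivative partial k (partials ks h) u / C) (at 0)"
        if "u \<in> open_cube" for u
        using Cons.prems that by (intro DERIV_cdivide has_partial_DERIV) auto
      note P = DERIV_has_partial[OF *]
      show ?case
        using Cons partial_cong_open[OF open_open_cube, of _ "partials ks ?g" "\<lambda>u. partials ks h u / C" k] P by simp
    qed simp
    have "\<bar>alt (set js) y z (\<lambda>x. ?g (\<chi> i. x i)) x\<bar> \<le>
        (\<Prod>j\<in>set js. \<bar>W (y j) - W (z j)\<bar>) * (\<Prod>j\<in>- set js. ?e (x j))"
    proof (rule alt_bound[where W' = W' and q = "\<lambda>_. ?e"])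
      show "partials_exist_on open_cube js ?g" using scale mixed(1)[OF js(2)] by blast
      fix u :: "(real, 'n) vec" assume u: "u \<in> open_cube"
      have uj: "0 < u $ j" "u $ j < 1" for j using u by (auto simp: open_cube_def)
      have "\<bar>partials js ?g u\<bar> = \<bar>mixed_partial J h u\<bar> / C"
        using scale[OF mixed(1)[OF js(2)]] mixed(2)[OF js(2) u] u C(1) js by simp
      also have "\<dots> \<le> (\<Prod>j\<in>UNIV. min (u $ j) (1 - u $ j) powr (- B - of_bool (j \<in> J)))"
        using C(2)[OF u, of J] C(1) by (simp add: field_simps)
      also have "\<dots> \<le> (\<Prod>j\<in>UNIV. if j \<in> J then W' (u $ j) else ?e (u $ j))"
      proof (intro prod_mono conjI)
        fix j
        have "min (u $ j) (1 - u $ j) powr (- B - 1) \<le> W' (u $ j)"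
          using uj[of j] by (auto simp: W'_def min_def)
        moreover have "min (u $ j) (1 - u $ j) powr (- B) \<le> min (u $ j) (1 - u $ j) powr (- (B + \<theta>))"
          using uj[of j] \<theta> by (intro powr_mono') auto
        moreover have "min (u $ j) (1 - u $ j) powr (- (B + \<theta>)) \<le> ?e (u $ j)"
          using uj[of j] by (auto simp: edge_def min_def)
        ultimately show "min (u $ j) (1 - u $ j) powr (- B - of_bool (j \<in> J)) \<le> (if j \<in> J then W' (u $ j) else ?e (u $ j))"
          by auto
      qed auto
      also have "\<dots> = (\<Prod>j\<in>set js. W' (u $ j)) * (\<Prod>j\<in>- set js. ?e (u $ j))"
        using js by (simp add: prod.If_cases Compl_eq)
      finally show "\<bar>partials js ?g u\<bar> \<le> (\<Prod>j\<in>set js. W' (u $ j)) * (\<Prod>j\<in>- set js. ?e (u $ j))" .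
    qed (use W y z x js in \<open>auto simp: edge_nonneg W'_def\<close>)
    moreover have "alt (set js) y z (\<lambda>x. ?g (\<chi> i. x i)) x = alt J y z (\<lambda>x. h (\<chi> i. x i)) x / C"
      using js by (simp add: alt_def sum_divide_distrib)
    ultimately have "\<bar>alt J y z (\<lambda>x. h (\<chi> i. x i)) x\<bar> \<le>
        C * ((\<Prod>j\<in>J. \<bar>W (y j) - W (z j)\<bar>) * (\<Prod>j\<in>- J. ?e (x j)))"
      using C(1) js by (simp add: abs_divide pos_divide_le_eq mult.commute)
    also have "\<dots> \<le> C * ((\<Prod>j\<in>J. c * (\<bar>y j - z j\<bar> powr \<theta> * (?e (y j) + ?e (z j)))) * (\<Prod>j\<in>- J. ?e (x j)))"
    proof (intro mult_left_mono mult_right_mono prod_mono conjI)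
      fix j
      show "\<bar>W (y j) - W (z j)\<bar> \<le> c * (\<bar>y j - z j\<bar> powr \<theta> * (?e (y j) + ?e (z j)))"
        using edge_primitive_hoelder[OF y z B \<theta>, of j j] by (simp add: W_def c_def mult.assoc)
    qed (use C(1) in \<open>auto intro!: prod_nonneg simp: edge_nonneg\<close>)
    also have "\<dots> = C * c ^ card J * ((\<Prod>j\<in>J. \<bar>y j - z j\<bar> powr \<theta> * (?e (y j) + ?e (z j))) * (\<Prod>j\<in>- J. ?e (x j)))"
      by (simp add: prod.distrib)
    also have "\<dots> \<le> C * c ^ CARD('n) * ((\<Prod>j\<in>J. \<bar>y j - z j\<bar> powr \<theta> * (?e (y j) + ?e (z j))) * (\<Prod>j\<in>- J. ?e (x j)))"
      using C(1) c by (intro mult_right_mono mult_left_mono power_increasing card_mono)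
        (auto intro!: mult_nonneg_nonneg prod_nonneg simp: edge_nonneg)
    finally show "\<bar>alt J y z (\<lambda>x. h (\<chi> i. x i)) x\<bar> \<le> C * c ^ CARD('n) *
        (\<Prod>j\<in>J. \<bar>y j - z j\<bar> powr \<theta> * (?e (y j) + ?e (z j))) * (\<Prod>j\<in>- J. ?e (x j))"
      by (simp add: mult.assoc)
  qed
  moreover have "C * c ^ CARD('n) > 0" using C c by simp
  ultimately show ?thesis by blast
qed

section \<open>The uniform distribution and resampling\<close>

definition U01 :: "real measure" where
  "U01 = density lborel (indicator {0<..<1})"

lemma sets_U01 [simp, measurable_cong]: "sets U01 = sets borel"
  by (simp add: U01_def)

lemma space_U01 [simp]: "space U01 = UNIV"
  by (simp add: U01_def)

lemma nn_integral_U01: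
  assumes [measurable]: "f \<in> borel_measurable borel"
  shows "(\<integral>\<^sup>+s. f s \<partial>U01) = (\<integral>\<^sup>+s. f s * indicator {0<..<1} s \<partial>lborel)"
  unfolding U01_def by (subst nn_integral_density) (auto simp: mult.commute)

lemma prob_space_U01: "prob_space U01"
proof
  show "emeasure U01 (space U01) = 1"
    using nn_integral_U01[of "\<lambda>_. 1"] by (simp add: nn_integral_indicator)
qed

lemma AE_U01: "AE s in U01. s \<in> {0<..<1}"
  unfolding U01_def by (subst AE_density) (auto simp: indicator_def)

lemma emeasure_U01_greaterThan: "emeasure U01 {a<..} = ennreal (max 0 (min 1 (1 - a)))"
proof -
  have "emeasure U01 {a<..} = emeasure lborel ({a<..} \<inter> {0<..<1})"
    unfolding U01_def by (subst emeasure_density) (auto simp: nn_integral_indicator[symmetric] indicator_inter_arith mult.commute)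
  also have "{a<..} \<inter> {0<..<1} = {max a 0<..<1}" by auto
  also have "emeasure lborel {max a 0<..<1} = ennreal (max 0 (min 1 (1 - a)))"
    by (cases "max a 0 \<le> 1") (auto simp: max_def min_def)
  finally show ?thesis .
qed

text \<open>Self-similarity of the uniform distribution: a uniform leading digit followed by a uniform remainder is
  uniform. Everything below about the laws of scrambled digits rests on this.\<close>

lemma nn_integral_U01_digit:
  assumes [measurable]: "f \<in> borel_measurable borel" and b: "b \<ge> 1"
  shows "(\<Sum>c<b. \<integral>\<^sup>+s. f ((real c + s) / real b) \<partial>U01) = of_nat b * (\<integral>\<^sup>+s. f s \<partial>U01)"
proof -
  have b0: "real b \<noteq> 0" using b by simp
  have 1: "(\<integral>\<^sup>+s. f ((real c + s) / real b) \<partial>U01) =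
     of_nat b * (\<integral>\<^sup>+s. f s * indicator {real c / real b<..<(real c + 1) / real b} s \<partial>lborel)" for c
  proof -
    have "(\<integral>\<^sup>+s. f ((real c + s) / real b) \<partial>U01) =
        (\<integral>\<^sup>+s. f ((real c + s) / real b) * indicator {0<..<1} s \<partial>lborel)"
      by (rule nn_integral_U01) measurable
    also have "\<dots> = \<bar>real b\<bar> * (\<integral>\<^sup>+s. f ((real c + (- real c + real b * s)) / real b) * indicator {0<..<1} (- real c + real b * s) \<partial>lborel)"
      by (rule nn_integral_real_affine[OF _ b0]) measurable
    also have "(\<lambda>s. f ((real c + (- real c + real b * s)) / real b) * indicator {0<..<1} (- real c + real b * s)) =
        (\<lambda>s. f s * indicator {real c / real b<..<(real c + 1) / real b} s)"
      using b by (auto simp: fun_eq_iff indicator_def field_simps)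
    finally show ?thesis by (simp add: ennreal_of_nat_eq_real_of_nat)
  qed
  have AE: "AE s in lborel. (\<Sum>c<b. indicator {real c / real b<..<(real c + 1) / real b} s :: ennreal) = indicator {0<..<1} (s::real)"
  proof -
    have "AE s in lborel. \<forall>c\<in>{..b}. s \<noteq> real c / real b"
      by (rule AE_ball_countable'[OF AE_lborel_singleton]) auto
    then show ?thesis
    proof eventually_elim
      case (elim s)
      show ?case
      proof (cases "s \<in> {0<..<1}")
        case True
        define c where "c = nat \<lfloor>s * real b\<rfloor>"
        have rc: "real c = \<lfloor>s * real b\<rfloor>" using True by (simp add: c_def)
        have c: "real c \<le> s * real b" "s * real b < real c + 1" unfolding rc by linarith+
        have "s * real b < 1 * real b" using True b by (intro mult_strict_right_mono) auto
        then have cb: "c < b" using c(1) by linarith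
        have ne: "real c \<noteq> s * real b" using bspec[OF elim, of c] cb b by (auto simp: field_simps)
        have "(indicator {real c' / real b<..<(real c' + 1) / real b} s :: ennreal) = (if c' = c then 1 else 0)" for c'
        proof -
          have "c' < c \<Longrightarrow> real c' + 1 \<le> real c" "c < c' \<Longrightarrow> real c + 1 \<le> real c'" by linarith+
          then have "real c' < s * real b \<and> s * real b < real c' + 1 \<longleftrightarrow> c' = c"
            using c ne \<open>c' < c \<Longrightarrow> real c' + 1 \<le> real c\<close> \<open>c < c' \<Longrightarrow> real c + 1 \<le> real c'\<close>
            by (cases c' c rule: linorder_cases) auto
          then show ?thesis using b by (auto simp: indicator_def field_simps)
        qed
        then show ?thesis using True cb by simp
      next
        case False
        have "(indicator {real c / real b<..<(real c + 1) / real b} s :: ennreal) = 0" if "c < b" for c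
        proof -
          have "0 \<le> real c / real b" "(real c + 1) / real b \<le> 1" using that by (auto simp: field_simps)
          then have "\<not> (real c / real b < s \<and> s < (real c + 1) / real b)"
            using False by (meson greaterThanLessThan_iff order_le_less_trans order_less_le_trans)
          then show ?thesis by (auto simp: indicator_def)
        qed
        then show ?thesis using False by simp
      qed
    qed
  qed
  have "(\<Sum>c<b. \<integral>\<^sup>+s. f ((real c + s) / real b) \<partial>U01) =
      of_nat b * (\<Sum>c<b. \<integral>\<^sup>+s. f s * indicator {real c / real b<..<(real c + 1) / real b} s \<partial>lborel)"
    by (simp add: 1 sum_distrib_left)
  also have "(\<Sum>c<b. \<integral>\<^sup>+s. f s * indicator {real c / real b<..<(real c + 1) / real b} s \<partial>lborel) =
      (\<integral>\<^sup>+s. f s * (\<Sum>c<b. indicator {real c / real b<..<(real c + 1) / real b} s) \<partial>lborel)"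
    by (subst nn_integral_sum[symmetric]) (auto simp: sum_distrib_left)
  also have "\<dots> = (\<integral>\<^sup>+s. f s \<partial>U01)"
    unfolding nn_integral_U01[OF assms(1)]
    by (rule nn_integral_cong_AE) (use AE in eventually_elim, auto)
  finally show ?thesis .
qed

definition splice :: "'i set \<Rightarrow> ('i \<Rightarrow> 'a) \<Rightarrow> ('i \<Rightarrow> 'a) \<Rightarrow> 'i \<Rightarrow> 'a" where
  "splice A p p' = (\<lambda>i. if i \<in> A then p' i else p i)"

lemma measurable_splice:
  "(\<lambda>(p, p'). splice A p p') \<in> measurable (PiM I M \<Otimes>\<^sub>M PiM I M) (PiM I M)"
  unfolding splice_def
proof (rule measurable_PiM_single', goal_cases)
  case (1 i)
  then show ?case by (cases "i \<in> A") (auto simp: split_def)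
next
  case 2
  then show ?case by (auto simp: space_pair_measure space_PiM PiE_def extensional_def)
qed

lemma splice_in_space:
  "p \<in> space (PiM I M) \<Longrightarrow> p' \<in> space (PiM I M) \<Longrightarrow> splice A p p' \<in> space (PiM I M)"
  by (auto simp: splice_def space_PiM PiE_def extensional_def)

text \<open>Independence in the form used throughout: overwriting the coordinates in \<open>A\<close> by those of an independent
  copy does not change the law, as both sides agree on cylinder sets.\<close>

lemma nn_integral_PiM_resample:
  assumes M: "\<And>i. i \<in> I \<Longrightarrow> prob_space (M i)"
    and \<Phi>[measurable]: "\<Phi> \<in> borel_measurable (PiM I M)"
  shows "(\<integral>\<^sup>+p. \<Phi> p \<partial>PiM I M) = (\<integral>\<^sup>+p. \<integral>\<^sup>+p'. \<Phi> (splice A p p') \<partial>PiM I M \<partial>PiM I M)"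
proof -
  interpret P: prob_space "PiM I M" by (rule prob_space_PiM[OF M])
  interpret PP: pair_prob_space "PiM I M" "PiM I M" ..
  let ?D = "distr (PiM I M \<Otimes>\<^sub>M PiM I M) (PiM I M) (\<lambda>(p, p'). splice A p p')"
  note measurable_splice[measurable]
  have "PiM I M = ?D"
  proof (rule measure_eqI_PiM_infinite[OF refl])
    show "finite_measure (PiM I M)" by unfold_locales
    fix F J assume J: "finite J" "J \<subseteq> I" "\<And>i. i \<in> J \<Longrightarrow> F i \<in> sets (M i)"
    let ?c = "\<lambda>J. prod_emb I M J (Pi\<^sub>E J F)"
    have "emeasure ?D (?c J) = emeasure (PiM I M \<Otimes>\<^sub>M PiM I M)
        ((\<lambda>(p, p'). splice A p p') -` ?c J \<inter> space (PiM I M \<Otimes>\<^sub>M PiM I M))"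
      using J by (intro emeasure_distr sets_PiM_I) auto
    also have "(\<lambda>(p, p'). splice A p p') -` ?c J \<inter> space (PiM I M \<Otimes>\<^sub>M PiM I M) = ?c (J - A) \<times> ?c (J \<inter> A)"
      using J(2) by (auto simp: prod_emb_def splice_def space_pair_measure space_PiM PiE_def Pi_iff extensional_def restrict_def split: if_splits)
    also have "emeasure (PiM I M \<Otimes>\<^sub>M PiM I M) \<dots> = emeasure (PiM I M) (?c (J - A)) * emeasure (PiM I M) (?c (J \<inter> A))"
      using J by (intro P.emeasure_pair_measure_Times sets_PiM_I) auto
    also have "\<dots> = (\<Prod>i\<in>J - A. emeasure (M i) (F i)) * (\<Prod>i\<in>J \<inter> A. emeasure (M i) (F i))"
      using J by (subst (1 2) emeasure_PiM_emb[OF M]) auto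
    also have "\<dots> = (\<Prod>i\<in>J. emeasure (M i) (F i))"
      using J(1) by (subst prod.union_disjoint[symmetric]) (auto intro!: prod.cong)
    also have "\<dots> = emeasure (PiM I M) (?c J)"
      using J by (subst emeasure_PiM_emb[OF M]) auto
    finally show "emeasure (PiM I M) (?c J) = emeasure ?D (?c J)" by simp
  qed simp
  then have "(\<integral>\<^sup>+p. \<Phi> p \<partial>PiM I M) = (\<integral>\<^sup>+p. \<Phi> p \<partial>?D)" by simp
  also have "\<dots> = (\<integral>\<^sup>+q. \<Phi> (case q of (p, p') \<Rightarrow> splice A p p') \<partial>(PiM I M \<Otimes>\<^sub>M PiM I M))"
    by (rule nn_integral_distr) measurable
  also have "\<dots> = (\<integral>\<^sup>+p. \<integral>\<^sup>+p'. \<Phi> (splice A p p') \<partial>PiM I M \<partial>PiM I M)"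
    by (subst P.nn_integral_fst[symmetric]) auto
  finally show ?thesis .
qed

lemma nn_integral_PiM_component:
  assumes M: "\<And>i. i \<in> I \<Longrightarrow> prob_space (M i)" and i: "i \<in> I" and [measurable]: "\<phi> \<in> borel_measurable (M i)"
  shows "(\<integral>\<^sup>+p. \<phi> (p i) \<partial>PiM I M) = (\<integral>\<^sup>+x. \<phi> x \<partial>M i)"
proof -
  have "(\<integral>\<^sup>+x. \<phi> x \<partial>M i) = (\<integral>\<^sup>+x. \<phi> x \<partial>distr (PiM I M) (M i) (\<lambda>p. p i))"
    by (subst distr_PiM_component[of I M i, OF M i]) simp_all
  also have "\<dots> = (\<integral>\<^sup>+p. \<phi> (p i) \<partial>PiM I M)" using i by (intro nn_integral_distr) auto
  finally show ?thesis by simp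
qed

definition Ucube :: "('d::finite \<Rightarrow> real) measure" where
  "Ucube = PiM UNIV (\<lambda>_. U01)"

lemma sets_Ucube [measurable_cong]: "sets Ucube = sets (PiM UNIV (\<lambda>_. borel))"
  unfolding Ucube_def by (intro sets_PiM_cong) auto

lemma space_Ucube [simp]: "space Ucube = UNIV"
  by (simp add: Ucube_def space_PiM)

lemma prob_space_Ucube: "prob_space Ucube"
  unfolding Ucube_def by (intro prob_space_PiM prob_space_U01)

lemma nn_integral_Ucube_resample:
  assumes [measurable]: "\<Phi> \<in> borel_measurable (PiM UNIV (\<lambda>_::'d::finite. borel))"
  shows "(\<integral>\<^sup>+s. \<Phi> s \<partial>Ucube) = (\<integral>\<^sup>+s. \<integral>\<^sup>+t. \<Phi> (s(j := t)) \<partial>U01 \<partial>Ucube)"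
proof -
  have m: "\<Phi> \<in> borel_measurable (PiM UNIV (\<lambda>_::'d. U01))"
    using assms sets_Ucube unfolding Ucube_def by (simp cong: measurable_cong_sets)
  have "(\<integral>\<^sup>+s. \<Phi> s \<partial>Ucube) = (\<integral>\<^sup>+s. \<integral>\<^sup>+s'. \<Phi> (splice {j} s s') \<partial>Ucube \<partial>Ucube)"
    unfolding Ucube_def by (rule nn_integral_PiM_resample[OF prob_space_U01 m])
  also have "\<dots> = (\<integral>\<^sup>+s. \<integral>\<^sup>+s'. \<Phi> (s(j := s' j)) \<partial>Ucube \<partial>Ucube)"
    by (intro nn_integral_cong arg_cong[of _ _ \<Phi>]) (auto simp: splice_def)
  also have "\<dots> = (\<integral>\<^sup>+s. \<integral>\<^sup>+t. \<Phi> (s(j := t)) \<partial>U01 \<partial>Ucube)"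
  proof (intro nn_integral_cong)
    fix s :: "'d \<Rightarrow> real"
    have "(\<lambda>t. s(j := t)) \<in> measurable borel (PiM UNIV (\<lambda>_::'d. borel))"
      by (rule measurable_PiM_single') (auto simp: fun_upd_def)
    then have "(\<lambda>t. \<Phi> (s(j := t))) \<in> borel_measurable borel"
      using assms by (rule measurable_compose)
    then show "(\<integral>\<^sup>+s'. \<Phi> (s(j := s' j)) \<partial>Ucube) = (\<integral>\<^sup>+t. \<Phi> (s(j := t)) \<partial>U01)"
      unfolding Ucube_def by (intro nn_integral_PiM_component prob_space_U01) auto
  qed
  finally show ?thesis .
qed

section \<open>Uniformity of scrambled digit expansions\<close>

lemma emeasure_U01_UNIV: "emeasure U01 UNIV = 1"
  using prob_space.emeasure_space_1[OF prob_space_U01] by simp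

lemma digit_series:
  assumes d: "\<And>l. d l < b" and b: "b \<ge> 2"
  shows "summable (\<lambda>l. real (d l) / real b ^ Suc l)"
    "0 \<le> (\<Sum>l. real (d l) / real b ^ Suc l)" "(\<Sum>l. real (d l) / real b ^ Suc l) \<le> 1"
proof -
  have lim: "(\<lambda>n. (1 / real b) ^ n) \<longlonglongrightarrow> 0"
    using b by (intro LIMSEQ_power_zero) auto
  have "(\<lambda>l. (1 / real b) ^ l - (1 / real b) ^ Suc l) sums ((1 / real b) ^ 0 - 0)"
    by (rule telescope_sums'[OF lim])
  then have S: "(\<lambda>l. (1 / real b) ^ l - (1 / real b) ^ Suc l) sums 1" by simp
  have le: "real (d l) / real b ^ Suc l \<le> (1 / real b) ^ l - (1 / real b) ^ Suc l" for l
  proof -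
    have "real (d l) + 1 \<le> real b" using d[of l] by linarith
    then have "real (d l) / real b ^ Suc l \<le> (real b - 1) / real b ^ Suc l" by (intro divide_right_mono) auto
    also have "\<dots> = (1 / real b) ^ l - (1 / real b) ^ Suc l" using b by (simp add: field_simps)
    finally show ?thesis .
  qed
  show sm: "summable (\<lambda>l. real (d l) / real b ^ Suc l)"
    by (rule summable_comparison_test'[OF sums_summable[OF S]]) (use le in auto)
  show "0 \<le> (\<Sum>l. real (d l) / real b ^ Suc l)" by (rule suminf_nonneg[OF sm]) simp
  show "(\<Sum>l. real (d l) / real b ^ Suc l) \<le> 1"
    using suminf_le[OF le sm sums_summable[OF S]] sums_unique[OF S] by simp
qed

lemma digit_series_split:
  assumes d: "\<And>l. d l < b" and b: "b \<ge> 2"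
  shows "(\<Sum>l. real (d l) / real b ^ Suc l) =
    (\<Sum>l<k. real (d l) / real b ^ Suc l) + (\<Sum>l. real (d (l + k)) / real b ^ Suc l) / real b ^ k"
proof -
  have "(\<Sum>l. real (d (l + k)) / real b ^ Suc (l + k)) = (\<Sum>l. real (d (l + k)) / real b ^ Suc l / real b ^ k)"
    by (simp add: power_add mult_ac)
  also have "\<dots> = (\<Sum>l. real (d (l + k)) / real b ^ Suc l) / real b ^ k"
    by (rule suminf_divide[OF digit_series(1)[of "\<lambda>l. d (l + k)", OF d b]])
  finally show ?thesis
    using suminf_split_initial_segment[OF digit_series(1)[of d b, OF d b], of k] by simp
qed

text \<open>At level \<open>k \<le> N\<close> the remainder \<open>s\<close> stands in for all digits from position \<open>k\<close> on, so that a uniform \<open>s\<close> gives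
  a uniform point of the cell. All levels above \<open>N\<close> denote the number itself; thus a decomposition
  over the levels up to \<open>N + 1\<close> is finite and exact.\<close>

definition blur :: "nat \<Rightarrow> nat \<Rightarrow> (nat \<Rightarrow> nat) \<Rightarrow> nat \<Rightarrow> real \<Rightarrow> real" where
  "blur b N d k s =
     (if k \<le> N then (\<Sum>l<k. real (d l) / real b ^ Suc l) + s / real b ^ k
      else (\<Sum>l. real (d l) / real b ^ Suc l))"

lemma blur_0 [simp]: "blur b N d 0 s = s"
  by (simp add: blur_def)

lemma blur_split:
  assumes d: "\<And>l. d l < b" and b: "b \<ge> 2" and K: "K \<le> N" "K \<le> k"
  shows "blur b N d k s =
    (\<Sum>l<K. real (d l) / real b ^ Suc l) + blur b (N - K) (\<lambda>l. d (l + K)) (k - K) s / real b ^ K"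
proof (cases "k \<le> N")
  case True
  have "(\<Sum>l<k. real (d l) / real b ^ Suc l) =
      (\<Sum>l<K. real (d l) / real b ^ Suc l) + (\<Sum>l=K..<k. real (d l) / real b ^ Suc l)"
    using sum.atLeastLessThan_concat[of 0 K k "\<lambda>l. real (d l) / real b ^ Suc l"] K
    by (simp only: atLeast0LessThan zero_le)
  also have "(\<Sum>l=K..<k. real (d l) / real b ^ Suc l) = (\<Sum>l<k - K. real (d (l + K)) / real b ^ Suc (l + K))"
    by (rule sum.reindex_bij_witness[of _ "\<lambda>l. l + K" "\<lambda>l. l - K"]) auto
  also have "\<dots> = (\<Sum>l<k - K. real (d (l + K)) / real b ^ Suc l) / real b ^ K"
    by (simp add: sum_divide_distrib power_add mult_ac)
  finally show ?thesis
    using K True diff_le_mono[OF True, of K] b by (simp add: blur_def add_divide_distrib power_add[symmetric])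
next
  case False
  then have "\<not> k - K \<le> N - K" using K by linarith
  with False show ?thesis
    using digit_series_split[of d b K, OF d b] by (simp add: blur_def)
qed

lemma finite_digit_perms: "finite (digit_perms b)"
  by (simp add: digit_perms_def finite_permutations)

lemma id_digit_perms: "id \<in> digit_perms b"
  by (simp add: digit_perms_def permutes_id)

lemma digit_perms_less: "q \<in> digit_perms b \<Longrightarrow> a < b \<Longrightarrow> q a < b"
  using permutes_in_image[of q "{..<b}" a] by (auto simp: digit_perms_def)

lemma prob_space_digit_perms: "prob_space (uniform_count_measure (digit_perms b))"
  using finite_digit_perms id_digit_perms by (intro prob_space_uniform_count_measure) auto

text \<open>Averaging \<open>\<phi> (q a)\<close> over all permutations does not depend on \<open>a\<close>, and the sum over \<open>a\<close> is the same for each \<open>q\<close>.\<close>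

lemma nn_integral_perm_digit:
  assumes a: "a < b"
  shows "of_nat b * (\<integral>\<^sup>+q. \<phi> (q a) \<partial>uniform_count_measure (digit_perms b)) = (\<Sum>c<b. \<phi> c :: ennreal)"
proof -
  let ?P = "digit_perms b"
  have card: "card ?P > 0" using finite_digit_perms id_digit_perms by (auto simp: card_gt_0_iff)
  define \<kappa> where "\<kappa> = ennreal (1 / real (card ?P))"
  have \<kappa>: "of_nat (card ?P) * \<kappa> = 1"
    using card unfolding \<kappa>_def ennreal_of_nat_eq_real_of_nat by (simp add: ennreal_mult[symmetric])
  have int: "(\<integral>\<^sup>+q. \<phi> (q a) \<partial>uniform_count_measure ?P) = (\<Sum>q\<in>?P. \<phi> (q a)) * \<kappa>" for a
    unfolding uniform_count_measure_def
    by (subst nn_integral_point_measure_finite[OF finite_digit_perms])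
       (simp add: \<kappa>_def sum_distrib_left mult.commute)
  have sym: "(\<Sum>q\<in>?P. \<phi> (q a')) = (\<Sum>q\<in>?P. \<phi> (q a))" if "a' < b" for a'
  proof -
    have "Transposition.transpose a a' permutes {..<b}" using a that by (intro permutes_swap_id) auto
    from sum_permutations_compose_right[OF this, of "\<lambda>q. \<phi> (q a)"]
    show ?thesis by (simp add: digit_perms_def)
  qed
  have "of_nat b * (\<Sum>q\<in>?P. \<phi> (q a)) = (\<Sum>a'<b. \<Sum>q\<in>?P. \<phi> (q a'))"
    by (simp add: sym)
  also have "\<dots> = (\<Sum>q\<in>?P. \<Sum>a'<b. \<phi> (q a'))" by (rule sum.swap)
  also have "\<dots> = (\<Sum>q\<in>?P. \<Sum>c<b. \<phi> c)"
  proof (rule sum.cong[OF refl])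
    fix q assume "q \<in> ?P"
    then have "q permutes {..<b}" by (simp add: digit_perms_def)
    from sum.permute[OF this, of \<phi>] show "(\<Sum>a'<b. \<phi> (q a')) = (\<Sum>c<b. \<phi> c)" by (simp add: o_def)
  qed
  also have "\<dots> = of_nat (card ?P) * (\<Sum>c<b. \<phi> c)" by simp
  finally have "of_nat b * ((\<Sum>q\<in>?P. \<phi> (q a)) * \<kappa>) = (of_nat (card ?P) * \<kappa>) * (\<Sum>c<b. \<phi> c)"
    by (simp add: mult_ac)
  then show ?thesis by (simp add: int \<kappa>)
qed

definition nodes :: "nat \<Rightarrow> ('d \<times> nat list) set" where
  "nodes b = UNIV \<times> lists {..<b}"

definition Perms :: "nat \<Rightarrow> ('d \<times> nat list \<Rightarrow> nat \<Rightarrow> nat) measure" where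
  "Perms b = PiM (nodes b) (\<lambda>_. uniform_count_measure (digit_perms b))"

lemma prob_space_Perms: "prob_space (Perms b)"
  unfolding Perms_def by (intro prob_space_PiM prob_space_digit_perms)

lemma space_PermsD: "p \<in> space (Perms b) \<Longrightarrow> i \<in> nodes b \<Longrightarrow> p i \<in> digit_perms b"
  using PiE_mem[of p "nodes b" "\<lambda>_. digit_perms b" i]
  by (simp add: Perms_def space_PiM space_uniform_count_measure)

lemma measurable_Perms_component:
  assumes "i \<in> nodes b"
  shows "(\<lambda>p. f (p i)) \<in> measurable (Perms b) (count_space UNIV)"
proof -
  have "(\<lambda>p. p i) \<in> measurable (Perms b) (count_space (digit_perms b))"
    using measurable_component_singleton[OF assms, of "\<lambda>_. uniform_count_measure (digit_perms b)"]
    by (simp add: Perms_def measurable_cong_sets[OF refl sets_uniform_count_measure_count_space])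
  then show ?thesis by (rule measurable_compose) simp
qed

lemma nn_integral_Perms_resample:
  assumes "\<Phi> \<in> borel_measurable (Perms b)"
  shows "(\<integral>\<^sup>+p. \<Phi> p \<partial>Perms b) = (\<integral>\<^sup>+p. \<integral>\<^sup>+p'. \<Phi> (splice A p p') \<partial>Perms b \<partial>Perms b)"
  using assms unfolding Perms_def by (intro nn_integral_PiM_resample prob_space_digit_perms)

lemma nn_integral_Perms_digit:
  assumes "i \<in> nodes b" "a < b"
  shows "of_nat b * (\<integral>\<^sup>+p. \<phi> (p i a) \<partial>Perms b) = (\<Sum>c<b. \<phi> c :: ennreal)"
proof -
  have "(\<integral>\<^sup>+p. \<phi> (p i a) \<partial>Perms b) = (\<integral>\<^sup>+q. \<phi> (q a) \<partial>uniform_count_measure (digit_perms b))"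
    unfolding Perms_def using assms(1)
    by (intro nn_integral_PiM_component prob_space_digit_perms)
       (auto simp: measurable_cong_sets[OF sets_uniform_count_measure_count_space refl])
  then show ?thesis using nn_integral_perm_digit[OF assms(2), of \<phi>] by simp
qed

text \<open>Resampling the permutation at the last node makes the last digit uniform and independent of the
  others; merged with the remainder it becomes a uniform remainder one level higher up.\<close>

lemma nn_integral_truncated_expansion:
  fixes \<nu> :: "nat \<Rightarrow> 'd \<times> nat list"
  assumes b: "b \<ge> 2" and \<nu>: "inj \<nu>" "\<And>l. \<nu> l \<in> nodes b" and a: "\<And>l. a l < b"
    and \<Phi>: "\<Phi> \<in> borel_measurable borel"
  shows "(\<integral>\<^sup>+p. \<integral>\<^sup>+s. \<Phi> ((\<Sum>l<k. real (p (\<nu> l) (a l)) / real b ^ Suc l) + s / real b ^ k) \<partial>U01 \<partial>Perms b)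
    = (\<integral>\<^sup>+s. \<Phi> s \<partial>U01)"
  using \<Phi>
proof (induction k)
  case 0
  interpret prob_space "Perms b :: ('d \<times> nat list \<Rightarrow> nat \<Rightarrow> nat) measure" by (rule prob_space_Perms)
  show ?case by (simp add: emeasure_space_1)
next
  case (Suc k)
  interpret P: prob_space "Perms b :: ('d \<times> nat list \<Rightarrow> nat \<Rightarrow> nat) measure" by (rule prob_space_Perms)
  interpret U: prob_space U01 by (rule prob_space_U01)
  note [measurable] = Suc.prems
  have [measurable]: "(\<lambda>p. real (p (\<nu> l) (a l))) \<in> borel_measurable (Perms b)" for l
    using measurable_compose[OF measurable_Perms_component[OF \<nu>(2), of "\<lambda>q. q (a l)" l], of real borel] by simp
  have ne: "\<nu> l \<noteq> \<nu> k" if "l < k" for l using \<nu>(1) that by (auto dest: injD)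
  have inner: "(\<integral>\<^sup>+p'. \<integral>\<^sup>+s. \<Phi> (y + (real (p' (\<nu> k) (a k)) / real b ^ Suc k + s / real b ^ Suc k)) \<partial>U01 \<partial>Perms b) =
      (\<integral>\<^sup>+s. \<Phi> (y + s / real b ^ k) \<partial>U01)" (is "?L = ?R") for y
  proof -
    have "of_nat b * ?L = (\<Sum>c<b. \<integral>\<^sup>+s. \<Phi> (y + (real c / real b ^ Suc k + s / real b ^ Suc k)) \<partial>U01)"
      by (rule nn_integral_Perms_digit[OF \<nu>(2) a, of "\<lambda>c. \<integral>\<^sup>+s. \<Phi> (y + (real c / real b ^ Suc k + s / real b ^ Suc k)) \<partial>U01"])
    also have "\<dots> = (\<Sum>c<b. \<integral>\<^sup>+s. \<Phi> (y + ((real c + s) / real b) / real b ^ k) \<partial>U01)"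
      by (intro sum.cong nn_integral_cong arg_cong[of _ _ \<Phi>] refl) (simp add: field_simps)
    also have "\<dots> = of_nat b * ?R"
      using b by (intro nn_integral_U01_digit[of "\<lambda>s. \<Phi> (y + s / real b ^ k)"]) auto
    finally show ?thesis using b by (simp add: ennreal_mult_cancel_left)
  qed
  have "(\<integral>\<^sup>+p. \<integral>\<^sup>+s. \<Phi> ((\<Sum>l<Suc k. real (p (\<nu> l) (a l)) / real b ^ Suc l) + s / real b ^ Suc k) \<partial>U01 \<partial>Perms b)
     = (\<integral>\<^sup>+p. \<integral>\<^sup>+p'. \<integral>\<^sup>+s. \<Phi> ((\<Sum>l<Suc k. real (splice {\<nu> k} p p' (\<nu> l) (a l)) / real b ^ Suc l) + s / real b ^ Suc k) \<partial>U01 \<partial>Perms b \<partial>Perms b)"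
    by (rule nn_integral_Perms_resample) measurable
  also have "\<dots> = (\<integral>\<^sup>+p. \<integral>\<^sup>+p'. \<integral>\<^sup>+s. \<Phi> ((\<Sum>l<k. real (p (\<nu> l) (a l)) / real b ^ Suc l) +
      (real (p' (\<nu> k) (a k)) / real b ^ Suc k + s / real b ^ Suc k)) \<partial>U01 \<partial>Perms b \<partial>Perms b)"
  proof (intro nn_integral_cong arg_cong[of _ _ \<Phi>])
    fix p p' :: "'d \<times> nat list \<Rightarrow> nat \<Rightarrow> nat" and s
    have "(\<Sum>l<k. real (splice {\<nu> k} p p' (\<nu> l) (a l)) / real b ^ Suc l) = (\<Sum>l<k. real (p (\<nu> l) (a l)) / real b ^ Suc l)"
      by (intro sum.cong) (use ne in \<open>auto simp: splice_def\<close>)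
    then show "(\<Sum>l<Suc k. real (splice {\<nu> k} p p' (\<nu> l) (a l)) / real b ^ Suc l) + s / real b ^ Suc k =
      (\<Sum>l<k. real (p (\<nu> l) (a l)) / real b ^ Suc l) + (real (p' (\<nu> k) (a k)) / real b ^ Suc k + s / real b ^ Suc k)"
      by (simp add: splice_def)
  qed
  also have "\<dots> = (\<integral>\<^sup>+p. \<integral>\<^sup>+s. \<Phi> ((\<Sum>l<k. real (p (\<nu> l) (a l)) / real b ^ Suc l) + s / real b ^ k) \<partial>U01 \<partial>Perms b)"
    by (simp only: inner)
  also have "\<dots> = (\<integral>\<^sup>+s. \<Phi> s \<partial>U01)" by (rule Suc.IH[OF Suc.prems])
  finally show ?case .
qed

text \<open>The full expansion and the truncated one with a remainder differ by at most \<open>b ^ (-k)\<close>, so their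
  distribution functions agree up to a shift of the argument by that amount, for every \<open>k\<close>.\<close>

lemma distr_infinite_expansion:
  fixes \<nu> :: "nat \<Rightarrow> 'd \<times> nat list"
  assumes b: "b \<ge> 2" and \<nu>: "inj \<nu>" "\<And>l. \<nu> l \<in> nodes b" and a: "\<And>l. a l < b"
  shows "distr (Perms b) borel (\<lambda>p. \<Sum>l. real (p (\<nu> l) (a l)) / real b ^ Suc l) = U01" (is "distr ?P _ ?\<tau> = _")
proof -
  interpret P: prob_space ?P by (rule prob_space_Perms)
  interpret U: prob_space U01 by (rule prob_space_U01)
  have [measurable]: "(\<lambda>p. real (p (\<nu> l) (a l))) \<in> borel_measurable ?P" for l
    using measurable_compose[OF measurable_Perms_component[OF \<nu>(2), of "\<lambda>q. q (a l)" l], of real borel] by simp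
  have m[measurable]: "?\<tau> \<in> borel_measurable ?P" by measurable
  interpret D: prob_space "distr ?P borel ?\<tau>" by (rule P.prob_space_distr[OF m])
  have fin: "emeasure (distr ?P borel ?\<tau>) {x<..} < \<infinity>" for x
    unfolding D.emeasure_eq_measure by simp
  have eq: "emeasure (distr ?P borel ?\<tau>) {x<..} = emeasure U01 {x<..}" for x
  proof -
    define f where "f x = max 0 (min 1 (1 - x :: real))" for x
    define r where "r = measure (distr ?P borel ?\<tau>) {x<..}"
    have r: "emeasure (distr ?P borel ?\<tau>) {x<..} = ennreal r" "r \<ge> 0"
      unfolding r_def by (rule D.emeasure_eq_measure) simp
    have tail: "(\<integral>\<^sup>+p. \<integral>\<^sup>+s. indicator {x<..} (?\<tau> p) \<partial>U01 \<partial>?P) = ennreal r"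
    proof -
      have "(\<integral>\<^sup>+p. indicator {x<..} (?\<tau> p) \<partial>?P) = (\<integral>\<^sup>+t. indicator {x<..} t \<partial>distr ?P borel ?\<tau>)"
        by (rule nn_integral_distr[symmetric]) measurable
      also have "\<dots> = ennreal r" unfolding r(1)[symmetric] by (rule nn_integral_indicator) simp
      finally show ?thesis by (simp only: nn_integral_const space_U01 emeasure_U01_UNIV mult_1_right)
    qed
    have "\<bar>r - f x\<bar> \<le> (1 / real b) ^ k" for k
    proof -
      let ?e = "(1 / real b) ^ k"
      let ?Y = "\<lambda>p s. (\<Sum>l<k. real (p (\<nu> l) (a l)) / real b ^ Suc l) + s / real b ^ k"
      have close: "\<bar>?\<tau> p - ?Y p s\<bar> \<le> ?e" if p: "p \<in> space ?P" and s: "s \<in> {0<..<1}" for p s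
      proof -
        have d: "p (\<nu> l) (a l) < b" for l using digit_perms_less[OF space_PermsD[OF p \<nu>(2)] a] .
        let ?t = "\<Sum>l. real (p (\<nu> (l + k)) (a (l + k))) / real b ^ Suc l"
        have t: "0 \<le> ?t" "?t \<le> 1" using digit_series[OF d b, of "\<lambda>l. l + k"] by auto
        have "?\<tau> p - ?Y p s = (?t - s) / real b ^ k"
          using digit_series_split[of "\<lambda>l. p (\<nu> l) (a l)" b k, OF d b] by (simp add: diff_divide_distrib)
        moreover have "\<bar>?t - s\<bar> \<le> 1" using t s by auto
        ultimately show ?thesis using b by (simp add: power_one_over divide_simps)
      qed
      have le1: "ennreal (f (x + ?e)) \<le> ennreal r"
      proof -
        have "ennreal (f (x + ?e)) = (\<integral>\<^sup>+s. indicator {x + ?e<..} s \<partial>U01)"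
          by (simp add: f_def emeasure_U01_greaterThan)
        also have "\<dots> = (\<integral>\<^sup>+p. \<integral>\<^sup>+s. indicator {x + ?e<..} (?Y p s) \<partial>U01 \<partial>?P)"
          by (rule nn_integral_truncated_expansion[OF b \<nu> a, symmetric]) measurable
        also have "\<dots> \<le> (\<integral>\<^sup>+p. \<integral>\<^sup>+s. indicator {x<..} (?\<tau> p) \<partial>U01 \<partial>?P)"
        proof (rule nn_integral_mono, rule nn_integral_mono_AE)
          fix p assume p: "p \<in> space ?P"
          show "AE s in U01. indicator {x + ?e<..} (?Y p s) \<le> (indicator {x<..} (?\<tau> p) :: ennreal)"
            using AE_U01 by eventually_elim (use close[OF p] in \<open>fastforce simp: indicator_def\<close>)
        qed
        finally show ?thesis unfolding tail .
      qed
      have le2: "ennreal r \<le> ennreal (f (x - ?e))"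
      proof -
        have "ennreal r = (\<integral>\<^sup>+p. \<integral>\<^sup>+s. indicator {x<..} (?\<tau> p) \<partial>U01 \<partial>?P)" by (simp only: tail)
        also have "\<dots> \<le> (\<integral>\<^sup>+p. \<integral>\<^sup>+s. indicator {x - ?e<..} (?Y p s) \<partial>U01 \<partial>?P)"
        proof (rule nn_integral_mono, rule nn_integral_mono_AE)
          fix p assume p: "p \<in> space ?P"
          show "AE s in U01. (indicator {x<..} (?\<tau> p) :: ennreal) \<le> indicator {x - ?e<..} (?Y p s)"
            using AE_U01 by eventually_elim (use close[OF p] in \<open>fastforce simp: indicator_def\<close>)
        qed
        also have "\<dots> = (\<integral>\<^sup>+s. indicator {x - ?e<..} s \<partial>U01)"
          by (rule nn_integral_truncated_expansion[OF b \<nu> a]) measurable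
        also have "\<dots> = ennreal (f (x - ?e))" by (simp add: f_def emeasure_U01_greaterThan)
        finally show ?thesis .
      qed
      have "f (x + ?e) \<le> r" "r \<le> f (x - ?e)" using le1 le2 r(2) by (auto simp: f_def ennreal_le_iff2)
      moreover have "f (x - e) \<le> f x + e" "f x - e \<le> f (x + e)" if "e \<ge> 0" for e
        using that by (auto simp: f_def max_def min_def)
      from this[of ?e] have "f (x - ?e) \<le> f x + ?e" "f x - ?e \<le> f (x + ?e)" by auto
      ultimately show ?thesis by linarith
    qed
    moreover have "(\<lambda>k. (1 / real b) ^ k) \<longlonglongrightarrow> 0" using b by (intro LIMSEQ_power_zero) auto
    ultimately have "\<bar>r - f x\<bar> \<le> 0" by (intro LIMSEQ_le_const) auto
    then show "emeasure (distr ?P borel ?\<tau>) {x<..} = emeasure U01 {x<..}"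
      unfolding r(1) emeasure_U01_greaterThan by (simp add: f_def)
  qed
  show ?thesis by (rule measure_eqI_lessThan[OF _ _ fin eq]) simp_all
qed

lemma nn_integral_blur:
  fixes \<nu> :: "nat \<Rightarrow> 'd \<times> nat list"
  assumes b: "b \<ge> 2" and \<nu>: "inj \<nu>" "\<And>l. \<nu> l \<in> nodes b" and a: "\<And>l. a l < b"
    and \<Phi>[measurable]: "\<Phi> \<in> borel_measurable borel"
  shows "(\<integral>\<^sup>+p. \<integral>\<^sup>+s. \<Phi> (blur b N (\<lambda>l. p (\<nu> l) (a l)) k s) \<partial>U01 \<partial>Perms b) = (\<integral>\<^sup>+s. \<Phi> s \<partial>U01)"
proof (cases "k \<le> N")
  case True
  then show ?thesis unfolding blur_def using nn_integral_truncated_expansion[OF assms] by simp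
next
  case False
  interpret U: prob_space U01 by (rule prob_space_U01)
  have [measurable]: "(\<lambda>p. real (p (\<nu> l) (a l))) \<in> borel_measurable (Perms b)" for l
    using measurable_compose[OF measurable_Perms_component[OF \<nu>(2), of "\<lambda>q. q (a l)" l], of real borel] by simp
  have "(\<integral>\<^sup>+s. \<Phi> s \<partial>U01) = (\<integral>\<^sup>+s. \<Phi> s \<partial>distr (Perms b) borel (\<lambda>p. \<Sum>l. real (p (\<nu> l) (a l)) / real b ^ Suc l))"
    by (simp only: distr_infinite_expansion[OF b \<nu> a])
  also have "\<dots> = (\<integral>\<^sup>+p. \<Phi> (\<Sum>l. real (p (\<nu> l) (a l)) / real b ^ Suc l) \<partial>Perms b)"
    by (rule nn_integral_distr) measurable
  finally show ?thesis using False by (simp add: blur_def emeasure_U01_UNIV)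
qed

section \<open>Joint laws of blurred scrambled points\<close>

definition scrambled_digit :: "('d \<times> nat list \<Rightarrow> nat \<Rightarrow> nat) \<Rightarrow> ('d \<Rightarrow> nat \<Rightarrow> nat) \<Rightarrow> 'd \<Rightarrow> nat \<Rightarrow> nat" where
  "scrambled_digit p \<alpha> j l = p (j, map (\<alpha> j) [0..<l]) (\<alpha> j l)"

definition blurred :: "nat \<Rightarrow> nat \<Rightarrow> ('d \<times> nat list \<Rightarrow> nat \<Rightarrow> nat) \<Rightarrow> ('d \<Rightarrow> nat \<Rightarrow> nat) \<Rightarrow>
    ('d \<Rightarrow> nat) \<Rightarrow> ('d \<Rightarrow> real) \<Rightarrow> 'd \<Rightarrow> real" where
  "blurred b N p \<alpha> k s = (\<lambda>j. blur b N (scrambled_digit p \<alpha> j) (k j) (s j))"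

lemma measurable_PiM_borelI:
  assumes "\<And>i. (\<lambda>x. f x i) \<in> borel_measurable M"
  shows "f \<in> measurable M (PiM UNIV (\<lambda>_. borel))"
  by (rule measurable_PiM_single') (use assms in \<open>auto simp: space_PiM\<close>)

lemma node_in_nodes: "(\<And>j l. \<alpha> j l < b) \<Longrightarrow> (j, map (\<alpha> j) [0..<l]) \<in> nodes b"
  by (auto simp: nodes_def)

lemma measurable_scrambled_digit:
  assumes "\<And>j l. \<alpha> j l < b"
  shows "(\<lambda>p. real (scrambled_digit p \<alpha> j l)) \<in> borel_measurable (Perms b)"
  unfolding scrambled_digit_def
  using measurable_compose[OF measurable_Perms_component[OF node_in_nodes[OF assms]], of real borel] by simp

lemma scrambled_digit_less:
  assumes "p \<in> space (Perms b)" "\<And>j l. \<alpha> j l < b"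
  shows "scrambled_digit p \<alpha> j l < b"
  unfolding scrambled_digit_def
  by (rule digit_perms_less[OF space_PermsD[OF assms(1) node_in_nodes[OF assms(2)]] assms(2)])

lemma measurable_blur:
  assumes "\<And>l. (\<lambda>x. real (d x l)) \<in> borel_measurable M" "s \<in> borel_measurable M"
  shows "(\<lambda>x. blur b N (d x) k (s x)) \<in> borel_measurable M"
proof -
  note [measurable] = assms
  show ?thesis unfolding blur_def by (cases "k \<le> N") simp_all
qed

lemma measurable_component_Ucube:
  "(\<lambda>s. s j) \<in> borel_measurable Ucube"
  using measurable_component_singleton[of j UNIV "\<lambda>_. borel"]
  by (simp add: measurable_cong_sets[OF sets_Ucube refl])

lemma measurable_blurred:
  assumes "\<And>j l. \<alpha> j l < b"
  shows "(\<lambda>(p, s). blurred b N p \<alpha> k s) \<in> measurable (Perms b \<Otimes>\<^sub>M Ucube) (PiM UNIV (\<lambda>_. borel))"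
proof -
  note [measurable] = measurable_scrambled_digit[OF assms] measurable_component_Ucube
  show ?thesis
    unfolding blurred_def split_beta
    by (intro measurable_PiM_borelI measurable_blur) measurable
qed

text \<open>Blurring coordinate \<open>j\<close> more strongly does not change the joint law with any quantity that does not
  look at the permutations for the digits of coordinate \<open>j\<close> from position \<open>K\<close> on: given everything else, those
  digits and the remainder make up a uniform number.\<close>

lemma nn_integral_blurred_step:
  fixes \<alpha> :: "'d::finite \<Rightarrow> nat \<Rightarrow> nat" and r :: "_ \<Rightarrow> real"
  assumes b: "b \<ge> 2" and \<alpha>: "\<And>j l. \<alpha> j l < b" and K: "K \<le> N" "K \<le> k j"
    and r: "r \<in> borel_measurable (Perms b)"
    and inv: "\<And>p p'. r (splice {(j, map (\<alpha> j) [0..<l]) | l. l \<ge> K} p p') = r p"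
    and \<Phi>: "\<Phi> \<in> borel_measurable (PiM UNIV (\<lambda>_. borel) \<Otimes>\<^sub>M borel)"
  shows "(\<integral>\<^sup>+p. \<integral>\<^sup>+s. \<Phi> (blurred b N p \<alpha> k s, r p) \<partial>Ucube \<partial>Perms b) =
    (\<integral>\<^sup>+p. \<integral>\<^sup>+s. \<Phi> (blurred b N p \<alpha> (k(j := K)) s, r p) \<partial>Ucube \<partial>Perms b)"
proof -
  interpret P: prob_space "Perms b :: ('d \<times> nat list \<Rightarrow> nat \<Rightarrow> nat) measure" by (rule prob_space_Perms)
  interpret C: prob_space "Ucube :: ('d \<Rightarrow> real) measure" by (rule prob_space_Ucube)
  interpret U: prob_space U01 by (rule prob_space_U01)
  interpret PC: pair_prob_space "Perms b :: ('d \<times> nat list \<Rightarrow> nat \<Rightarrow> nat) measure" "Ucube :: ('d \<Rightarrow> real) measure" ..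
  note [measurable] = r measurable_scrambled_digit[OF \<alpha>] measurable_component_Ucube measurable_blur \<Phi>
  note mb = measurable_blurred[of \<alpha>, OF \<alpha>]
  define A where "A = {(j, map (\<alpha> j) [0..<l]) | l. l \<ge> K}"
  define Y where "Y p = (\<Sum>l<K. real (scrambled_digit p \<alpha> j l) / real b ^ Suc l)" for p
  define V where "V p t = blur b (N - K) (\<lambda>l. scrambled_digit p \<alpha> j (l + K)) (k j - K) t" for p t
  have [measurable]: "Y \<in> borel_measurable (Perms b)" unfolding Y_def by measurable
  have V[measurable]: "(\<lambda>(p, t). V p t) \<in> borel_measurable (Perms b \<Otimes>\<^sub>M borel)"
    unfolding V_def split_beta by (rule measurable_blur) measurable
  define W where "W p s v = (blurred b N p \<alpha> k s)(j := Y p + v / real b ^ K)" for p s v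
  have W_upd: "W p (s(j := t)) v = W p s v" for p s t v
    by (auto simp: W_def blurred_def)
  have W_meas: "(\<lambda>x. W p (s x) (v x)) \<in> measurable M (PiM UNIV (\<lambda>_. borel))"
    if "p \<in> space (Perms b)" "s \<in> measurable M Ucube" "v \<in> borel_measurable M" for p s v and M :: "'z measure"
  proof (rule measurable_PiM_borelI)
    fix i
    have "(\<lambda>x. s x i) \<in> borel_measurable M" using that(2) measurable_component_Ucube by (rule measurable_compose)
    then show "(\<lambda>x. W p (s x) (v x) i) \<in> borel_measurable M"
      using that(3) unfolding W_def blurred_def by (cases "i = j") (auto intro!: measurable_blur)
  qed
  have \<Phi>1: "(\<lambda>x. \<Phi> (x, c)) \<in> borel_measurable (PiM UNIV (\<lambda>_. borel))" for c by measurable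
  have spl: "blurred b N (splice A p p') \<alpha> k s = W p s (V p' (s j))"
    if "p \<in> space (Perms b)" "p' \<in> space (Perms b)" for p p' s
  proof
    fix i
    have sp: "splice A p p' \<in> space (Perms b)" using that unfolding Perms_def by (rule splice_in_space)
    show "blurred b N (splice A p p') \<alpha> k s i = W p s (V p' (s j)) i"
    proof (cases "i = j")
      case False
      then have "scrambled_digit (splice A p p') \<alpha> i l = scrambled_digit p \<alpha> i l" for l
        by (auto simp: scrambled_digit_def splice_def A_def)
      then have "scrambled_digit (splice A p p') \<alpha> i = scrambled_digit p \<alpha> i" by blast
      then show ?thesis using False by (simp add: blurred_def W_def)
    next
      case True
      have lo: "scrambled_digit (splice A p p') \<alpha> j l = scrambled_digit p \<alpha> j l" if "l < K" for l
      proof -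
        have "(j, map (\<alpha> j) [0..<l]) \<notin> A"
          using that by (auto simp: A_def dest!: map_eq_imp_length_eq)
        then show ?thesis by (simp add: scrambled_digit_def splice_def)
      qed
      have hi: "scrambled_digit (splice A p p') \<alpha> j (l + K) = scrambled_digit p' \<alpha> j (l + K)" for l
        by (auto simp: scrambled_digit_def splice_def A_def)
      show ?thesis
        unfolding blurred_def W_def True
        by (subst blur_split[OF scrambled_digit_less[OF sp \<alpha>] b K]) (simp add: Y_def V_def lo hi)
    qed
  qed
  have "(\<integral>\<^sup>+p. \<integral>\<^sup>+s. \<Phi> (blurred b N p \<alpha> k s, r p) \<partial>Ucube \<partial>Perms b) =
      (\<integral>\<^sup>+p. \<integral>\<^sup>+p'. \<integral>\<^sup>+s. \<Phi> (blurred b N (splice A p p') \<alpha> k s, r (splice A p p')) \<partial>Ucube \<partial>Perms b \<partial>Perms b)"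
  proof (rule nn_integral_Perms_resample)
    have "(\<lambda>(p, s). \<Phi> (blurred b N p \<alpha> k s, r p)) \<in> borel_measurable (Perms b \<Otimes>\<^sub>M Ucube)"
      using mb[of N k] by (auto simp: split_beta intro!: measurable_compose[OF _ \<Phi>] measurable_Pair)
    then show "(\<lambda>p. \<integral>\<^sup>+s. \<Phi> (blurred b N p \<alpha> k s, r p) \<partial>Ucube) \<in> borel_measurable (Perms b)"
      by (rule C.borel_measurable_nn_integral)
  qed
  also have "\<dots> = (\<integral>\<^sup>+p. \<integral>\<^sup>+p'. \<integral>\<^sup>+s. \<Phi> (W p s (V p' (s j)), r p) \<partial>Ucube \<partial>Perms b \<partial>Perms b)"
    by (intro nn_integral_cong) (simp add: spl inv[folded A_def])
  also have "\<dots> = (\<integral>\<^sup>+p. \<integral>\<^sup>+p'. \<integral>\<^sup>+s. \<integral>\<^sup>+t. \<Phi> (W p s (V p' t), r p) \<partial>U01 \<partial>Ucube \<partial>Perms b \<partial>Perms b)"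
  proof (rule nn_integral_cong, rule nn_integral_cong)
    fix p p' :: "'d \<times> nat list \<Rightarrow> nat \<Rightarrow> nat" assume p: "p \<in> space (Perms b)" and p': "p' \<in> space (Perms b)"
    have 1: "(\<lambda>t. V p' t) \<in> borel_measurable borel" using measurable_Pair2[OF V p'] by simp
    have "(\<lambda>s. W p s (V p' (s j))) \<in> measurable (PiM UNIV (\<lambda>_. borel)) (PiM UNIV (\<lambda>_. borel))"
      using measurable_compose[OF measurable_component_singleton[of j UNIV "\<lambda>_. borel"] 1]
      by (intro W_meas[OF p]) (auto simp: measurable_cong_sets[OF refl sets_Ucube])
    from nn_integral_Ucube_resample[OF measurable_compose[OF this \<Phi>1], of "r p" j]
    show "(\<integral>\<^sup>+s. \<Phi> (W p s (V p' (s j)), r p) \<partial>Ucube) = (\<integral>\<^sup>+s. \<integral>\<^sup>+t. \<Phi> (W p s (V p' t), r p) \<partial>U01 \<partial>Ucube)"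
      by (simp add: W_upd)
  qed
  also have "\<dots> = (\<integral>\<^sup>+p. \<integral>\<^sup>+s. \<integral>\<^sup>+p'. \<integral>\<^sup>+t. \<Phi> (W p s (V p' t), r p) \<partial>U01 \<partial>Perms b \<partial>Ucube \<partial>Perms b)"
  proof (rule nn_integral_cong)
    fix p :: "'d \<times> nat list \<Rightarrow> nat \<Rightarrow> nat" assume p: "p \<in> space (Perms b)"
    have "(\<lambda>x. W p (snd (fst x)) (V (fst (fst x)) (snd x))) \<in>
        measurable ((Perms b \<Otimes>\<^sub>M Ucube) \<Otimes>\<^sub>M U01) (PiM UNIV (\<lambda>_. borel))"
      by (intro W_meas[OF p]) measurable
    from measurable_compose[OF this \<Phi>1[of "r p"]]
    have "(\<lambda>(q, t). \<Phi> (W p (snd q) (V (fst q) t), r p)) \<in> borel_measurable ((Perms b \<Otimes>\<^sub>M Ucube) \<Otimes>\<^sub>M U01)"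
      by (simp add: split_beta)
    from U.borel_measurable_nn_integral[OF this]
    have m: "(\<lambda>(p', s). \<integral>\<^sup>+t. \<Phi> (W p s (V p' t), r p) \<partial>U01) \<in> borel_measurable (Perms b \<Otimes>\<^sub>M Ucube)"
      by (simp add: split_beta)
    show "(\<integral>\<^sup>+p'. \<integral>\<^sup>+s. \<integral>\<^sup>+t. \<Phi> (W p s (V p' t), r p) \<partial>U01 \<partial>Ucube \<partial>Perms b) =
        (\<integral>\<^sup>+s. \<integral>\<^sup>+p'. \<integral>\<^sup>+t. \<Phi> (W p s (V p' t), r p) \<partial>U01 \<partial>Perms b \<partial>Ucube)"
      using PC.Fubini[OF m] by simp
  qed
  also have "\<dots> = (\<integral>\<^sup>+p. \<integral>\<^sup>+s. \<integral>\<^sup>+t. \<Phi> (W p s t, r p) \<partial>U01 \<partial>Ucube \<partial>Perms b)"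
  proof (rule nn_integral_cong, rule nn_integral_cong)
    fix p :: "'d \<times> nat list \<Rightarrow> nat \<Rightarrow> nat" and s :: "'d \<Rightarrow> real" assume p: "p \<in> space (Perms b)"
    have "(\<lambda>v. \<Phi> (W p s v, r p)) \<in> borel_measurable borel"
      by (rule measurable_compose[OF W_meas[OF p] \<Phi>1]) auto
    moreover have "inj (\<lambda>l. (j, map (\<alpha> j) [0..<l + K]))"
      by (rule injI) (auto dest!: map_eq_imp_length_eq)
    ultimately have "(\<integral>\<^sup>+p'. \<integral>\<^sup>+t. \<Phi> (W p s (blur b (N - K) (\<lambda>l. p' (j, map (\<alpha> j) [0..<l + K]) (\<alpha> j (l + K))) (k j - K) t), r p) \<partial>U01 \<partial>Perms b) =
        (\<integral>\<^sup>+t. \<Phi> (W p s t, r p) \<partial>U01)"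
      by (intro nn_integral_blur[OF b _ node_in_nodes[OF \<alpha>] \<alpha>, where N = "N - K" and k = "k j - K" and
          \<Phi> = "\<lambda>v. \<Phi> (W p s v, r p)"])
    then show "(\<integral>\<^sup>+p'. \<integral>\<^sup>+t. \<Phi> (W p s (V p' t), r p) \<partial>U01 \<partial>Perms b) = (\<integral>\<^sup>+t. \<Phi> (W p s t, r p) \<partial>U01)"
      by (simp add: V_def scrambled_digit_def)
  qed
  also have "\<dots> = (\<integral>\<^sup>+p. \<integral>\<^sup>+s. \<Phi> (blurred b N p \<alpha> (k(j := K)) s, r p) \<partial>Ucube \<partial>Perms b)"
  proof (rule nn_integral_cong)
    fix p :: "'d \<times> nat list \<Rightarrow> nat \<Rightarrow> nat" assume p: "p \<in> space (Perms b)"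
    have eq: "blurred b N p \<alpha> (k(j := K)) s = W p s (s j)" for s
      using K by (auto simp: blurred_def W_def Y_def blur_def)
    have "(\<lambda>s. W p s (s j)) \<in> measurable (PiM UNIV (\<lambda>_. borel)) (PiM UNIV (\<lambda>_. borel))"
      by (intro W_meas[OF p]) (auto simp: measurable_cong_sets[OF refl sets_Ucube])
    from nn_integral_Ucube_resample[OF measurable_compose[OF this \<Phi>1], of "r p" j]
    show "(\<integral>\<^sup>+s. \<integral>\<^sup>+t. \<Phi> (W p s t, r p) \<partial>U01 \<partial>Ucube) = (\<integral>\<^sup>+s. \<Phi> (blurred b N p \<alpha> (k(j := K)) s, r p) \<partial>Ucube)"
      by (simp add: W_upd eq)
  qed
  finally show ?thesis .
qed


lemma nn_integral_blurred:
  fixes \<alpha> :: "'d::finite \<Rightarrow> nat \<Rightarrow> nat"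
  assumes b: "b \<ge> 2" and \<alpha>: "\<And>j l. \<alpha> j l < b" and \<Phi>[measurable]: "\<Phi> \<in> borel_measurable (PiM UNIV (\<lambda>_. borel))"
  shows "(\<integral>\<^sup>+p. \<integral>\<^sup>+s. \<Phi> (blurred b N p \<alpha> k s) \<partial>Ucube \<partial>Perms b) = (\<integral>\<^sup>+s. \<Phi> s \<partial>Ucube)"
proof -
  interpret P: prob_space "Perms b :: ('d \<times> nat list \<Rightarrow> nat \<Rightarrow> nat) measure" by (rule prob_space_Perms)
  define I where "I k = (\<integral>\<^sup>+p. \<integral>\<^sup>+s. \<Phi> (blurred b N p \<alpha> k s) \<partial>Ucube \<partial>Perms b)" for k
  have step: "I k = I (k(j := 0))" for k j
    using nn_integral_blurred_step[where K = 0 and N = N and k = k and j = j and r = "\<lambda>_. 0" and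
        \<Phi> = "\<lambda>x. \<Phi> (fst x)" and \<alpha> = \<alpha> and b = b, OF b \<alpha>] by (simp add: I_def)
  have "finite J \<Longrightarrow> I k = I (\<lambda>j. if j \<in> J then 0 else k j)" for J
  proof (induction J rule: finite_induct)
    case (insert j J)
    have "(\<lambda>i. if i \<in> insert j J then 0 else k i) = (\<lambda>i. if i \<in> J then 0 else k i)(j := 0)" by auto
    with insert.IH step show ?case by simp
  qed simp
  from this[of UNIV] have "I k = I (\<lambda>_. 0)" by simp
  also have "\<dots> = (\<integral>\<^sup>+s. \<Phi> s \<partial>Ucube)"
    by (simp add: I_def blurred_def P.emeasure_space_1)
  finally show ?thesis by (simp add: I_def)
qed

lemma distr_blurred:
  fixes \<alpha> :: "'d::finite \<Rightarrow> nat \<Rightarrow> nat"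
  assumes b: "b \<ge> 2" and \<alpha>: "\<And>j l. \<alpha> j l < b"
  shows "distr (Perms b \<Otimes>\<^sub>M Ucube) (PiM UNIV (\<lambda>_. borel)) (\<lambda>(p, s). blurred b N p \<alpha> k s) = Ucube"
    (is "distr ?M ?N ?f = _")
proof (rule measure_eqI)
  interpret C: prob_space "Ucube :: ('d \<Rightarrow> real) measure" by (rule prob_space_Ucube)
  note m[measurable] = measurable_blurred[of \<alpha>, OF \<alpha>]
  fix A assume "A \<in> sets (distr ?M ?N ?f)"
  then have A[measurable]: "A \<in> sets ?N" by simp
  have "emeasure (distr ?M ?N ?f) A = (\<integral>\<^sup>+x. indicator A x \<partial>distr ?M ?N ?f)" by simp
  also have "\<dots> = (\<integral>\<^sup>+x. indicator A (?f x) \<partial>?M)" by (rule nn_integral_distr) auto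
  also have "\<dots> = (\<integral>\<^sup>+p. \<integral>\<^sup>+s. indicator A (blurred b N p \<alpha> k s) \<partial>Ucube \<partial>Perms b)"
    by (subst C.nn_integral_fst[symmetric]) auto
  also have "\<dots> = emeasure Ucube A"
    by (subst nn_integral_blurred[OF b \<alpha>]) (auto simp: sets_Ucube)
  finally show "emeasure (distr ?M ?N ?f) A = emeasure Ucube A" .
qed (simp add: sets_Ucube)

lemma distr_blurred_step:
  fixes \<alpha> :: "'d::finite \<Rightarrow> nat \<Rightarrow> nat" and r :: "_ \<Rightarrow> real"
  assumes b: "b \<ge> 2" and \<alpha>: "\<And>j l. \<alpha> j l < b" and K: "K \<le> N" "K \<le> k j"
    and r[measurable]: "r \<in> borel_measurable (Perms b)"
    and inv: "\<And>p p'. r (splice {(j, map (\<alpha> j) [0..<l]) | l. l \<ge> K} p p') = r p"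
  shows "distr (Perms b \<Otimes>\<^sub>M Ucube) (PiM UNIV (\<lambda>_. borel) \<Otimes>\<^sub>M borel) (\<lambda>(p, s). (blurred b N p \<alpha> k s, r p)) =
    distr (Perms b \<Otimes>\<^sub>M Ucube) (PiM UNIV (\<lambda>_. borel) \<Otimes>\<^sub>M borel) (\<lambda>(p, s). (blurred b N p \<alpha> (k(j := K)) s, r p))"
    (is "distr ?M ?N (?f k) = distr ?M ?N (?f ?k')")
proof (rule measure_eqI)
  interpret C: prob_space "Ucube :: ('d \<Rightarrow> real) measure" by (rule prob_space_Ucube)
  note m[measurable] = measurable_blurred[of \<alpha>, OF \<alpha>]
  have f[measurable]: "?f k \<in> measurable ?M ?N" for k
    using m[of N k] by (auto simp: split_beta intro!: measurable_Pair)
  fix A assume "A \<in> sets (distr ?M ?N (?f k))"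
  then have A[measurable]: "A \<in> sets ?N" by simp
  have *: "emeasure (distr ?M ?N (?f k)) A =
      (\<integral>\<^sup>+p. \<integral>\<^sup>+s. indicator A (blurred b N p \<alpha> k s, r p) \<partial>Ucube \<partial>Perms b)" for k
  proof -
    have "emeasure (distr ?M ?N (?f k)) A = (\<integral>\<^sup>+x. indicator A x \<partial>distr ?M ?N (?f k))" by simp
    also have "\<dots> = (\<integral>\<^sup>+x. indicator A (?f k x) \<partial>?M)" by (rule nn_integral_distr) auto
    also have "\<dots> = (\<integral>\<^sup>+p. \<integral>\<^sup>+s. indicator A (?f k (p, s)) \<partial>Ucube \<partial>Perms b)"
      by (rule C.nn_integral_fst[symmetric]) measurable
    finally show ?thesis by simp
  qed
  show "emeasure (distr ?M ?N (?f k)) A = emeasure (distr ?M ?N (?f ?k')) A"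
    unfolding * by (rule nn_integral_blurred_step[where K = K and N = N and k = k and j = j and r = r and
        \<Phi> = "indicator A" and \<alpha> = \<alpha> and b = b, OF b \<alpha> K r inv]) measurable
qed simp

section \<open>Counting net points by digit prefixes\<close>

lemma digit_less: "b \<ge> 1 \<Longrightarrow> digit b x l < b"
  by (simp add: digit_def nat_less_iff)

definition word_value :: "nat \<Rightarrow> nat list \<Rightarrow> nat" where
  "word_value b w = foldl (\<lambda>v d. v * b + d) 0 w"

lemma word_value_simps [simp]:
  "word_value b [] = 0" "word_value b (v @ [c]) = word_value b v * b + c"
  by (simp_all add: word_value_def)

lemma floor_next_digit:
  assumes b: "b \<ge> 1" and x: "0 \<le> x"
  shows "nat \<lfloor>real b ^ Suc k * x\<rfloor> = nat \<lfloor>real b ^ k * x\<rfloor> * b + digit b x k"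
proof -
  let ?z = "\<lfloor>real b ^ Suc k * x\<rfloor>"
  have "\<lfloor>real b ^ k * x\<rfloor> = \<lfloor>(real b ^ Suc k * x) / real_of_int (int b)\<rfloor>"
    using b by simp
  also have "\<dots> = ?z div int b" by (rule floor_divide_real_eq_div) simp
  finally have "?z = \<lfloor>real b ^ k * x\<rfloor> * int b + ?z mod int b" by simp
  moreover have "0 \<le> \<lfloor>real b ^ k * x\<rfloor>" "0 \<le> ?z mod int b" using x b by auto
  ultimately show ?thesis
    unfolding digit_def by (metis int_nat_eq nat_add_distrib nat_int nat_mult_distrib of_nat_0_le_iff mult_nonneg_nonneg)
qed

lemma digits_eq_iff:
  assumes b: "b \<ge> 1" and x: "0 \<le> x" "x < 1"
  shows "length w = k \<Longrightarrow> set w \<subseteq> {..<b} \<Longrightarrow> map (digit b x) [0..<k] = w \<longleftrightarrow> nat \<lfloor>real b ^ k * x\<rfloor> = word_value b w"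
proof (induction w arbitrary: k rule: rev_induct)
  case Nil
  then show ?case using x by simp
next
  case (snoc c v)
  then obtain k' where k: "k = Suc k'" "length v = k'" by auto
  have c: "c < b" and v: "set v \<subseteq> {..<b}" using snoc.prems by auto
  have "nat \<lfloor>real b ^ k * x\<rfloor> = word_value b (v @ [c]) \<longleftrightarrow>
      nat \<lfloor>real b ^ k' * x\<rfloor> * b + digit b x k' = word_value b v * b + c"
    unfolding k(1) floor_next_digit[OF b x(1)] by simp
  also have "\<dots> \<longleftrightarrow> nat \<lfloor>real b ^ k' * x\<rfloor> = word_value b v \<and> digit b x k' = c" (is "?l = ?r")
  proof
    assume eq: ?l
    from arg_cong[OF eq, of "\<lambda>z. z div b"] arg_cong[OF eq, of "\<lambda>z. z mod b"]
    show ?r using c digit_less[OF b, of x k'] by simp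
  qed simp
  also have "\<dots> \<longleftrightarrow> map (digit b x) [0..<k] = v @ [c]"
    using snoc.IH[OF k(2) v] by (auto simp: k(1))
  finally show ?case by simp
qed

lemma word_value_less: "set w \<subseteq> {..<b} \<Longrightarrow> word_value b w < b ^ length w"
proof (induction w rule: rev_induct)
  case (snoc c v)
  then have "word_value b v + 1 \<le> b ^ length v" and c: "c < b" by auto
  then have "(word_value b v + 1) * b \<le> b ^ length v * b" by (intro mult_right_mono) auto
  with c show ?case by (simp add: algebra_simps)
qed simp

definition words :: "nat \<Rightarrow> ('d \<Rightarrow> nat) \<Rightarrow> ('d \<Rightarrow> nat list) set" where
  "words b k = {w. \<forall>j. length (w j) = k j \<and> set (w j) \<subseteq> {..<b}}"

lemma finite_words: "finite (words b (k :: 'd::finite \<Rightarrow> nat))"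
proof -
  have "words b k \<subseteq> PiE UNIV (\<lambda>j. {w. set w \<subseteq> {..<b} \<and> length w = k j})"
    by (auto simp: words_def)
  then show ?thesis by (rule finite_subset) (auto intro!: finite_PiE finite_lists_length_eq)
qed

text \<open>A coarser box is a disjoint union of \<open>b\<close> boxes that are one digit finer in a single coordinate, so the
  net property at the finest resolved level propagates to all coarser ones.\<close>

lemma net_prefix_count:
  fixes x :: "nat \<Rightarrow> real^'d"
  assumes net: "tmd_net b t m x" and b: "b \<ge> 2"
  shows "(\<Sum>j\<in>UNIV. k j) + t \<le> m \<Longrightarrow> w \<in> words b k \<Longrightarrow>
    card {i. i < b ^ m \<and> (\<forall>j. map (digit b (x i $ j)) [0..<k j] = w j)} = b ^ (m - (\<Sum>j\<in>UNIV. k j))"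
proof (induction "m - t - (\<Sum>j\<in>UNIV. k j)" arbitrary: k w)
  case 0
  have x: "0 \<le> x i $ j" "x i $ j < 1" if "i < b ^ m" for i j
    using net that by (auto simp: tmd_net_def)
  define a where "a j = word_value b (w j)" for j
  have a: "a j < b ^ k j" for j
    using 0(3) word_value_less[of "w j" b] by (auto simp: words_def a_def)
  have sum: "(\<Sum>j\<in>UNIV. k j) + t = m" using 0(1,2) by simp
  have "(map (digit b (x i $ j)) [0..<k j] = w j) \<longleftrightarrow>
      real (a j) / real b ^ k j \<le> x i $ j \<and> x i $ j < (real (a j) + 1) / real b ^ k j"
    if i: "i < b ^ m" for i j
  proof -
    have "map (digit b (x i $ j)) [0..<k j] = w j \<longleftrightarrow> nat \<lfloor>real b ^ k j * x i $ j\<rfloor> = a j"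
      unfolding a_def using 0(3) b x[OF i] by (intro digits_eq_iff) (auto simp: words_def)
    also have "\<dots> \<longleftrightarrow> \<lfloor>real b ^ k j * x i $ j\<rfloor> = int (a j)"
      using x[OF i, of j] by (auto simp: nat_eq_iff)
    also have "\<dots> \<longleftrightarrow> real (a j) \<le> real b ^ k j * x i $ j \<and> real b ^ k j * x i $ j < real (a j) + 1"
      by (auto simp: floor_eq_iff)
    also have "\<dots> \<longleftrightarrow> real (a j) / real b ^ k j \<le> x i $ j \<and> x i $ j < (real (a j) + 1) / real b ^ k j"
      using b by (simp add: field_simps)
    finally show ?thesis .
  qed
  then have "{i. i < b ^ m \<and> (\<forall>j. map (digit b (x i $ j)) [0..<k j] = w j)} =
     {i. i < b ^ m \<and> (\<forall>j. real (a j) / real b ^ k j \<le> x i $ j \<and> x i $ j < (real (a j) + 1) / real b ^ k j)}"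
    by auto
  also have "card \<dots> = b ^ t"
    using net sum a unfolding tmd_net_def by blast
  also have "t = m - (\<Sum>j\<in>UNIV. k j)" using sum by simp
  finally show ?case .
next
  case (Suc r)
  define j0 :: 'd where "j0 = undefined"
  let ?k = "k(j0 := Suc (k j0))"
  let ?S = "\<lambda>k w. {i. i < b ^ m \<and> (\<forall>j. map (digit b (x i $ j)) [0..<k j] = w j)}"
  let ?w = "\<lambda>c. w(j0 := w j0 @ [c])"
  have sum: "(\<Sum>j\<in>UNIV. ?k j) = Suc (\<Sum>j\<in>UNIV. k j)"
  proof -
    have "(\<Sum>j\<in>UNIV. ?k j) = Suc (k j0) + (\<Sum>j\<in>UNIV - {j0}. k j)"
      by (subst sum.remove[of _ j0]) auto
    also have "\<dots> = Suc (\<Sum>j\<in>UNIV. k j)" by (subst (2) sum.remove[of _ j0]) auto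
    finally show ?thesis .
  qed
  have w: "?w c \<in> words b ?k" if "c < b" for c
    using Suc.prems(2) that by (auto simp: words_def)
  define T where "T c = ?S ?k (?w c)" for c
  have IH: "card (T c) = b ^ (m - Suc (\<Sum>j\<in>UNIV. k j))" if "c < b" for c
    unfolding T_def sum[symmetric] using Suc.hyps(2) Suc.prems(1) sum
    by (intro Suc.hyps(1) w that) linarith+
  have "?S k w = (\<Union>c<b. T c)"
  proof (intro equalityI subsetI)
    fix i assume i: "i \<in> ?S k w"
    then have "i \<in> T (digit b (x i $ j0) (k j0))" by (auto simp: T_def)
    moreover have "digit b (x i $ j0) (k j0) < b" using b by (intro digit_less) simp
    ultimately show "i \<in> (\<Union>c<b. T c)" by blast
  next
    fix i assume "i \<in> (\<Union>c<b. T c)"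
    then obtain c where c: "i < b ^ m" "\<And>j. map (digit b (x i $ j)) [0..<?k j] = ?w c j" by (auto simp: T_def)
    have "map (digit b (x i $ j)) [0..<k j] = w j" for j
      using c(2)[of j] by (cases "j = j0") auto
    then show "i \<in> ?S k w" using c(1) by blast
  qed
  also have "card \<dots> = (\<Sum>c<b. card (T c))"
  proof (rule card_UN_disjoint)
    show "\<forall>c\<in>{..<b}. \<forall>c'\<in>{..<b}. c \<noteq> c' \<longrightarrow> T c \<inter> T c' = {}"
    proof (intro ballI impI equals0I)
      fix c c' i assume "c \<noteq> c'" "i \<in> T c \<inter> T c'"
      then have "?w c j0 = ?w c' j0" unfolding T_def by (metis (mono_tags, lifting) IntE mem_Collect_eq)
      with \<open>c \<noteq> c'\<close> show False by simp
    qed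
  qed (auto simp: T_def)
  also have "\<dots> = (\<Sum>c<b. b ^ (m - Suc (\<Sum>j\<in>UNIV. k j)))"
    by (rule sum.cong[OF refl]) (rule IH, simp)
  also have "\<dots> = b ^ Suc (m - Suc (\<Sum>j\<in>UNIV. k j))" by simp
  also have "Suc (m - Suc (\<Sum>j\<in>UNIV. k j)) = m - (\<Sum>j\<in>UNIV. k j)"
    using Suc.hyps(2) by linarith
  finally show ?case .
qed

lemma exists_below_with_sum:
  fixes f :: "'a::finite \<Rightarrow> nat"
  shows "s \<le> (\<Sum>j\<in>UNIV. f j) \<Longrightarrow> \<exists>g. (\<forall>j. g j \<le> f j) \<and> (\<Sum>j\<in>UNIV. g j) = s"
proof (induction s)
  case 0
  then show ?case by (intro exI[of _ "\<lambda>_. 0"]) auto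
next
  case (Suc s)
  then obtain g where g: "\<And>j. g j \<le> f j" "(\<Sum>j\<in>UNIV. g j) = s" by auto
  have "\<exists>j. g j < f j"
  proof (rule ccontr)
    assume "\<not> ?thesis"
    then have "g j = f j" for j using g(1)[of j] by (auto simp: not_less le_antisym)
    then show False using Suc.prems g(2) by simp
  qed
  then obtain i where i: "g i < f i" by blast
  have "(\<Sum>j\<in>UNIV. (g(i := Suc (g i))) j) = Suc (g i) + (\<Sum>j\<in>UNIV - {i}. g j)"
    by (subst sum.remove[of _ i]) auto
  also have "\<dots> = Suc (\<Sum>j\<in>UNIV. g j)" by (subst (2) sum.remove[of _ i]) auto
  finally show ?case using g i by (intro exI[of _ "g(i := Suc (g i))"]) auto
qed

text \<open>Two points interact at level \<open>\<kappa>\<close> only if they share the box of level \<open>\<kappa> - 1\<close>, and for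
  \<open>\<bar>\<kappa>\<bar> > m - t\<close> such a box contains boundedly many points.\<close>

lemma net_neighbour_count:
  fixes x :: "nat \<Rightarrow> real^'d"
  assumes net: "tmd_net b t m x" and b: "b \<ge> 2" and m: "t \<le> m" and \<kappa>: "m < (\<Sum>j\<in>UNIV. \<kappa> j) + t"
  shows "card {i'. i' < b ^ m \<and> (\<forall>j. map (digit b (x i' $ j)) [0..<\<kappa> j - 1] = map (digit b (x i $ j)) [0..<\<kappa> j - 1])}
    \<le> b ^ (t + CARD('d))"
proof -
  let ?q = "\<Sum>j\<in>UNIV. (\<kappa> j - 1)"
  have "(\<Sum>j\<in>UNIV. \<kappa> j) \<le> (\<Sum>j\<in>UNIV. (\<kappa> j - 1) + 1)" by (intro sum_mono) auto
  also have "\<dots> = ?q + CARD('d)" by (subst sum.distrib) simp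
  finally have q: "(\<Sum>j\<in>UNIV. \<kappa> j) \<le> ?q + CARD('d)" .
  obtain g where g: "\<And>j. g j \<le> \<kappa> j - 1" "(\<Sum>j\<in>UNIV. g j) = min ?q (m - t)"
    using exists_below_with_sum[of "min ?q (m - t)" "\<lambda>j. \<kappa> j - 1"] by auto
  let ?w = "\<lambda>j. map (digit b (x i $ j)) [0..<g j]"
  have "?w \<in> words b g"
    using digit_less[of b] b by (auto simp: words_def)
  then have c: "card {i'. i' < b ^ m \<and> (\<forall>j. map (digit b (x i' $ j)) [0..<g j] = ?w j)} = b ^ (m - min ?q (m - t))"
    using m g(2) by (subst net_prefix_count[OF net b]) auto
  have "card {i'. i' < b ^ m \<and> (\<forall>j. map (digit b (x i' $ j)) [0..<\<kappa> j - 1] = map (digit b (x i $ j)) [0..<\<kappa> j - 1])} \<le>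
      card {i'. i' < b ^ m \<and> (\<forall>j. map (digit b (x i' $ j)) [0..<g j] = ?w j)}"
  proof (rule card_mono)
    show "{i'. i' < b ^ m \<and> (\<forall>j. map (digit b (x i' $ j)) [0..<\<kappa> j - 1] = map (digit b (x i $ j)) [0..<\<kappa> j - 1])} \<subseteq>
       {i'. i' < b ^ m \<and> (\<forall>j. map (digit b (x i' $ j)) [0..<g j] = ?w j)}"
      by (auto simp: map_eq_conv dest!: less_le_trans[OF _ g(1)])
  qed auto
  also have "\<dots> \<le> b ^ (t + CARD('d))"
    unfolding c using b q \<kappa> m by (intro power_increasing) (auto simp: min_def)
  finally show ?thesis .
qed

definition scramble_word :: "(nat list \<Rightarrow> nat \<Rightarrow> nat) \<Rightarrow> nat list \<Rightarrow> nat list" where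
  "scramble_word q w = map (\<lambda>l. q (take l w) (w ! l)) [0..<length w]"

lemma scramble_word_snoc: "scramble_word q (v @ [c]) = scramble_word q v @ [q v c]"
  by (simp add: scramble_word_def nth_append)

lemma scramble_word_Nil [simp]: "scramble_word q [] = []"
  by (simp add: scramble_word_def)

lemma length_scramble_word [simp]: "length (scramble_word q w) = length w"
  by (simp add: scramble_word_def)

lemma map_scrambled_digit:
  "map (scrambled_digit p \<alpha> j) [0..<k] = scramble_word (\<lambda>u. p (j, u)) (map (\<alpha> j) [0..<k])"
  by (induction k) (simp_all add: scramble_word_snoc scrambled_digit_def)

lemma scramble_word_inj:
  assumes q: "\<And>u. set u \<subseteq> {..<b} \<Longrightarrow> q u permutes {..<b}"
  shows "set w \<subseteq> {..<b} \<Longrightarrow> set w' \<subseteq> {..<b} \<Longrightarrow> scramble_word q w = scramble_word q w' \<Longrightarrow> w = w'"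
proof (induction w arbitrary: w' rule: rev_induct)
  case Nil
  then show ?case by (metis length_0_conv length_scramble_word)
next
  case (snoc c v)
  then have "length w' = Suc (length v)" by (metis length_append_singleton length_scramble_word)
  then obtain v' c' where w': "w' = v' @ [c']" by (metis length_Suc_conv_rev)
  have "scramble_word q v = scramble_word q v'" "q v c = q v' c'"
    using snoc.prems(3) by (auto simp: w' scramble_word_snoc)
  moreover from this(1) have "v = v'" using snoc by (auto simp: w')
  moreover have "inj (q v)" using q[of v] snoc.prems by (auto intro: permutes_inj)
  ultimately show ?case by (auto simp: w' dest: injD)
qed

lemma scramble_word_surj:
  assumes q: "\<And>u. set u \<subseteq> {..<b} \<Longrightarrow> q u permutes {..<b}"
  shows "set W \<subseteq> {..<b} \<Longrightarrow> \<exists>w. set w \<subseteq> {..<b} \<and> scramble_word q w = W"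
proof (induction W rule: rev_induct)
  case (snoc C V)
  then obtain v where v: "set v \<subseteq> {..<b}" "scramble_word q v = V" by auto
  have "C \<in> q v ` {..<b}" using permutes_image[OF q[OF v(1)]] snoc.prems by auto
  then obtain c where "c < b" "q v c = C" by auto
  with v show ?case by (intro exI[of _ "v @ [c]"]) (simp add: scramble_word_snoc)
qed (auto intro: exI[of _ "[]"])

text \<open>Scrambling permutes the digit words of each length, so it carries boxes to boxes bijectively.\<close>

lemma scrambled_net_prefix_count:
  fixes x :: "nat \<Rightarrow> real^'d"
  assumes net: "tmd_net b t m x" and b: "b \<ge> 2" and p: "p \<in> space (Perms b)"
    and k: "(\<Sum>j\<in>UNIV. k j) + t \<le> m" and W: "W \<in> words b k"
  shows "card {i. i < b ^ m \<and> (\<lambda>j. map (scrambled_digit p (\<lambda>j. digit b (x i $ j)) j) [0..<k j]) = W} =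
    b ^ (m - (\<Sum>j\<in>UNIV. k j))"
proof -
  have q: "p (j, u) permutes {..<b}" if "set u \<subseteq> {..<b}" for j u
    using space_PermsD[OF p, of "(j, u)"] that by (auto simp: nodes_def digit_perms_def)
  have "\<exists>w. set w \<subseteq> {..<b} \<and> scramble_word (\<lambda>u. p (j, u)) w = W j" for j
    by (rule scramble_word_surj[OF q]) (use W in \<open>auto simp: words_def\<close>)
  then obtain w where w: "\<And>j. set (w j) \<subseteq> {..<b}" "\<And>j. scramble_word (\<lambda>u. p (j, u)) (w j) = W j" by metis
  have "w \<in> words b k"
    using w W by (auto simp: words_def) (metis length_scramble_word)
  moreover have "(\<lambda>j. map (scrambled_digit p (\<lambda>j. digit b (x i $ j)) j) [0..<k j]) = W \<longleftrightarrow>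
      (\<forall>j. map (digit b (x i $ j)) [0..<k j] = w j)" for i
  proof -
    have S: "set (map (digit b (x i $ j)) [0..<k j]) \<subseteq> {..<b}" for j using digit_less[of b] b by auto
    have "scramble_word (\<lambda>u. p (j, u)) (map (digit b (x i $ j)) [0..<k j]) = scramble_word (\<lambda>u. p (j, u)) (w j) \<longleftrightarrow>
        map (digit b (x i $ j)) [0..<k j] = w j" for j
    proof
      assume eq: "scramble_word (\<lambda>u. p (j, u)) (map (digit b (x i $ j)) [0..<k j]) = scramble_word (\<lambda>u. p (j, u)) (w j)"
      show "map (digit b (x i $ j)) [0..<k j] = w j"
        by (rule scramble_word_inj[OF q S w(1) eq])
    qed simp
    then show ?thesis
      unfolding fun_eq_iff map_scrambled_digit w(2)[symmetric] by simp
  qed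
  ultimately show ?thesis using net_prefix_count[OF net b k] by simp
qed

section \<open>Square-integrable functions\<close>

definition square_integrable :: "'a measure \<Rightarrow> ('a \<Rightarrow> real) \<Rightarrow> bool" where
  "square_integrable M f \<longleftrightarrow> f \<in> borel_measurable M \<and> integrable M (\<lambda>x. (f x)\<^sup>2)"

lemma square_integrable_mult:
  assumes "square_integrable M f" "square_integrable M g"
  shows "integrable M (\<lambda>x. f x * g x)"
proof (rule Bochner_Integration.integrable_bound)
  show "integrable M (\<lambda>x. (f x)\<^sup>2 + (g x)\<^sup>2)" using assms by (simp add: square_integrable_def)
  show "(\<lambda>x. f x * g x) \<in> borel_measurable M" using assms by (auto simp: square_integrable_def)
  have "\<bar>a * c\<bar> \<le> a\<^sup>2 + c\<^sup>2" for a c :: real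
  proof -
    have "2 * (\<bar>a\<bar> * \<bar>c\<bar>) \<le> a\<^sup>2 + c\<^sup>2" using sum_squares_bound[of "\<bar>a\<bar>" "\<bar>c\<bar>"] by simp
    moreover have "0 \<le> \<bar>a\<bar> * \<bar>c\<bar>" by simp
    ultimately have "\<bar>a\<bar> * \<bar>c\<bar> \<le> a\<^sup>2 + c\<^sup>2" by linarith
    then show ?thesis by (simp add: abs_mult)
  qed
  then show "AE x in M. norm (f x * g x) \<le> norm ((f x)\<^sup>2 + (g x)\<^sup>2)" by simp
qed

lemma square_integrable_add:
  assumes "square_integrable M f" "square_integrable M g"
  shows "square_integrable M (\<lambda>x. f x + g x)"
proof -
  have "(\<lambda>x. (f x + g x)\<^sup>2) = (\<lambda>x. (f x)\<^sup>2 + (g x)\<^sup>2 + 2 * (f x * g x))"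
    by (simp add: power2_sum mult.assoc)
  then show ?thesis
    using assms square_integrable_mult[OF assms] by (auto simp: square_integrable_def)
qed

lemma square_integrable_cmult:
  "square_integrable M f \<Longrightarrow> square_integrable M (\<lambda>x. c * f x)"
  by (auto simp: square_integrable_def power_mult_distrib)

lemma square_integrable_sum:
  "(\<And>i. i \<in> I \<Longrightarrow> square_integrable M (f i)) \<Longrightarrow> square_integrable M (\<lambda>x. \<Sum>i\<in>I. f i x)"
  by (induction I rule: infinite_finite_induct)
     (auto intro: square_integrable_add simp: square_integrable_def[of M "\<lambda>_. 0"])

lemma square_integrable_alt:
  "(\<And>k. square_integrable M (\<lambda>x. f x k)) \<Longrightarrow> square_integrable M (\<lambda>x. alt J y z (f x) v)"
  unfolding alt_def by (intro square_integrable_sum square_integrable_cmult)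

lemma (in prob_space) square_integrable_imp_integrable:
  "square_integrable M f \<Longrightarrow> integrable M f"
  using square_integrable_mult[of M f "\<lambda>_. 1"] by (simp add: square_integrable_def)

lemma (in prob_space) integral_squared_le:
  assumes "square_integrable M f"
  shows "(\<integral>x. f x \<partial>M)\<^sup>2 \<le> (\<integral>x. (f x)\<^sup>2 \<partial>M)"
proof -
  have "0 \<le> (\<integral>x. (f x - (\<integral>x. f x \<partial>M))\<^sup>2 \<partial>M)" by (rule integral_nonneg_AE) simp
  also have "\<dots> = (\<integral>x. (f x)\<^sup>2 \<partial>M) - (\<integral>x. f x \<partial>M)\<^sup>2"
    using assms square_integrable_imp_integrable[OF assms]
    by (intro variance_eq) (auto simp: square_integrable_def)
  finally show ?thesis by simp
qed

lemma square_sum_le: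
  fixes f :: "'a \<Rightarrow> real"
  shows "(\<Sum>i\<in>I. f i)\<^sup>2 \<le> real (card I) * (\<Sum>i\<in>I. (f i)\<^sup>2)"
  using Cauchy_Schwarz_ineq_sum[of f "\<lambda>_. 1" I] by (simp add: mult.commute)

lemma (in pair_prob_space) square_integrable_inner_integral:
  assumes f: "square_integrable (M1 \<Otimes>\<^sub>M M2) (\<lambda>(x, y). f x y)"
  shows "square_integrable M1 (\<lambda>x. \<integral>y. f x y \<partial>M2)"
    "(\<integral>x. (\<integral>y. f x y \<partial>M2)\<^sup>2 \<partial>M1) \<le> (\<integral>(x, y). (f x y)\<^sup>2 \<partial>(M1 \<Otimes>\<^sub>M M2))"
proof -
  have m[measurable]: "(\<lambda>(x, y). f x y) \<in> borel_measurable (M1 \<Otimes>\<^sub>M M2)"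
    and i: "integrable (M1 \<Otimes>\<^sub>M M2) (\<lambda>(x, y). (f x y)\<^sup>2)"
    using f unfolding square_integrable_def by (simp_all add: split_beta')
  have AE: "AE x in M1. square_integrable M2 (f x)"
    using AE_integrable_fst'[OF i] AE_space
  proof eventually_elim
    case (elim x)
    then show ?case using measurable_Pair2[OF m] by (simp add: square_integrable_def)
  qed
  have le: "AE x in M1. (\<integral>y. f x y \<partial>M2)\<^sup>2 \<le> (\<integral>y. (f x y)\<^sup>2 \<partial>M2)"
    using AE by eventually_elim (rule M2.integral_squared_le)
  have mI: "(\<lambda>x. \<integral>y. f x y \<partial>M2) \<in> borel_measurable M1"
    by (rule M2.borel_measurable_lebesgue_integral) measurable
  have i2: "integrable M1 (\<lambda>x. \<integral>y. (f x y)\<^sup>2 \<partial>M2)" using integrable_fst'[OF i] by simp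
  have "integrable M1 (\<lambda>x. (\<integral>y. f x y \<partial>M2)\<^sup>2)"
    by (rule Bochner_Integration.integrable_bound[OF i2]) (use le mI in \<open>auto elim!: eventually_mono\<close>)
  then show 1: "square_integrable M1 (\<lambda>x. \<integral>y. f x y \<partial>M2)" using mI by (simp add: square_integrable_def)
  have "(\<integral>x. (\<integral>y. f x y \<partial>M2)\<^sup>2 \<partial>M1) \<le> (\<integral>x. (\<integral>y. (f x y)\<^sup>2 \<partial>M2) \<partial>M1)"
    using 1 by (intro integral_mono_AE i2 le) (simp add: square_integrable_def)
  also have "\<dots> = (\<integral>(x, y). (f x y)\<^sup>2 \<partial>(M1 \<Otimes>\<^sub>M M2))"
    using integral_fst'[OF i] by simp
  finally show "(\<integral>x. (\<integral>y. f x y \<partial>M2)\<^sup>2 \<partial>M1) \<le> (\<integral>(x, y). (f x y)\<^sup>2 \<partial>(M1 \<Otimes>\<^sub>M M2))" .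
qed

section \<open>The multiresolution decomposition of the error\<close>

lemma alt_const:
  assumes "finite J" "J \<noteq> {}"
  shows "alt J y z (\<lambda>_. c) x = 0"
proof -
  from assms obtain j where "j \<in> J" by auto
  then have "J = insert j (J - {j})" by auto
  moreover have "alt (J - {j}) y z (\<lambda>_. c) (x(j := y j)) = alt (J - {j}) y z (\<lambda>_. c) (x(j := z j))"
    by (simp add: alt_def)
  ultimately show ?thesis
    using alt_insert[of "J - {j}" j y z "\<lambda>_. c" x] assms(1) by simp
qed

text \<open>The difference between level \<open>\<kappa>\<close> and the levels below it, one coordinate at a time; a coordinate at level 0
  is left alone since there is no coarser level.\<close>

definition level_diff :: "('d::finite \<Rightarrow> nat) \<Rightarrow> (('d \<Rightarrow> nat) \<Rightarrow> real) \<Rightarrow> real" where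
  "level_diff \<kappa> f = alt {j. \<kappa> j > 0} \<kappa> (\<lambda>j. \<kappa> j - 1) f \<kappa>"

definition levels :: "nat \<Rightarrow> ('d::finite \<Rightarrow> nat) set" where
  "levels N = {\<kappa>. \<forall>j. \<kappa> j \<le> N}"

lemma levels_eq_PiE: "levels N = PiE UNIV (\<lambda>_. {..N})"
  by (auto simp: levels_def)

lemma finite_levels: "finite (levels N)"
  unfolding levels_eq_PiE by (rule finite_PiE) auto

lemma card_levels: "card (levels N :: ('d::finite \<Rightarrow> nat) set) = (N + 1) ^ CARD('d)"
  unfolding levels_eq_PiE by (simp add: card_PiE)

text \<open>The sum over the levels of one coordinate telescopes; induction takes the coordinates one by one.\<close>

lemma sum_level_diff: "(\<Sum>\<kappa>\<in>levels N. level_diff \<kappa> f) = f (\<lambda>_::'d::finite. N)"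
proof -
  have "finite J \<Longrightarrow> (\<Sum>\<kappa>\<in>{\<kappa>. (\<forall>j\<in>J. \<kappa> j \<le> N) \<and> (\<forall>j. j \<notin> J \<longrightarrow> \<kappa> j = N)}.
      alt {j\<in>J. \<kappa> j > 0} \<kappa> (\<lambda>j. \<kappa> j - 1) f \<kappa>) = f (\<lambda>_. N)" for J :: "'d set"
  proof (induction J rule: finite_induct)
    case empty
    have "{\<kappa>. (\<forall>j\<in>{}. \<kappa> j \<le> N) \<and> (\<forall>j. j \<notin> {} \<longrightarrow> \<kappa> j = N)} = {\<lambda>_::'d. N}" by auto
    then show ?case by simp
  next
    case (insert i J)
    let ?L = "\<lambda>J. {\<kappa> :: 'd \<Rightarrow> nat. (\<forall>j\<in>J. \<kappa> j \<le> N) \<and> (\<forall>j. j \<notin> J \<longrightarrow> \<kappa> j = N)}"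
    let ?T = "\<lambda>J \<kappa>. alt {j\<in>J. \<kappa> j > 0} \<kappa> (\<lambda>j. \<kappa> j - 1) f \<kappa>"
    define A where "A \<kappa> c = alt {j\<in>J. \<kappa> j > 0} \<kappa> (\<lambda>j. \<kappa> j - 1) f (\<kappa>(i := c))" for \<kappa> c
    have T: "?T (insert i J) (\<kappa>(i := c)) = (if c = 0 then A \<kappa> 0 else A \<kappa> c - A \<kappa> (c - 1))" for \<kappa> c
    proof -
      have J: "{j\<in>J. (\<kappa>(i := c)) j > 0} = {j\<in>J. \<kappa> j > 0}" using insert.hyps by auto
      have cong: "alt {j\<in>J. \<kappa> j > 0} (\<kappa>(i := c)) (\<lambda>j. (\<kappa>(i := c)) j - 1) f x = alt {j\<in>J. \<kappa> j > 0} \<kappa> (\<lambda>j. \<kappa> j - 1) f x" for x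
        using insert.hyps by (intro alt_cong) auto
      show ?thesis
      proof (cases "c = 0")
        case True
        then have "{j \<in> insert i J. (\<kappa>(i := c)) j > 0} = {j\<in>J. (\<kappa>(i := c)) j > 0}" by auto
        then show ?thesis using True cong J by (simp add: A_def)
      next
        case False
        then have ins: "{j \<in> insert i J. (\<kappa>(i := c)) j > 0} = insert i {j\<in>J. \<kappa> j > 0}" using J by auto
        have "?T (insert i J) (\<kappa>(i := c)) = alt {j\<in>J. \<kappa> j > 0} \<kappa> (\<lambda>j. \<kappa> j - 1) f (\<kappa>(i := c)) -
            alt {j\<in>J. \<kappa> j > 0} \<kappa> (\<lambda>j. \<kappa> j - 1) f (\<kappa>(i := c - 1))"
        proof -
          have "finite {j\<in>J. \<kappa> j > 0}" "i \<notin> {j\<in>J. \<kappa> j > 0}" using insert.hyps by auto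
          then show ?thesis unfolding ins alt_insert[OF \<open>finite {j\<in>J. \<kappa> j > 0}\<close> \<open>i \<notin> {j\<in>J. \<kappa> j > 0}\<close>] cong by simp
        qed
        then show ?thesis using False by (simp add: A_def)
      qed
    qed
    have img: "?L (insert i J) = (\<lambda>(\<kappa>, c). \<kappa>(i := c)) ` (?L J \<times> {..N})"
    proof (intro equalityI subsetI)
      fix \<kappa> assume \<kappa>: "\<kappa> \<in> ?L (insert i J)"
      then have "\<kappa> = (\<lambda>(\<kappa>, c). \<kappa>(i := c)) (\<kappa>(i := N), \<kappa> i)" "(\<kappa>(i := N), \<kappa> i) \<in> ?L J \<times> {..N}"
        using insert.hyps by auto
      then show "\<kappa> \<in> (\<lambda>(\<kappa>, c). \<kappa>(i := c)) ` (?L J \<times> {..N})" by (rule image_eqI)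
    qed (use insert.hyps in auto)
    have inj: "inj_on (\<lambda>(\<kappa>, c). \<kappa>(i := c)) (?L J \<times> {..N})"
    proof (rule inj_onI, clarify)
      fix \<kappa> \<kappa>' :: "'d \<Rightarrow> nat" and c c'
      assume k: "\<forall>j. j \<notin> J \<longrightarrow> \<kappa> j = N" "\<forall>j. j \<notin> J \<longrightarrow> \<kappa>' j = N" and eq: "\<kappa>(i := c) = \<kappa>'(i := c')"
      have "\<kappa> j = \<kappa>' j" for j
        using k insert.hyps fun_cong[OF eq, of j] by (cases "j = i") auto
      then show "\<kappa> = \<kappa>' \<and> c = c'" using fun_cong[OF eq, of i] by auto
    qed
    have "sum (?T (insert i J)) (?L (insert i J)) = sum (?T (insert i J) \<circ> (\<lambda>(\<kappa>, c). \<kappa>(i := c))) (?L J \<times> {..N})"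
      unfolding img by (rule sum.reindex[OF inj])
    also have "\<dots> = (\<Sum>(\<kappa>, c)\<in>?L J \<times> {..N}. ?T (insert i J) (\<kappa>(i := c)))"
      by (intro sum.cong refl) (simp only: o_def case_prod_beta)
    also have "\<dots> = (\<Sum>\<kappa>\<in>?L J. \<Sum>c\<le>N. ?T (insert i J) (\<kappa>(i := c)))"
      by (rule sum.cartesian_product[symmetric])
    also have "\<dots> = (\<Sum>\<kappa>\<in>?L J. ?T J \<kappa>)"
    proof (rule sum.cong[OF refl])
      fix \<kappa> assume "\<kappa> \<in> ?L J"
      then have \<kappa>i: "\<kappa>(i := N) = \<kappa>" using insert.hyps by auto
      have "(\<Sum>c\<le>M. ?T (insert i J) (\<kappa>(i := c))) = A \<kappa> M" for M
        unfolding T by (induction M) auto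
      then show "(\<Sum>c\<le>N. ?T (insert i J) (\<kappa>(i := c))) = ?T J \<kappa>" using \<kappa>i by (simp add: A_def)
    qed
    also have "\<dots> = f (\<lambda>_. N)" by (rule insert.IH)
    finally show ?case .
  qed
  from this[of UNIV] show ?thesis by (simp add: levels_def level_diff_def)
qed

lemma level_diff_linear:
  "(\<Sum>i\<in>I. level_diff \<kappa> (f i)) = level_diff \<kappa> (\<lambda>k. \<Sum>i\<in>I. f i k)"
  unfolding level_diff_def alt_def sum_distrib_left by (rule sum.swap)

lemma level_diff_zero: "level_diff (\<lambda>_. 0) f = f (\<lambda>_. 0)"
  by (simp add: level_diff_def)

lemma level_diff_const_below:
  assumes "\<And>k. (\<And>j. k j \<le> \<kappa> j) \<Longrightarrow> f k = c" and "\<kappa> \<noteq> (\<lambda>_. 0)"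
  shows "level_diff \<kappa> f = 0"
proof -
  have "level_diff \<kappa> f = level_diff \<kappa> (\<lambda>_. c)"
    unfolding level_diff_def alt_def
    by (intro sum.cong refl arg_cong2[of _ _ _ _ "(*)"] assms(1)) auto
  also have "\<dots> = 0"
    using assms(2) unfolding level_diff_def by (intro alt_const) (auto simp: fun_eq_iff)
  finally show ?thesis .
qed

text \<open>The canonical model: the permutations are the coordinates of the product space \<open>Perms b\<close>. The levels run up
  to \<open>m + 1\<close>, where level \<open>m + 1\<close> means full precision; a level vector with such an entry is beyond the
  resolution \<open>m - t\<close> of the net anyway.\<close>

locale scrambled_net =
  fixes b t m :: nat and x :: "nat \<Rightarrow> real^'d" and h :: "('d \<Rightarrow> real) \<Rightarrow> real"
  assumes b: "b \<ge> 2" and tm: "t \<le> m" and net: "tmd_net b t m x"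
    and h: "square_integrable Ucube h"
begin

sublocale P: prob_space "Perms b :: ('d \<times> nat list \<Rightarrow> nat \<Rightarrow> nat) measure" by (rule prob_space_Perms)
sublocale C: prob_space "Ucube :: ('d \<Rightarrow> real) measure" by (rule prob_space_Ucube)
sublocale PC: pair_prob_space "Perms b :: ('d \<times> nat list \<Rightarrow> nat \<Rightarrow> nat) measure" "Ucube :: ('d \<Rightarrow> real) measure" ..

definition point_digits :: "nat \<Rightarrow> 'd \<Rightarrow> nat \<Rightarrow> nat" where
  "point_digits i j = digit b (x i $ j)"

lemma point_digits_less: "point_digits i j l < b"
  using digit_less[of b] b by (simp add: point_digits_def)

abbreviation pt where "pt p i k s \<equiv> blurred b m p (point_digits i) k s"

definition cell_mean where "cell_mean p i k = (\<integral>s. h (pt p i k s) \<partial>Ucube)"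

text \<open>The contribution of level \<open>\<kappa>\<close> to the value at point \<open>i\<close>; for \<open>\<kappa> = 0\<close> it is the integral of \<open>h\<close>, and the sum over
  all \<open>\<kappa>\<close> is the value at the scrambled point.\<close>

definition detail where "detail \<kappa> p i = level_diff \<kappa> (cell_mean p i)"

lemma h_meas: "h \<in> borel_measurable (PiM UNIV (\<lambda>_. borel))"
  using h by (simp add: square_integrable_def measurable_cong_sets[OF sets_Ucube refl])

lemma pt_meas: "(\<lambda>(p, s). pt p i k s) \<in> measurable (Perms b \<Otimes>\<^sub>M Ucube) (PiM UNIV (\<lambda>_. borel))"
  by (rule measurable_blurred[OF point_digits_less])

lemma pt_transfer:
  fixes F :: "('d \<Rightarrow> real) \<Rightarrow> real"
  assumes F: "integrable Ucube F"
  shows "integrable (Perms b \<Otimes>\<^sub>M Ucube) (\<lambda>(p, s). F (pt p i k s))"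
    "(\<integral>(p, s). F (pt p i k s) \<partial>(Perms b \<Otimes>\<^sub>M Ucube)) = (\<integral>s. F s \<partial>Ucube)"
proof -
  have Fm: "F \<in> borel_measurable (PiM UNIV (\<lambda>_. borel))"
    using F by (auto simp: measurable_cong_sets[OF sets_Ucube[symmetric] refl])
  note D = distr_blurred[of b "point_digits i" m k, OF b point_digits_less]
  show "integrable (Perms b \<Otimes>\<^sub>M Ucube) (\<lambda>(p, s). F (pt p i k s))"
    using integrable_distr_eq[OF pt_meas[of i k] Fm] F unfolding D by (simp add: split_beta')
  show "(\<integral>(p, s). F (pt p i k s) \<partial>(Perms b \<Otimes>\<^sub>M Ucube)) = (\<integral>s. F s \<partial>Ucube)"
    using integral_distr[OF pt_meas[of i k] Fm] unfolding D by (simp add: split_beta')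
qed

lemma pt_square_integrable: "square_integrable (Perms b \<Otimes>\<^sub>M Ucube) (\<lambda>(p, s). h (pt p i k s))"
proof -
  have "(\<lambda>(p, s). h (pt p i k s)) \<in> borel_measurable (Perms b \<Otimes>\<^sub>M Ucube)"
    using measurable_compose[OF pt_meas h_meas] by (simp add: split_beta')
  then show ?thesis
    using pt_transfer(1)[of "\<lambda>s. (h s)\<^sup>2" i k] h by (simp add: square_integrable_def split_beta')
qed

lemma cell_mean_square_integrable: "square_integrable (Perms b) (\<lambda>p. cell_mean p i k)"
  unfolding cell_mean_def by (rule PC.square_integrable_inner_integral(1)[OF pt_square_integrable])

lemma detail_square_integrable: "square_integrable (Perms b) (\<lambda>p. detail \<kappa> p i)"
  unfolding detail_def level_diff_def by (intro square_integrable_alt cell_mean_square_integrable)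

lemma integral_cell_mean: "(\<integral>p. cell_mean p i k \<partial>Perms b) = (\<integral>s. h s \<partial>Ucube)"
  unfolding cell_mean_def
  using PC.integral_fst'[OF pt_transfer(1)[OF C.square_integrable_imp_integrable[OF h], of i k]]
    pt_transfer(2)[OF C.square_integrable_imp_integrable[OF h], of i k] by simp

text \<open>At levels the net resolves, each cell holds the same number of points, so the sum of the cell means
  is not random and equals its expectation.\<close>

lemma sum_cell_mean:
  assumes k: "(\<Sum>j\<in>UNIV. k j) + t \<le> m" and p: "p \<in> space (Perms b)"
  shows "(\<Sum>i<b ^ m. cell_mean p i k) = real (b ^ m) * (\<integral>s. h s \<partial>Ucube)"
proof -
  \<comment> \<open>a cell mean depends on the point through its scrambled digit words only\<close>
  define \<phi> where "\<phi> W = (\<integral>s. h (\<lambda>j. (\<Sum>l<k j. real (W j ! l) / real b ^ Suc l) + s j / real b ^ k j) \<partial>Ucube)" for W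
  define W where "W p i = (\<lambda>j. map (scrambled_digit p (point_digits i) j) [0..<k j])" for p i
  have km: "k j \<le> m" for j
    using member_le_sum[of j UNIV k] k by simp
  have mean: "cell_mean p i k = \<phi> (W p i)" for p i
    unfolding cell_mean_def \<phi>_def
    by (intro Bochner_Integration.integral_cong refl arg_cong[of _ _ h] ext) (simp add: blurred_def blur_def km W_def)
  define c where "c = real (b ^ (m - (\<Sum>j\<in>UNIV. k j))) * (\<Sum>w\<in>words b k. \<phi> w)"
  have sum: "(\<Sum>i<b ^ m. cell_mean p i k) = c" if p: "p \<in> space (Perms b)" for p
  proof -
    have "W p ` {..<b ^ m} \<subseteq> words b k"
      using scrambled_digit_less[OF p point_digits_less] by (auto simp: words_def W_def)
    then have "(\<Sum>i<b ^ m. cell_mean p i k) = (\<Sum>w\<in>words b k. \<Sum>i\<in>{i \<in> {..<b ^ m}. W p i = w}. \<phi> (W p i))"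
      unfolding mean by (intro sum.group[symmetric] finite_words) auto
    also have "\<dots> = (\<Sum>w\<in>words b k. real (b ^ (m - (\<Sum>j\<in>UNIV. k j))) * \<phi> w)"
    proof (rule sum.cong[OF refl])
      fix w assume w: "w \<in> words b k"
      have "{i \<in> {..<b ^ m}. W p i = w} =
          {i. i < b ^ m \<and> (\<lambda>j. map (scrambled_digit p (\<lambda>j. digit b (x i $ j)) j) [0..<k j]) = w}"
        by (auto simp: W_def point_digits_def[abs_def])
      then have "card {i \<in> {..<b ^ m}. W p i = w} = b ^ (m - (\<Sum>j\<in>UNIV. k j))"
        using scrambled_net_prefix_count[OF net b p k w] by simp
      then show "(\<Sum>i\<in>{i \<in> {..<b ^ m}. W p i = w}. \<phi> (W p i)) = real (b ^ (m - (\<Sum>j\<in>UNIV. k j))) * \<phi> w"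
        by simp
    qed
    finally show ?thesis by (simp add: c_def sum_distrib_left)
  qed
  have "c = (\<integral>p. c \<partial>(Perms b :: ('d \<times> nat list \<Rightarrow> nat \<Rightarrow> nat) measure))" by (simp add: P.prob_space)
  also have "\<dots> = (\<integral>p. (\<Sum>i<b ^ m. cell_mean p i k) \<partial>Perms b)"
    by (intro Bochner_Integration.integral_cong refl sum[symmetric])
  also have "\<dots> = (\<Sum>i<b ^ m. \<integral>p. cell_mean p i k \<partial>Perms b)"
    by (intro Bochner_Integration.integral_sum P.square_integrable_imp_integrable cell_mean_square_integrable)
  also have "\<dots> = real (b ^ m) * (\<integral>s. h s \<partial>Ucube)" by (simp add: integral_cell_mean)
  finally show ?thesis using sum[OF p] by simp
qed

lemma sum_detail_eq_0:
  assumes \<kappa>: "(\<Sum>j\<in>UNIV. \<kappa> j) + t \<le> m" "\<kappa> \<noteq> (\<lambda>_. 0)" and p: "p \<in> space (Perms b)"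
  shows "(\<Sum>i<b ^ m. detail \<kappa> p i) = 0"
  unfolding detail_def level_diff_linear
proof (rule level_diff_const_below[OF _ \<kappa>(2)])
  fix k :: "'d \<Rightarrow> nat" assume "\<And>j. k j \<le> \<kappa> j"
  then have "(\<Sum>j\<in>UNIV. k j) + t \<le> m" using sum_mono[of UNIV k \<kappa>] \<kappa>(1) by fastforce
  then show "(\<Sum>i<b ^ m. cell_mean p i k) = real (b ^ m) * (\<integral>s. h s \<partial>Ucube)" by (rule sum_cell_mean[OF _ p])
qed

lemma detail_0: "detail (\<lambda>_. 0) p i = (\<integral>s. h s \<partial>Ucube)"
  by (simp add: detail_def level_diff_zero cell_mean_def blurred_def)

lemma sum_detail: "(\<Sum>\<kappa>\<in>levels (m + 1). detail \<kappa> p i) = h (\<lambda>j. scramble b p (x i) $ j)"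
proof -
  have "(\<Sum>\<kappa>\<in>levels (m + 1). detail \<kappa> p i) = cell_mean p i (\<lambda>_. m + 1)"
    unfolding detail_def by (rule sum_level_diff)
  also have "pt p i (\<lambda>_. m + 1) s = (\<lambda>j. scramble b p (x i) $ j)" for s
    by (auto simp: blurred_def blur_def scramble_def scrambled_digit_def point_digits_def)
  then have "cell_mean p i (\<lambda>_. m + 1) = h (\<lambda>j. scramble b p (x i) $ j)"
    using C.prob_space by (simp add: cell_mean_def)
  finally show ?thesis .
qed

text \<open>Coarsening coordinate \<open>j\<close> to a level \<open>K\<close> leaves the correlation with \<open>r\<close> unchanged when \<open>r\<close> does not depend on the
  permutations that are averaged out.\<close>

lemma integral_cell_mean_mult:
  assumes r: "square_integrable (Perms b) r" and K: "K \<le> m" "K \<le> k j"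
    and inv: "\<And>p p'. r (splice {(j, map (point_digits i j) [0..<l]) | l. l \<ge> K} p p') = r p"
  shows "(\<integral>p. cell_mean p i k * r p \<partial>Perms b) = (\<integral>p. cell_mean p i (k(j := K)) * r p \<partial>Perms b)"
proof -
  have rm[measurable]: "r \<in> borel_measurable (Perms b)" using r by (simp add: square_integrable_def)
  let ?N = "PiM UNIV (\<lambda>_. borel) \<Otimes>\<^sub>M borel :: (('d \<Rightarrow> real) \<times> real) measure"
  let ?f = "\<lambda>k (p, s). (pt p i k s, r p)"
  have f: "?f k \<in> measurable (Perms b \<Otimes>\<^sub>M Ucube) ?N" for k
    using pt_meas[of i k] by (auto simp: split_beta' intro!: measurable_Pair)
  have hm: "(\<lambda>(e, \<rho>). h e * \<rho>) \<in> borel_measurable ?N"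
    unfolding split_beta'
    by (rule borel_measurable_times[OF measurable_compose[OF measurable_fst h_meas] measurable_snd])
  have "integrable (Perms b \<Otimes>\<^sub>M (Ucube :: ('d \<Rightarrow> real) measure)) (\<lambda>q. (r (fst q))\<^sup>2)"
    using integrable_distr_eq[of fst "Perms b \<Otimes>\<^sub>M (Ucube :: ('d \<Rightarrow> real) measure)" "Perms b" "\<lambda>p. (r p)\<^sup>2"] r
    by (simp add: square_integrable_def C.distr_pair_fst)
  then have r2: "square_integrable (Perms b \<Otimes>\<^sub>M (Ucube :: ('d \<Rightarrow> real) measure)) (\<lambda>(p, s). r p)"
    by (simp add: square_integrable_def split_beta')
  have eq: "(\<integral>p. cell_mean p i k * r p \<partial>Perms b) = (\<integral>y. (case y of (e, \<rho>) \<Rightarrow> h e * \<rho>) \<partial>distr (Perms b \<Otimes>\<^sub>M Ucube) ?N (?f k))" for k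
  proof -
    have int: "integrable (Perms b \<Otimes>\<^sub>M Ucube) (\<lambda>(p, s). h (pt p i k s) * r p)"
      using square_integrable_mult[OF pt_square_integrable[of i k] r2] by (simp add: split_beta')
    have "(\<integral>p. cell_mean p i k * r p \<partial>Perms b) = (\<integral>p. \<integral>s. h (pt p i k s) * r p \<partial>Ucube \<partial>Perms b)"
      by (simp add: cell_mean_def)
    also have "\<dots> = (\<integral>(p, s). h (pt p i k s) * r p \<partial>(Perms b \<Otimes>\<^sub>M Ucube))"
      using PC.integral_fst'[OF int] by simp
    also have "\<dots> = (\<integral>y. (case y of (e, \<rho>) \<Rightarrow> h e * \<rho>) \<partial>distr (Perms b \<Otimes>\<^sub>M Ucube) ?N (?f k))"
      by (subst integral_distr[OF f hm]) (simp add: split_beta')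
    finally show ?thesis .
  qed
  show ?thesis
    unfolding eq
    using distr_blurred_step[where \<alpha> = "point_digits i" and r = r and k = k and j = j and K = K and N = m,
        OF b point_digits_less K rm inv] by simp
qed

text \<open>When the two points differ within their first \<open>\<kappa>\<^sub>j - 1\<close> digits in coordinate \<open>j\<close>, the second one uses none of the permutations
  for the later digits of the first, while averaging over these cancels level \<open>\<kappa>\<^sub>j\<close> against level \<open>\<kappa>\<^sub>j - 1\<close>.\<close>

lemma detail_orthogonal:
  assumes \<kappa>: "\<kappa> \<in> levels (m + 1)"
    and ne: "map (point_digits i' j) [0..<\<kappa> j - 1] \<noteq> map (point_digits i j) [0..<\<kappa> j - 1]"
  shows "(\<integral>p. detail \<kappa> p i * detail \<kappa> p i' \<partial>Perms b) = 0"
proof -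
  define K where "K = \<kappa> j - 1"
  have \<kappa>j: "\<kappa> j > 0" using ne by (cases "\<kappa> j") auto
  have "\<kappa> j \<le> m + 1" using \<kappa> by (simp add: levels_def)
  then have K: "K \<le> m" unfolding K_def by linarith
  define A where "A = {(j, map (point_digits i j) [0..<l]) | l. l \<ge> K}"
  have notin: "(j', map (point_digits i' j') [0..<l]) \<notin> A" for j' l
  proof
    assume "(j', map (point_digits i' j') [0..<l]) \<in> A"
    then obtain l0 where j': "j' = j" and l0: "l0 \<ge> K" and l: "map (point_digits i' j) [0..<l] = map (point_digits i j) [0..<l0]"
      unfolding A_def by blast
    from arg_cong[OF l, of length] have "l = l0" by simp
    with l l0 have "map (point_digits i' j) [0..<K] = map (point_digits i j) [0..<K]" by auto
    then show False using ne by (simp add: K_def)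
  qed
  have "scrambled_digit (splice A p p') (point_digits i') = scrambled_digit p (point_digits i')" for p p'
    using notin by (intro ext) (simp add: scrambled_digit_def splice_def)
  then have inv: "detail \<kappa> (splice A p p') i' = detail \<kappa> p i'" for p p'
    by (simp add: detail_def cell_mean_def[abs_def] blurred_def)
  define R where "R k = (\<integral>p. cell_mean p i k * detail \<kappa> p i' \<partial>Perms b)" for k
  have R: "R k = R (k(j := K))" if "K \<le> k j" for k
    unfolding R_def
    by (rule integral_cell_mean_mult[where r = "\<lambda>p. detail \<kappa> p i'" and i = i and k = k and j = j and K = K,
        OF detail_square_integrable K that inv[unfolded A_def]])
  let ?v = "{j. \<kappa> j > 0} - {j}"
  have v: "{j. \<kappa> j > 0} = insert j ?v" using \<kappa>j by auto
  have "(\<integral>p. detail \<kappa> p i * detail \<kappa> p i' \<partial>Perms b) = level_diff \<kappa> R"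
  proof -
    have int: "integrable (Perms b) (\<lambda>p. cell_mean p i k * detail \<kappa> p i')" for k
      by (rule square_integrable_mult[OF cell_mean_square_integrable detail_square_integrable])
    have "(\<integral>p. detail \<kappa> p i * detail \<kappa> p i' \<partial>Perms b) =
        (\<integral>p. level_diff \<kappa> (\<lambda>k. cell_mean p i k * detail \<kappa> p i') \<partial>Perms b)"
      unfolding detail_def[of \<kappa> _ i] level_diff_def alt_def by (simp add: sum_distrib_right mult.assoc)
    also have "\<dots> = level_diff \<kappa> R"
      unfolding level_diff_def alt_def R_def using int
      by (subst Bochner_Integration.integral_sum) auto
    finally show ?thesis .
  qed
  also have "\<dots> = alt ?v \<kappa> (\<lambda>j. \<kappa> j - 1) R \<kappa> - alt ?v \<kappa> (\<lambda>j. \<kappa> j - 1) R (\<kappa>(j := K))"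
    unfolding level_diff_def by (subst v, subst alt_insert) (auto simp: K_def)
  also have "alt ?v \<kappa> (\<lambda>j. \<kappa> j - 1) R \<kappa> = alt ?v \<kappa> (\<lambda>j. \<kappa> j - 1) R (\<kappa>(j := K))"
    unfolding alt_def
  proof (intro sum.cong refl arg_cong2[of _ _ _ _ "(*)"])
    fix S assume S: "S \<in> Pow ?v"
    let ?k = "\<lambda>i. if i \<in> S then \<kappa> i - 1 else if i \<in> ?v then \<kappa> i else \<kappa> i"
    have "R ?k = R (?k(j := K))" using S by (intro R) (auto simp: K_def)
    also have "?k(j := K) = (\<lambda>i. if i \<in> S then \<kappa> i - 1 else if i \<in> ?v then \<kappa> i else (\<kappa>(j := K)) i)"
      using S by (intro ext) auto
    finally show "R ?k = R (\<lambda>i. if i \<in> S then \<kappa> i - 1 else if i \<in> ?v then \<kappa> i else (\<kappa>(j := K)) i)" .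
  qed
  finally show ?thesis by (simp add: fun_upd_def)
qed

text \<open>Only pairs in a common box of level \<open>\<kappa> - 1\<close> are correlated, and every point has boundedly many such partners.
  This is the bound on the gain coefficients of the scrambled net, with a cruder constant.\<close>

lemma detail_sum_second_moment:
  assumes \<kappa>: "\<kappa> \<in> levels (m + 1)" "m < (\<Sum>j\<in>UNIV. \<kappa> j) + t"
    and V: "\<And>i. (\<integral>p. (detail \<kappa> p i)\<^sup>2 \<partial>Perms b) \<le> V"
  shows "(\<integral>p. (\<Sum>i<b ^ m. detail \<kappa> p i)\<^sup>2 \<partial>Perms b) \<le> real (b ^ m) * real (b ^ (t + CARD('d))) * V"
proof -
  let ?c = "\<lambda>i i'. \<integral>p. detail \<kappa> p i * detail \<kappa> p i' \<partial>Perms b"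
  have int: "integrable (Perms b) (\<lambda>p. detail \<kappa> p i * detail \<kappa> p i')" for i i'
    by (rule square_integrable_mult[OF detail_square_integrable detail_square_integrable])
  have V0: "V \<ge> 0" by (rule order_trans[OF _ V[of 0]]) (rule integral_nonneg_AE, simp)
  have c: "?c i i' \<le> V" for i i'
  proof -
    have "?c i i' \<le> (\<integral>p. ((detail \<kappa> p i)\<^sup>2 + (detail \<kappa> p i')\<^sup>2) / 2 \<partial>Perms b)"
    proof (rule integral_mono[OF int])
      show "integrable (Perms b) (\<lambda>p. ((detail \<kappa> p i)\<^sup>2 + (detail \<kappa> p i')\<^sup>2) / 2)"
        using detail_square_integrable by (auto simp: square_integrable_def)
      show "detail \<kappa> p i * detail \<kappa> p i' \<le> ((detail \<kappa> p i)\<^sup>2 + (detail \<kappa> p i')\<^sup>2) / 2" for p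
        using sum_squares_bound[of "detail \<kappa> p i" "detail \<kappa> p i'"] by simp
    qed
    also have "\<dots> = ((\<integral>p. (detail \<kappa> p i)\<^sup>2 \<partial>Perms b) + (\<integral>p. (detail \<kappa> p i')\<^sup>2 \<partial>Perms b)) / 2"
      using detail_square_integrable by (simp add: square_integrable_def)
    also have "\<dots> \<le> V" using V[of i] V[of i'] by simp
    finally show ?thesis .
  qed
  have "(\<integral>p. (\<Sum>i<b ^ m. detail \<kappa> p i)\<^sup>2 \<partial>Perms b) = (\<Sum>i<b ^ m. \<Sum>i'<b ^ m. ?c i i')"
    unfolding power2_eq_square sum_product using int by (simp add: Bochner_Integration.integral_sum)
  also have "\<dots> \<le> (\<Sum>i<b ^ m. real (b ^ (t + CARD('d))) * V)"
  proof (rule sum_mono)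
    fix i assume "i \<in> {..<b ^ m}"
    let ?N = "{i'. i' < b ^ m \<and> (\<forall>j. map (digit b (x i' $ j)) [0..<\<kappa> j - 1] = map (digit b (x i $ j)) [0..<\<kappa> j - 1])}"
    have "(\<Sum>i'<b ^ m. ?c i i') = (\<Sum>i'\<in>?N. ?c i i')"
    proof (rule sum.mono_neutral_right)
      show "\<forall>i'\<in>{..<b ^ m} - ?N. ?c i i' = 0"
      proof
        fix i' assume "i' \<in> {..<b ^ m} - ?N"
        then obtain j where "map (digit b (x i' $ j)) [0..<\<kappa> j - 1] \<noteq> map (digit b (x i $ j)) [0..<\<kappa> j - 1]" by blast
        then show "?c i i' = 0"
          by (intro detail_orthogonal[OF \<kappa>(1), of i' j]) (simp add: point_digits_def[abs_def])
      qed
    qed auto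
    also have "\<dots> \<le> real (card ?N) * V"
      using sum_bounded_above[of ?N "?c i" V] c by simp
    also have "\<dots> \<le> real (b ^ (t + CARD('d))) * V"
      using net_neighbour_count[OF net b tm \<kappa>(2), of i] V0
      by (intro mult_right_mono) (simp_all only: of_nat_le_iff)
    finally show "(\<Sum>i'<b ^ m. ?c i i') \<le> real (b ^ (t + CARD('d))) * V" .
  qed
  also have "\<dots> = real (b ^ m) * real (b ^ (t + CARD('d))) * V" by simp
  finally show ?thesis .
qed

lemma error_square_integrable:
  "square_integrable (Perms b) (\<lambda>p. (\<Sum>i<b ^ m. h (\<lambda>j. scramble b p (x i) $ j)) / c - c')"
proof -
  have "square_integrable (Perms b) (\<lambda>p. (1 / c) * (\<Sum>i<b ^ m. \<Sum>\<kappa>\<in>levels (m + 1). detail \<kappa> p i) + (- c'))"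
    by (intro square_integrable_add square_integrable_cmult square_integrable_sum detail_square_integrable)
       (simp add: square_integrable_def)
  then show ?thesis unfolding sum_detail by simp
qed

text \<open>The level 0 produces the integral and the resolved levels sum to zero, so the error consists of the
  fine levels alone. Their number is polynomial in \<open>m\<close>, so the inequality of Cauchy and Schwarz over
  the levels costs only a power of \<open>m\<close>.\<close>

lemma mean_square_error_le:
  assumes V: "\<And>\<kappa> i. \<kappa> \<in> levels (m + 1) \<Longrightarrow> m < (\<Sum>j\<in>UNIV. \<kappa> j) + t \<Longrightarrow> (\<integral>p. (detail \<kappa> p i)\<^sup>2 \<partial>Perms b) \<le> V"
    and V0: "0 \<le> V"
  defines "err \<equiv> \<lambda>p. (\<Sum>i<b ^ m. h (\<lambda>j. scramble b p (x i) $ j)) / real (b ^ m) - (\<integral>s. h s \<partial>Ucube)"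
  shows "(\<integral>p. (err p)\<^sup>2 \<partial>Perms b) \<le> (real (m + 2) ^ CARD('d))\<^sup>2 * (real (b ^ (t + CARD('d))) * V / real (b ^ m))"
proof -
  let ?n = "real (b ^ m)"
  have n: "?n > 0" using b by simp
  define \<Lambda> where "\<Lambda> = {\<kappa> \<in> levels (m + 1). m < (\<Sum>j\<in>UNIV. \<kappa> (j :: 'd)) + t}"
  have fin: "finite \<Lambda>" by (rule finite_subset[OF _ finite_levels[of "m + 1"]]) (auto simp: \<Lambda>_def)
  define E where "E p = (\<Sum>\<kappa>\<in>\<Lambda>. \<Sum>i<b ^ m. detail \<kappa> p i)" for p
  have err: "err p = E p / ?n" if p: "p \<in> space (Perms b)" for p
  proof -
    have "(\<Sum>i<b ^ m. h (\<lambda>j. scramble b p (x i) $ j)) = (\<Sum>\<kappa>\<in>levels (m + 1). \<Sum>i<b ^ m. detail \<kappa> p i)"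
      unfolding sum_detail[symmetric] by (rule sum.swap)
    also have "\<dots> = (\<Sum>\<kappa>\<in>insert (\<lambda>_. 0) \<Lambda>. \<Sum>i<b ^ m. detail \<kappa> p i)"
    proof (rule sum.mono_neutral_right[OF finite_levels])
      show "insert (\<lambda>_. 0) \<Lambda> \<subseteq> levels (m + 1)" by (auto simp: \<Lambda>_def levels_def)
      show "\<forall>\<kappa>\<in>levels (m + 1) - insert (\<lambda>_. 0) \<Lambda>. (\<Sum>i<b ^ m. detail \<kappa> p i) = 0"
        using sum_detail_eq_0[OF _ _ p] by (auto simp: \<Lambda>_def not_less)
    qed
    also have "\<dots> = ?n * (\<integral>s. h s \<partial>Ucube) + E p"
      using fin tm by (subst sum.insert) (auto simp: \<Lambda>_def E_def detail_0)
    finally show ?thesis using n by (simp add: err_def field_simps)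
  qed
  have sqD: "square_integrable (Perms b) (\<lambda>p. \<Sum>i<b ^ m. detail \<kappa> p i)" for \<kappa>
    by (intro square_integrable_sum detail_square_integrable)
  have sqE: "square_integrable (Perms b) (\<lambda>p. E p / ?n)"
    using square_integrable_cmult[of "Perms b" E "1 / ?n"] square_integrable_sum[of \<Lambda> "Perms b" "\<lambda>\<kappa> p. \<Sum>i<b ^ m. detail \<kappa> p i"] sqD
    by (simp add: E_def[abs_def])
  have "(\<integral>p. (err p)\<^sup>2 \<partial>Perms b) = (\<integral>p. (E p / ?n)\<^sup>2 \<partial>Perms b)"
    using err by (intro Bochner_Integration.integral_cong) auto
  also have "\<dots> \<le> (\<integral>p. real (card \<Lambda>) / ?n\<^sup>2 * (\<Sum>\<kappa>\<in>\<Lambda>. (\<Sum>i<b ^ m. detail \<kappa> p i)\<^sup>2) \<partial>Perms b)"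
  proof (rule integral_mono)
    show "integrable (Perms b) (\<lambda>p. (E p / ?n)\<^sup>2)" using sqE by (simp add: square_integrable_def)
    show "integrable (Perms b) (\<lambda>p. real (card \<Lambda>) / ?n\<^sup>2 * (\<Sum>\<kappa>\<in>\<Lambda>. (\<Sum>i<b ^ m. detail \<kappa> p i)\<^sup>2))"
      using sqD by (auto simp: square_integrable_def)
    fix p
    show "(E p / ?n)\<^sup>2 \<le> real (card \<Lambda>) / ?n\<^sup>2 * (\<Sum>\<kappa>\<in>\<Lambda>. (\<Sum>i<b ^ m. detail \<kappa> p i)\<^sup>2)"
      using divide_right_mono[OF square_sum_le[of "\<lambda>\<kappa>. \<Sum>i<b ^ m. detail \<kappa> p i" \<Lambda>], of "?n\<^sup>2"]
      by (simp add: E_def power_divide)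
  qed
  also have "\<dots> = real (card \<Lambda>) / ?n\<^sup>2 * (\<Sum>\<kappa>\<in>\<Lambda>. \<integral>p. (\<Sum>i<b ^ m. detail \<kappa> p i)\<^sup>2 \<partial>Perms b)"
    using sqD by (simp add: square_integrable_def Bochner_Integration.integral_sum)
  also have "\<dots> \<le> real (card \<Lambda>) / ?n\<^sup>2 * (\<Sum>\<kappa>\<in>\<Lambda>. ?n * real (b ^ (t + CARD('d))) * V)"
    by (intro mult_left_mono sum_mono detail_sum_second_moment V) (auto simp: \<Lambda>_def)
  also have "\<dots> = (real (card \<Lambda>))\<^sup>2 * (real (b ^ (t + CARD('d))) * V / ?n)"
    using n by (simp add: power2_eq_square)
  also have "\<dots> \<le> (real (m + 2) ^ CARD('d))\<^sup>2 * (real (b ^ (t + CARD('d))) * V / ?n)"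
  proof -
    have "card \<Lambda> \<le> (m + 2) ^ CARD('d)"
      using card_mono[OF finite_levels, of \<Lambda> "m + 1"] card_levels[where 'd = 'd, of "m + 1"] by (auto simp: \<Lambda>_def)
    then have "real (card \<Lambda>) \<le> real (m + 2) ^ CARD('d)" by (metis of_nat_le_iff of_nat_power)
    then show ?thesis using n V0 by (intro mult_right_mono power_mono) auto
  qed
  finally show "(\<integral>p. (err p)\<^sup>2 \<partial>Perms b) \<le> (real (m + 2) ^ CARD('d))\<^sup>2 * (real (b ^ (t + CARD('d))) * V / ?n)" .
qed

end

section \<open>Variance of the details\<close>

lemma partial_expansion_le:
  assumes "\<And>l. d l < b" "b \<ge> 2"
  shows "(\<Sum>l<k. real (d l) / real b ^ Suc l) \<le> 1 - 1 / real b ^ k"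
proof (induction k)
  case (Suc k)
  have "real (d k) + 1 \<le> real b" using assms(1)[of k] by linarith
  then have "real (d k) / real b ^ Suc k \<le> (real b - 1) / real b ^ Suc k" by (intro divide_right_mono) auto
  also have "\<dots> = 1 / real b ^ k - 1 / real b ^ Suc k" using assms(2) by (simp add: field_simps)
  finally show ?case using Suc by simp
qed simp

lemma blur_unit_interval:
  assumes d: "\<And>l. d l < b" and b: "b \<ge> 2" and s: "0 \<le> s" "s \<le> 1"
  shows "0 \<le> blur b N d k s" "blur b N d k s \<le> 1"
proof -
  have "s / real b ^ k \<le> 1 / real b ^ k" using s by (intro divide_right_mono) auto
  then have "(\<Sum>l<k. real (d l) / real b ^ Suc l) + s / real b ^ k \<le> 1"
    using partial_expansion_le[of d b k, OF d b] by linarith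
  moreover have "0 \<le> (\<Sum>l<k. real (d l) / real b ^ Suc l) + s / real b ^ k"
    using s by (intro add_nonneg_nonneg sum_nonneg) auto
  ultimately show "0 \<le> blur b N d k s" "blur b N d k s \<le> 1"
    using digit_series(2,3)[of d b, OF d b] by (auto simp: blur_def)
qed

lemma blur_diff_le:
  assumes d: "\<And>l. d l < b" and b: "b \<ge> 2" and s: "0 \<le> s" "s \<le> 1" and K: "K \<le> N" "K \<le> k"
  shows "\<bar>blur b N d k s - blur b N d K s\<bar> \<le> 1 / real b ^ K"
proof -
  let ?\<beta> = "blur b (N - K) (\<lambda>l. d (l + K)) (k - K) s"
  have "blur b N d k s - blur b N d K s = (?\<beta> - s) / real b ^ K"
    using blur_split[of d b K N k s, OF d b K] blur_split[of d b K N K s, OF d b K(1)] by (simp add: diff_divide_distrib)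
  moreover have "\<bar>?\<beta> - s\<bar> \<le> 1"
    using blur_unit_interval[of "\<lambda>l. d (l + K)" b s "N - K" "k - K", OF d b s] s by (auto simp: abs_le_iff)
  ultimately show ?thesis using b by (simp add: divide_right_mono)
qed

lemma AE_Ucube: "AE s in Ucube. \<forall>j. s j \<in> {0<..<1}"
proof -
  have "AE s in Ucube. s j \<in> {0<..<1}" for j
    unfolding Ucube_def
    using AE_PiM_component[of UNIV "\<lambda>_. U01" j "\<lambda>s. s \<in> {0<..<1}", OF prob_space_U01 _ AE_U01] by simp
  then show ?thesis by (subst AE_all_countable) auto
qed

lemma nn_integral_powr_unit_interval:
  assumes "a < 1"
  shows "(\<integral>\<^sup>+s. ennreal (s powr (- a)) \<partial>U01) < \<infinity>"
proof -
  have "((\<lambda>x. x powr (- a)) has_integral 1 powr (- a + 1) / (- a + 1)) {0..1}"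
    using assms by (intro has_integral_powr_from_0) auto
  then have "((\<lambda>x. if x \<in> {0..1} then x powr (- a) else 0) has_integral 1 powr (- a + 1) / (- a + 1)) UNIV"
    by (simp only: has_integral_restrict_UNIV)
  then have "(\<integral>\<^sup>+s. ennreal (if s \<in> {0..1} then s powr (- a) else 0) \<partial>lborel) = ennreal (1 powr (- a + 1) / (- a + 1))"
    by (intro nn_integral_has_integral_lborel) auto
  moreover have "(\<integral>\<^sup>+s. ennreal (s powr (- a)) \<partial>U01) \<le> (\<integral>\<^sup>+s. ennreal (if s \<in> {0..1} then s powr (- a) else 0) \<partial>lborel)"
    by (subst nn_integral_U01) (auto intro!: nn_integral_mono simp: indicator_def)
  ultimately show ?thesis by (simp add: le_less_trans)
qed

lemma nn_integral_U01_reflect: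
  assumes [measurable]: "f \<in> borel_measurable borel"
  shows "(\<integral>\<^sup>+s. f (1 - s) \<partial>U01) = (\<integral>\<^sup>+s. f s \<partial>U01)"
proof -
  have "(\<integral>\<^sup>+s. f s \<partial>U01) = (\<integral>\<^sup>+s. f s * indicator {0<..<1} s \<partial>lborel)" by (rule nn_integral_U01) fact
  also have "\<dots> = ennreal \<bar>- 1 :: real\<bar> * (\<integral>\<^sup>+s. f (1 + (-1) * s) * indicator {0<..<1} (1 + (-1) * s) \<partial>lborel)"
    by (rule nn_integral_real_affine) auto
  also have "\<dots> = (\<integral>\<^sup>+s. f (1 - s) * indicator {0<..<1} s \<partial>lborel)"
    by (auto intro!: nn_integral_cong simp: indicator_def)
  also have "\<dots> = (\<integral>\<^sup>+s. f (1 - s) \<partial>U01)" by (rule nn_integral_U01[symmetric]) measurable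
  finally show ?thesis by simp
qed

lemma integrable_edge_squared:
  assumes "\<gamma> < 1 / 2"
  shows "integrable U01 (\<lambda>s. (edge \<gamma> s)\<^sup>2)"
proof -
  have m: "(\<lambda>s. s powr a) \<in> borel_measurable U01" "(\<lambda>s. (1 - s) powr a) \<in> borel_measurable U01" for a
    by measurable
  have i1: "integrable U01 (\<lambda>s. s powr (- (2 * \<gamma>)))"
    using nn_integral_powr_unit_interval[of "2 * \<gamma>"] assms m by (intro integrableI_nonneg) auto
  have i2: "integrable U01 (\<lambda>s. (1 - s) powr (- (2 * \<gamma>)))"
    using nn_integral_powr_unit_interval[of "2 * \<gamma>"] assms m
      nn_integral_U01_reflect[of "\<lambda>s. ennreal (s powr (- (2 * \<gamma>)))"] by (intro integrableI_nonneg) auto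
  have sq: "(r powr (- \<gamma>))\<^sup>2 = r powr (- (2 * \<gamma>))" for r :: real
    by (simp add: power2_eq_square powr_add[symmetric])
  show ?thesis
  proof (rule Bochner_Integration.integrable_bound)
    show "integrable U01 (\<lambda>s. 2 * s powr (- (2 * \<gamma>)) + 2 * (1 - s) powr (- (2 * \<gamma>)))"
      using i1 i2 by auto
    show "(\<lambda>s. (edge \<gamma> s)\<^sup>2) \<in> borel_measurable U01" unfolding edge_def by measurable
    have "(edge \<gamma> s)\<^sup>2 \<le> 2 * s powr (- (2 * \<gamma>)) + 2 * (1 - s) powr (- (2 * \<gamma>))" for s
      using sum_squares_bound[of "s powr (- \<gamma>)" "(1 - s) powr (- \<gamma>)"]
      unfolding edge_def power2_sum sq by linarith
    then show "AE s in U01. norm ((edge \<gamma> s)\<^sup>2) \<le> norm (2 * s powr (- (2 * \<gamma>)) + 2 * (1 - s) powr (- (2 * \<gamma>)))"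
      by simp
  qed
qed

definition cube_edge :: "real \<Rightarrow> ('d::finite \<Rightarrow> real) \<Rightarrow> real" where
  "cube_edge \<gamma> s = (\<Prod>j\<in>UNIV. edge \<gamma> (s j))"

lemma square_integrable_cube_edge:
  assumes "\<gamma> < 1 / 2"
  shows "square_integrable Ucube (cube_edge \<gamma> :: ('d::finite \<Rightarrow> real) \<Rightarrow> real)"
proof -
  interpret U: prob_space U01 by (rule prob_space_U01)
  interpret product_sigma_finite "\<lambda>_::'d. U01"
    by (rule product_sigma_finite.intro) (rule U.sigma_finite_measure_axioms)
  have "integrable Ucube (\<lambda>s :: 'd \<Rightarrow> real. \<Prod>j\<in>UNIV. (edge \<gamma> (s j))\<^sup>2)"
    unfolding Ucube_def by (rule product_integrable_prod) (auto intro: integrable_edge_squared assms)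
  moreover have "(\<lambda>s :: 'd \<Rightarrow> real. edge \<gamma> (s j)) \<in> borel_measurable Ucube" for j
  proof -
    have "edge \<gamma> \<in> borel_measurable borel" unfolding edge_def[abs_def] by measurable
    from measurable_compose[OF measurable_component_Ucube this] show ?thesis .
  qed
  then have "(cube_edge \<gamma> :: ('d \<Rightarrow> real) \<Rightarrow> real) \<in> borel_measurable Ucube"
    unfolding cube_edge_def[abs_def] by measurable
  ultimately show ?thesis
    by (simp add: square_integrable_def cube_edge_def prod_power_distrib)
qed

context scrambled_net
begin

text \<open>Neighbouring levels of a coordinate differ by at most one cell width \<open>b ^ (1 - \<kappa>\<^sub>j)\<close>. Expanding the product of the
  sums of weights expresses the bound through weights at blurred points, each of which is uniform
  in the cube.\<close>

lemma level_diff_bound: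
  assumes h: "hoelder_growth C \<theta> \<gamma> h" and C: "C \<ge> 0" and \<theta>: "\<theta> \<ge> 0" and \<kappa>: "\<kappa> \<in> levels (m + 1)"
    and p: "p \<in> space (Perms b)" and s: "\<And>j. s j \<in> {0<..<1}"
    and inside: "\<And>k j. k \<in> levels (m + 1) \<Longrightarrow> pt p i k s j \<in> {0<..<1}"
  defines "v \<equiv> {j. \<kappa> j > 0}"
  shows "\<bar>level_diff \<kappa> (\<lambda>k. h (pt p i k s))\<bar> \<le>
    C * real b powr (- \<theta> * real (\<Sum>j\<in>UNIV. \<kappa> j - 1)) *
      (\<Sum>S\<in>Pow v. cube_edge \<gamma> (pt p i (\<lambda>j. if j \<in> S then \<kappa> j - 1 else \<kappa> j) s))"
proof -
  let ?y = "pt p i \<kappa> s" and ?z = "pt p i (\<lambda>j. \<kappa> j - 1) s"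
  let ?B = "real b powr (- \<theta> * real (\<Sum>j\<in>UNIV. \<kappa> j - 1))"
  have b1: "real b > 0" using b by simp
  have \<kappa>1: "(\<lambda>j. \<kappa> j - 1) \<in> levels (m + 1)"
    using \<kappa> unfolding levels_def by (auto intro: le_trans[OF diff_le_self])
  have \<kappa>m: "\<kappa> j - 1 \<le> m" for j
    using \<kappa> unfolding levels_def by (auto simp: le_diff_conv)
  have "level_diff \<kappa> (\<lambda>k. h (pt p i k s)) = alt v ?y ?z h ?y"
    unfolding level_diff_def alt_def v_def
    by (intro sum.cong refl arg_cong2[of _ _ _ _ "(*)"] arg_cong[of _ _ h] ext) (simp add: blurred_def)
  then have "\<bar>level_diff \<kappa> (\<lambda>k. h (pt p i k s))\<bar> \<le>
      C * (\<Prod>j\<in>v. \<bar>?y j - ?z j\<bar> powr \<theta> * (edge \<gamma> (?y j) + edge \<gamma> (?z j))) * (\<Prod>j\<in>- v. edge \<gamma> (?y j))"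
    using h inside[OF \<kappa>] inside[OF \<kappa>1] unfolding hoelder_growth_def by simp
  also have "\<dots> \<le> C * (\<Prod>j\<in>v. real b powr (- \<theta> * real (\<kappa> j - 1)) * (edge \<gamma> (?z j) + edge \<gamma> (?y j))) * (\<Prod>j\<in>- v. edge \<gamma> (?y j))"
  proof (intro mult_right_mono mult_left_mono prod_mono conjI C prod_nonneg ballI)
    fix j
    have "\<bar>?y j - ?z j\<bar> \<le> 1 / real b ^ (\<kappa> j - 1)"
      unfolding blurred_def using s[of j]
      by (intro blur_diff_le[OF scrambled_digit_less[OF p point_digits_less] b _ _ \<kappa>m]) auto
    also have "\<dots> = real b powr (- real (\<kappa> j - 1))"
      using b1 by (simp add: powr_minus powr_realpow field_simps)
    finally have "\<bar>?y j - ?z j\<bar> powr \<theta> \<le> (real b powr (- real (\<kappa> j - 1))) powr \<theta>"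
      using \<theta> by (intro powr_mono2) auto
    also have "\<dots> = real b powr (- \<theta> * real (\<kappa> j - 1))" by (simp add: powr_powr mult.commute)
    finally have *: "\<bar>?y j - ?z j\<bar> powr \<theta> \<le> real b powr (- \<theta> * real (\<kappa> j - 1))" .
    show "\<bar>?y j - ?z j\<bar> powr \<theta> * (edge \<gamma> (?y j) + edge \<gamma> (?z j)) \<le>
        real b powr (- \<theta> * real (\<kappa> j - 1)) * (edge \<gamma> (?z j) + edge \<gamma> (?y j))"
      using mult_right_mono[OF *, of "edge \<gamma> (?y j) + edge \<gamma> (?z j)"] edge_nonneg[of \<gamma> "?y j"] edge_nonneg[of \<gamma> "?z j"]
      by (simp add: add.commute)
  qed (auto intro!: mult_nonneg_nonneg add_nonneg_nonneg edge_nonneg)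
  also have "\<dots> = C * (\<Prod>j\<in>v. real b powr (- \<theta> * real (\<kappa> j - 1))) *
      ((\<Prod>j\<in>v. edge \<gamma> (?z j) + edge \<gamma> (?y j)) * (\<Prod>j\<in>- v. edge \<gamma> (?y j)))"
    by (simp add: prod.distrib mult.assoc)
  also have "(\<Prod>j\<in>v. real b powr (- \<theta> * real (\<kappa> j - 1))) = ?B"
  proof -
    have "(\<Prod>j\<in>v. real b powr (- \<theta> * real (\<kappa> j - 1))) = real b powr (\<Sum>j\<in>v. - \<theta> * real (\<kappa> j - 1))"
      using b1 by (subst powr_sum) auto
    also have "(\<Sum>j\<in>v. - \<theta> * real (\<kappa> j - 1)) = (\<Sum>j\<in>UNIV. - \<theta> * real (\<kappa> j - 1))"
      by (rule sum.mono_neutral_left) (auto simp: v_def)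
    finally show ?thesis by (simp add: sum_distrib_left)
  qed
  also have "(\<Prod>j\<in>v. edge \<gamma> (?z j) + edge \<gamma> (?y j)) * (\<Prod>j\<in>- v. edge \<gamma> (?y j)) =
      (\<Sum>S\<in>Pow v. cube_edge \<gamma> (pt p i (\<lambda>j. if j \<in> S then \<kappa> j - 1 else \<kappa> j) s))"
    unfolding prod_add[OF finite] sum_distrib_right
  proof (rule sum.cong[OF refl])
    fix S assume S: "S \<in> Pow v"
    let ?e = "\<lambda>j. edge \<gamma> (pt p i (\<lambda>j. if j \<in> S then \<kappa> j - 1 else \<kappa> j) s j)"
    have "cube_edge \<gamma> (pt p i (\<lambda>j. if j \<in> S then \<kappa> j - 1 else \<kappa> j) s) = prod ?e (S \<union> ((v - S) \<union> (- v)))"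
      using S unfolding cube_edge_def by (intro prod.cong) auto
    also have "\<dots> = prod ?e S * (prod ?e (v - S) * prod ?e (- v))"
      using S by (subst prod.union_disjoint, simp, simp, blast) (subst prod.union_disjoint, auto)
    also have "prod ?e S = (\<Prod>j\<in>S. edge \<gamma> (?z j))" by (intro prod.cong) (auto simp: blurred_def)
    also have "prod ?e (v - S) = (\<Prod>j\<in>v - S. edge \<gamma> (?y j))" by (intro prod.cong) (auto simp: blurred_def)
    also have "prod ?e (- v) = (\<Prod>j\<in>- v. edge \<gamma> (?y j))" using S by (intro prod.cong) (auto simp: blurred_def)
    finally show "(\<Prod>j\<in>S. edge \<gamma> (?z j)) * (\<Prod>j\<in>v - S. edge \<gamma> (?y j)) * (\<Prod>j\<in>- v. edge \<gamma> (?y j)) =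
        cube_edge \<gamma> (pt p i (\<lambda>j. if j \<in> S then \<kappa> j - 1 else \<kappa> j) s)" by simp
  qed
  finally show ?thesis .
qed

lemma AE_pt_inside: "AE (p, s) in Perms b \<Otimes>\<^sub>M Ucube. \<forall>j. pt p i k s j \<in> {0<..<1}"
proof -
  have "AE s in distr (Perms b \<Otimes>\<^sub>M Ucube) (PiM UNIV (\<lambda>_. borel)) (\<lambda>(p, s). pt p i k s). \<forall>j. s j \<in> {0<..<1}"
    unfolding distr_blurred[of b "point_digits i" m k, OF b point_digits_less] by (rule AE_Ucube)
  from AE_distrD[OF pt_meas this] show ?thesis by (simp add: split_beta')
qed

text \<open>A detail is the mean of a mixed difference over the remainders; its second moment is at most that
  of the difference, and each weight in the pointwise bound has the law of the uniform one.\<close>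

lemma detail_second_moment:
  assumes hg: "hoelder_growth C \<theta> \<gamma> h" and C: "C \<ge> 0" and \<theta>: "\<theta> \<ge> 0" and \<gamma>: "\<gamma> < 1 / 2" and \<kappa>: "\<kappa> \<in> levels (m + 1)"
  shows "(\<integral>p. (detail \<kappa> p i)\<^sup>2 \<partial>Perms b) \<le>
    (C * real b powr (- \<theta> * real (\<Sum>j\<in>UNIV. \<kappa> j - 1)))\<^sup>2 * (4 ^ CARD('d) * (\<integral>s. (cube_edge \<gamma> s)\<^sup>2 \<partial>(Ucube :: ('d \<Rightarrow> real) measure)))"
proof -
  let ?M = "Perms b \<Otimes>\<^sub>M (Ucube :: ('d \<Rightarrow> real) measure)"
  define v where "v = {j. \<kappa> j > 0}"
  define D where "D = C * real b powr (- \<theta> * real (\<Sum>j\<in>UNIV. \<kappa> j - 1))"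
  define c where "c = (\<integral>s. (cube_edge \<gamma> s)\<^sup>2 \<partial>(Ucube :: ('d \<Rightarrow> real) measure))"
  define H where "H p s = level_diff \<kappa> (\<lambda>k. h (pt p i k s))" for p s
  let ?w = "\<lambda>S p s. cube_edge \<gamma> (pt p i (\<lambda>j. if j \<in> S then \<kappa> j - 1 else \<kappa> j) s)"
  note w2 = square_integrable_cube_edge[OF \<gamma>, where 'd = 'd]
  have c0: "c \<ge> 0" unfolding c_def by (rule integral_nonneg_AE) simp
  have sqH: "square_integrable ?M (\<lambda>(p, s). H p s)"
    unfolding H_def level_diff_def split_beta'
    using square_integrable_alt[of ?M "\<lambda>q k. h (pt (fst q) i k (snd q))"] pt_square_integrable[of i] by (simp add: split_beta')
  have below: "(\<lambda>j. if j \<in> S then \<kappa> j - 1 else if j \<in> v then \<kappa> j else \<kappa> j) \<in> levels (m + 1)" for S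
    using \<kappa> by (auto simp: levels_def intro: le_trans[OF diff_le_self])
  have "AE p in Perms b. detail \<kappa> p i = (\<integral>s. H p s \<partial>Ucube)"
  proof -
    have "AE p in Perms b. integrable Ucube (\<lambda>s. h (pt p i k s))" for k
      using PC.AE_integrable_fst'[OF pt_transfer(1)[OF C.square_integrable_imp_integrable[OF h], of i k]] by simp
    then have "AE p in Perms b. \<forall>k\<in>levels (m + 1). integrable Ucube (\<lambda>s. h (pt p i k s))"
      by (subst AE_finite_all[OF finite_levels]) auto
    then show ?thesis
    proof eventually_elim
      case (elim p)
      then show ?case
        unfolding detail_def H_def level_diff_def alt_def cell_mean_def v_def[symmetric]
        using below by (subst Bochner_Integration.integral_sum) auto
    qed
  qed
  then have "(\<integral>p. (detail \<kappa> p i)\<^sup>2 \<partial>Perms b) = (\<integral>p. (\<integral>s. H p s \<partial>Ucube)\<^sup>2 \<partial>Perms b)"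
    using detail_square_integrable[of \<kappa> i] PC.square_integrable_inner_integral(1)[OF sqH]
    by (intro integral_cong_AE) (auto simp: square_integrable_def elim!: eventually_mono)
  also have "\<dots> \<le> (\<integral>(p, s). (H p s)\<^sup>2 \<partial>?M)" by (rule PC.square_integrable_inner_integral(2)[OF sqH])
  also have "\<dots> \<le> (\<integral>(p, s). D\<^sup>2 * real (card (Pow v)) * (\<Sum>S\<in>Pow v. (?w S p s)\<^sup>2) \<partial>?M)"
  proof (rule integral_mono_AE)
    show "integrable ?M (\<lambda>(p, s). (H p s)\<^sup>2)" using sqH by (simp add: square_integrable_def split_beta')
    show "integrable ?M (\<lambda>(p, s). D\<^sup>2 * real (card (Pow v)) * (\<Sum>S\<in>Pow v. (?w S p s)\<^sup>2))"
      using pt_transfer(1)[of "\<lambda>s. (cube_edge \<gamma> s)\<^sup>2" i] w2 by (auto simp: square_integrable_def split_beta')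
    have "AE q in ?M. \<forall>k\<in>levels (m + 1). \<forall>j. pt (fst q) i k (snd q) j \<in> {0<..<1}"
      using AE_pt_inside[of i] by (subst AE_finite_all[OF finite_levels]) (auto simp: split_beta')
    then show "AE q in ?M. (case q of (p, s) \<Rightarrow> (H p s)\<^sup>2) \<le> (case q of (p, s) \<Rightarrow> D\<^sup>2 * real (card (Pow v)) * (\<Sum>S\<in>Pow v. (?w S p s)\<^sup>2))"
      using AE_space
    proof eventually_elim
      case (elim q)
      obtain p s where q: "q = (p, s)" by force
      have p: "p \<in> space (Perms b)" using elim(2) by (simp add: q space_pair_measure)
      have ins: "pt p i k s j \<in> {0<..<1}" if "k \<in> levels (m + 1)" for k j
        using elim(1) that by (simp add: q)
      have s: "s j \<in> {0<..<1}" for j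
        using ins[of "\<lambda>_. 0" j] by (simp add: levels_def blurred_def)
      have "\<bar>H p s\<bar> \<le> D * (\<Sum>S\<in>Pow v. ?w S p s)"
        unfolding H_def D_def v_def by (rule level_diff_bound[OF hg C \<theta> \<kappa> p s ins])
      then have "(H p s)\<^sup>2 \<le> (D * (\<Sum>S\<in>Pow v. ?w S p s))\<^sup>2" by (rule abs_le_square_iff[THEN iffD1, OF order_trans]) simp
      also have "\<dots> \<le> D\<^sup>2 * (real (card (Pow v)) * (\<Sum>S\<in>Pow v. (?w S p s)\<^sup>2))"
        unfolding power_mult_distrib by (intro mult_left_mono square_sum_le) simp
      finally show ?case by (simp add: q mult.assoc)
    qed
  qed
  also have "\<dots> = D\<^sup>2 * real (card (Pow v)) * (\<Sum>S\<in>Pow v. c)"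
    using pt_transfer[of "\<lambda>s. (cube_edge \<gamma> s)\<^sup>2" i] w2
    by (simp add: square_integrable_def split_beta' c_def Bochner_Integration.integral_sum)
  also have "\<dots> = D\<^sup>2 * ((real (card (Pow v)))\<^sup>2 * c)" by (simp add: power2_eq_square)
  also have "\<dots> \<le> D\<^sup>2 * (4 ^ CARD('d) * c)"
  proof (intro mult_left_mono mult_right_mono c0)
    have "card v \<le> CARD('d)" by (intro card_mono) auto
    then have "(4::real) ^ card v \<le> 4 ^ CARD('d)" by (intro power_increasing) auto
    moreover have "((2::real) ^ card v)\<^sup>2 = (2\<^sup>2) ^ card v"
      by (simp only: power_mult[symmetric] mult.commute)
    ultimately show "(real (card (Pow v)))\<^sup>2 \<le> 4 ^ CARD('d)" by (simp add: card_Pow)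
  qed simp
  finally show ?thesis by (simp add: D_def c_def)
qed

end

section \<open>From the canonical model to the estimator\<close>

lemma vec_lambda_measurable:
  assumes "\<And>j. (\<lambda>x. f x j) \<in> borel_measurable M"
  shows "(\<lambda>x. (\<chi> j. f x j) :: real^'n) \<in> borel_measurable M"
proof (subst borel_measurable_euclidean_space, intro ballI)
  fix e :: "real^'n" assume "e \<in> Basis"
  then obtain j where "e = axis j 1" by (auto simp: Basis_vec_def)
  then show "(\<lambda>x. (\<chi> j. f x j) \<bullet> e) \<in> borel_measurable M"
    using assms by (simp add: inner_axis)
qed

lemma distr_PiM_lborel_vec:
  "distr (PiM UNIV (\<lambda>_::'n::finite. lborel)) borel (\<lambda>f. (\<chi> j. f j) :: real^'n) = lborel"
proof (rule lborel_eqI[symmetric])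
  interpret product_sigma_finite "\<lambda>_::'n. lborel :: real measure" by standard
  have m: "(\<lambda>f. (\<chi> j. f j) :: real^'n) \<in> borel_measurable (PiM UNIV (\<lambda>_. lborel))"
    by (rule vec_lambda_measurable) simp
  fix l u :: "real^'n" assume le: "\<And>e. e \<in> Basis \<Longrightarrow> l \<bullet> e \<le> u \<bullet> e"
  have le': "l $ j \<le> u $ j" for j
    using le[of "axis j 1"] by (simp add: inner_axis axis_in_Basis_iff)
  have "emeasure (distr (PiM UNIV (\<lambda>_. lborel)) borel (\<lambda>f. (\<chi> j. f j) :: real^'n)) (box l u) =
      emeasure (PiM UNIV (\<lambda>_. lborel)) (PiE UNIV (\<lambda>j. {l $ j <..< u $ j}))"
    by (subst emeasure_distr[OF m]) (auto intro!: arg_cong[of _ _ "emeasure _"] simp: mem_box_cart space_PiM PiE_iff)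
  also have "\<dots> = (\<Prod>j\<in>UNIV. emeasure lborel {l $ j <..< u $ j})"
    by (rule emeasure_PiM) auto
  also have "\<dots> = ennreal (\<Prod>j\<in>UNIV. u $ j - l $ j)"
    using le' by (simp add: prod_ennreal)
  also have "(\<Prod>j\<in>UNIV. u $ j - l $ j) = (\<Prod>e\<in>Basis. (u - l) \<bullet> e)"
  proof -
    have B: "Basis = (\<lambda>j. axis j 1 :: real^'n) ` UNIV" by (auto simp: Basis_vec_def)
    have inj: "inj (\<lambda>j. axis j 1 :: real^'n)" by (auto simp: inj_def axis_eq_axis)
    show ?thesis unfolding B by (subst prod.reindex[OF inj]) (simp add: inner_axis)
  qed
  finally show "emeasure (distr (PiM UNIV (\<lambda>_. lborel)) borel (\<lambda>f. (\<chi> j. f j) :: real^'n)) (box l u) =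
      (\<Prod>e\<in>Basis. (u - l) \<bullet> e)" .
qed simp

lemma Ucube_eq_density:
  "(Ucube :: ('n::finite \<Rightarrow> real) measure) =
    density (PiM UNIV (\<lambda>_. lborel)) (\<lambda>f. \<Prod>j\<in>UNIV. indicator {0<..<1} (f j))" (is "_ = ?D")
  unfolding Ucube_def
proof (rule measure_eqI_PiM_infinite[OF refl])
  interpret product_sigma_finite "\<lambda>_::'n. lborel :: real measure" by standard
  show "finite_measure (PiM UNIV (\<lambda>_::'n. U01))"
    by (rule prob_space.axioms(1)[OF prob_space_PiM[OF prob_space_U01]])
  show "sets ?D = sets (PiM UNIV (\<lambda>_::'n. U01))" by (auto intro!: sets_PiM_cong)
  fix A and J :: "'n set" assume A: "\<And>i. i \<in> J \<Longrightarrow> A i \<in> sets U01"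
  define A' where "A' j = (if j \<in> J then A j else UNIV)" for j
  have A'[measurable]: "A' j \<in> sets borel" for j using A by (auto simp: A'_def)
  have emb: "prod_emb UNIV (\<lambda>_. U01) J (Pi\<^sub>E J A) = PiE UNIV A'"
    by (auto simp: prod_emb_def A'_def PiE_def Pi_def split: if_splits)
  have "emeasure ?D (PiE UNIV A') = (\<integral>\<^sup>+f. (\<Prod>j\<in>UNIV. indicator {0<..<1} (f j)) * indicator (PiE UNIV A') f \<partial>PiM UNIV (\<lambda>_. lborel))"
    by (rule emeasure_density) measurable
  also have "\<dots> = (\<integral>\<^sup>+f. (\<Prod>j\<in>UNIV. indicator ({0<..<1} \<inter> A' j) (f j)) \<partial>PiM UNIV (\<lambda>_. lborel))"
  proof (rule nn_integral_cong)
    fix f :: "'n \<Rightarrow> real"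
    have "(indicator (PiE UNIV A') f :: ennreal) = (\<Prod>j\<in>UNIV. indicator (A' j) (f j))"
      by (auto simp: indicator_def PiE_def Pi_def prod_zero_iff)
    then show "(\<Prod>j\<in>UNIV. indicator {0<..<1} (f j)) * indicator (PiE UNIV A') f =
      (\<Prod>j\<in>UNIV. indicator ({0<..<1} \<inter> A' j) (f j) :: ennreal)"
      by (simp add: prod.distrib[symmetric] indicator_inter_arith)
  qed
  also have "\<dots> = (\<Prod>j\<in>UNIV. emeasure lborel ({0<..<1} \<inter> A' j))"
    by (subst product_nn_integral_prod) auto
  also have "\<dots> = (\<Prod>j\<in>UNIV. emeasure U01 (A' j))"
    unfolding U01_def
    by (intro prod.cong refl, subst emeasure_density) (simp_all add: indicator_inter_arith[symmetric])
  also have "\<dots> = (\<Prod>j\<in>J. emeasure U01 (A j))"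
    by (rule prod.mono_neutral_cong_right) (auto simp: A'_def emeasure_U01_UNIV)
  also have "\<dots> = emeasure (PiM UNIV (\<lambda>_::'n. U01)) (prod_emb UNIV (\<lambda>_. U01) J (Pi\<^sub>E J A))"
    using A by (intro emeasure_PiM_emb[symmetric] prob_space_U01) auto
  finally show "emeasure (PiM UNIV (\<lambda>_::'n. U01)) (prod_emb UNIV (\<lambda>_. U01) J (Pi\<^sub>E J A)) =
      emeasure ?D (prod_emb UNIV (\<lambda>_. U01) J (Pi\<^sub>E J A))" by (simp add: emb)
qed

lemma Ucube_open_cube:
  fixes g :: "real^'n \<Rightarrow> real"
  assumes g[measurable]: "g \<in> borel_measurable borel"
  shows "integrable Ucube (\<lambda>s. g (\<chi> j. s j)) \<longleftrightarrow> set_integrable lborel open_cube g"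
    "(\<integral>s. g (\<chi> j. s j) \<partial>Ucube) = (LINT u:open_cube|lborel. g u)"
proof -
  let ?P = "PiM UNIV (\<lambda>_::'n. lborel :: real measure)" and ?vec = "\<lambda>s. (\<chi> j. s j) :: real^'n"
  have m[measurable]: "?vec \<in> borel_measurable ?P" by (rule vec_lambda_measurable) simp
  have oc[measurable]: "(open_cube :: (real^'n) set) \<in> sets borel" by (rule borel_open[OF open_open_cube])
  have ind: "(\<Prod>j\<in>UNIV. indicator {0<..<1} (f j) :: ennreal) = ennreal (indicator open_cube (?vec f))" for f :: "'n \<Rightarrow> real"
    by (auto simp: indicator_def open_cube_def prod_zero_iff)
  have U: "Ucube = density ?P (\<lambda>f. ennreal (indicator open_cube (?vec f)))"
    unfolding Ucube_eq_density ind ..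
  have lb: "lborel = distr ?P borel ?vec" by (rule distr_PiM_lborel_vec[symmetric])
  have meas: "(\<lambda>u. indicator open_cube u *\<^sub>R g u) \<in> borel_measurable borel" by measurable
  have 1: "integrable lborel (\<lambda>u. indicator open_cube u *\<^sub>R g u) \<longleftrightarrow>
      integrable ?P (\<lambda>s. indicator open_cube (?vec s) *\<^sub>R g (?vec s))"
    by (subst lb) (rule integrable_distr_eq[OF m meas])
  show "integrable Ucube (\<lambda>s. g (?vec s)) \<longleftrightarrow> set_integrable lborel open_cube g"
    unfolding set_integrable_def 1 U by (subst integrable_density) auto
  have 2: "(\<integral>u. indicator open_cube u *\<^sub>R g u \<partial>lborel) =
      (\<integral>s. indicator open_cube (?vec s) *\<^sub>R g (?vec s) \<partial>?P)"
    by (subst lb) (rule integral_distr[OF m meas])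
  show "(\<integral>s. g (?vec s) \<partial>Ucube) = (LINT u:open_cube|lborel. g u)"
    unfolding set_lebesgue_integral_def 2 U by (subst integral_density) auto
qed

lemma distr_nested_uniform_scrambling:
  fixes X :: "'d::finite \<times> nat list \<Rightarrow> 'w \<Rightarrow> nat \<Rightarrow> nat"
  assumes X: "nested_uniform_scrambling b M X"
  shows "(\<lambda>\<omega>. \<lambda>i\<in>nodes b. X i \<omega>) \<in> measurable M (Perms b)"
    "distr M (Perms b) (\<lambda>\<omega>. \<lambda>i\<in>nodes b. X i \<omega>) = Perms b"
proof -
  let ?C = "count_space (digit_perms b)"
  interpret M: prob_space M using X by (simp add: nested_uniform_scrambling_def)
  have ind: "M.indep_vars (\<lambda>_. ?C) X (nodes b)"
    and unif: "\<And>i. i \<in> nodes b \<Longrightarrow> distr M ?C (X i) = uniform_count_measure (digit_perms b)"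
    using X unfolding nested_uniform_scrambling_def nodes_def by blast+
  have rv: "X i \<in> measurable M ?C" if "i \<in> nodes b" for i
    using ind that by (auto simp: M.indep_vars_def)
  have ne: "nodes b \<noteq> ({} :: ('d \<times> nat list) set)" by (auto simp: nodes_def)
  have sets: "sets (Perms b :: ('d \<times> nat list \<Rightarrow> nat \<Rightarrow> nat) measure) = sets (PiM (nodes b) (\<lambda>_. ?C))"
    unfolding Perms_def by (intro sets_PiM_cong) (auto simp: sets_uniform_count_measure)
  show "(\<lambda>\<omega>. \<lambda>i\<in>nodes b. X i \<omega>) \<in> measurable M (Perms b)"
    unfolding measurable_cong_sets[OF refl sets] by (rule measurable_restrict[OF rv])
  have "distr M (Perms b) (\<lambda>\<omega>. \<lambda>i\<in>nodes b. X i \<omega>) = distr M (PiM (nodes b) (\<lambda>_. ?C)) (\<lambda>\<omega>. \<lambda>i\<in>nodes b. X i \<omega>)"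
    by (rule distr_cong) (auto simp: sets)
  also have "\<dots> = PiM (nodes b) (\<lambda>i. distr M ?C (X i))"
    using M.indep_vars_iff_distr_eq_PiM'[OF ne rv] ind by simp
  also have "\<dots> = Perms b"
    unfolding Perms_def by (intro PiM_cong refl unif)
  finally show "distr M (Perms b) (\<lambda>\<omega>. \<lambda>i\<in>nodes b. X i \<omega>) = Perms b" .
qed

lemma scramble_restrict:
  assumes "b \<ge> 1"
  shows "scramble b (\<lambda>i\<in>nodes b. p i) y = scramble b p y"
proof -
  have "(j, map (digit b (y $ j)) [0..<k]) \<in> nodes b" for j k
    using digit_less[OF assms] by (auto simp: nodes_def)
  then show ?thesis unfolding scramble_def by simp
qed

lemma scramble_in_closed_cube:
  assumes b: "b \<ge> 2" and p: "p \<in> space (Perms b)"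
  shows "0 \<le> scramble b p y $ j" "scramble b p y $ j \<le> 1"
proof -
  have "(j, map (digit b (y $ j)) [0..<k]) \<in> nodes b" for k
    using digit_less[of b] b by (auto simp: nodes_def)
  then have "p (j, map (digit b (y $ j)) [0..<k]) (digit b (y $ j) k) < b" for k
    using digit_less[of b] b by (intro digit_perms_less[OF space_PermsD[OF p]]) auto
  from digit_series(2,3)[OF this b]
  show "0 \<le> scramble b p y $ j" "scramble b p y $ j \<le> 1" by (simp_all add: scramble_def)
qed

text \<open>Beyond the resolution of the net the level differences are of order \<open>n powr (- \<theta>)\<close>, and averaging over \<open>n\<close> points
  with boundedly many correlated partners gains \<open>n powr (- 1/2)\<close>.\<close>

lemma (in scrambled_net) mean_square_error_rate:
  assumes hg: "hoelder_growth C \<theta> \<gamma> h" and C: "C \<ge> 0" and \<theta>: "\<theta> \<ge> 0" and \<gamma>: "\<gamma> < 1 / 2"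
  defines "err \<equiv> \<lambda>p. (\<Sum>i<b ^ m. h (\<lambda>j. scramble b p (x i) $ j)) / real (b ^ m) - (\<integral>s. h s \<partial>Ucube)"
    and "A \<equiv> real (b ^ (t + CARD('d))) * (C\<^sup>2 * real b powr (2 * \<theta> * real (t + CARD('d))) *
      (4 ^ CARD('d) * (\<integral>s. (cube_edge \<gamma> s)\<^sup>2 \<partial>(Ucube :: ('d \<Rightarrow> real) measure))))"
  shows "(\<integral>p. (err p)\<^sup>2 \<partial>Perms b) \<le> A * (real (m + 2) ^ CARD('d) * real (b ^ m) powr (- 1 / 2 - \<theta>))\<^sup>2"
proof -
  let ?c = "4 ^ CARD('d) * (\<integral>s. (cube_edge \<gamma> s)\<^sup>2 \<partial>(Ucube :: ('d \<Rightarrow> real) measure))"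
  have c: "?c \<ge> 0" by (intro mult_nonneg_nonneg integral_nonneg_AE) auto
  have b1: "real b > 1" using b by simp
  define V where "V = C\<^sup>2 * real b powr (- 2 * \<theta> * (real m - real (t + CARD('d)))) * ?c"
  have V0: "V \<ge> 0" unfolding V_def using c by (intro mult_nonneg_nonneg) auto
  have V: "(\<integral>p. (detail \<kappa> p i)\<^sup>2 \<partial>Perms b) \<le> V"
    if \<kappa>: "\<kappa> \<in> levels (m + 1)" "m < (\<Sum>j\<in>UNIV. \<kappa> j) + t" for \<kappa> i
  proof -
    let ?q = "\<Sum>j\<in>UNIV. \<kappa> j - 1"
    have "(\<Sum>j\<in>UNIV. \<kappa> j) \<le> (\<Sum>j\<in>UNIV. (\<kappa> j - 1) + 1)" by (intro sum_mono) auto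
    also have "\<dots> = ?q + CARD('d)" by (subst sum.distrib) simp
    finally have q: "real m - real (t + CARD('d)) \<le> real ?q" using \<kappa>(2) by linarith
    have "(C * real b powr (- \<theta> * real ?q))\<^sup>2 = C\<^sup>2 * real b powr (- 2 * \<theta> * real ?q)"
      by (simp add: power_mult_distrib power2_eq_square powr_add[symmetric] mult.assoc del: of_nat_sum)
    also have "\<dots> \<le> C\<^sup>2 * real b powr (- 2 * \<theta> * (real m - real (t + CARD('d))))"
    proof (rule mult_left_mono, rule powr_mono)
      have "\<theta> * (real m - real (t + CARD('d))) \<le> \<theta> * real ?q" by (rule mult_left_mono[OF q \<theta>])
      then show "- 2 * \<theta> * real ?q \<le> - 2 * \<theta> * (real m - real (t + CARD('d)))" by linarith
    qed (use b1 in auto)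
    finally show ?thesis
      unfolding V_def
      by (intro order_trans[OF detail_second_moment[OF hg C \<theta> \<gamma> \<kappa>(1)]] mult_right_mono c)
  qed
  have "(\<integral>p. (err p)\<^sup>2 \<partial>Perms b) \<le>
      (real (m + 2) ^ CARD('d))\<^sup>2 * (real (b ^ (t + CARD('d))) * V / real (b ^ m))"
    unfolding err_def by (rule mean_square_error_le[OF V V0])
  also have "\<dots> = A * (real (m + 2) ^ CARD('d) * real (b ^ m) powr (- 1 / 2 - \<theta>))\<^sup>2"
  proof -
    have "(real (b ^ m) powr (- 1 / 2 - \<theta>))\<^sup>2 = real (b ^ m) powr (- 1 + - 2 * \<theta>)"
      by (simp add: power2_eq_square powr_add[symmetric])
    also have "\<dots> = real (b ^ m) powr (- 2 * \<theta>) / real (b ^ m)"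
      using b1 by (simp only: powr_add) (simp add: powr_minus field_simps)
    also have "real (b ^ m) powr (- 2 * \<theta>) = real b powr (- 2 * \<theta> * real m)"
      using b1 by (simp add: powr_realpow[symmetric] powr_powr mult_ac)
    finally have sq: "(real (b ^ m) powr (- 1 / 2 - \<theta>))\<^sup>2 = real b powr (- 2 * \<theta> * real m) / real (b ^ m)" .
    have "real b powr (- 2 * \<theta> * (real m - real (t + CARD('d)))) =
        real b powr (2 * \<theta> * real (t + CARD('d))) * real b powr (- 2 * \<theta> * real m)"
      by (simp add: powr_add[symmetric] algebra_simps)
    then show ?thesis unfolding power_mult_distrib sq A_def V_def by (simp add: mult_ac)
  qed
  finally show ?thesis .
qed

lemma polynomial_times_power_bound:
  assumes "b \<ge> 2" "\<delta> > 0"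
  obtains D where "D > 0" "\<And>m. real (m + 2) ^ d \<le> D * real (b ^ m) powr \<delta>"
proof -
  define a where "a = \<delta> * ln (real b)"
  have a: "a > 0" using assms by (simp add: a_def)
  have "(\<lambda>m. real (m + 2) ^ d * exp (- (a * real m))) \<longlonglongrightarrow> 0"
    using a by real_asymp
  then have "Bseq (\<lambda>m. real (m + 2) ^ d * exp (- (a * real m)))"
    by (intro convergent_imp_Bseq) (auto simp: convergent_def)
  then obtain D where D: "D > 0" "\<And>m. norm (real (m + 2) ^ d * exp (- (a * real m))) \<le> D"
    by (auto simp: Bseq_def)
  show thesis
  proof (rule that[OF D(1)])
    fix m
    have "real (b ^ m) powr \<delta> = exp (a * real m)"
      using assms by (simp add: powr_def a_def ln_realpow mult_ac)
    moreover have "real (m + 2) ^ d * exp (- (a * real m)) \<le> D" using D(2)[of m] by simp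
    ultimately show "real (m + 2) ^ d \<le> D * real (b ^ m) powr \<delta>"
      by (simp add: exp_minus field_simps)
  qed
qed

lemma hoelder_growth_cong:
  fixes h h1 :: "real^'d \<Rightarrow> real"
  assumes eq: "\<And>u. (\<And>j. 0 \<le> u $ j \<and> u $ j \<le> 1) \<Longrightarrow> h u = h1 u"
    and h: "hoelder_growth C \<theta> \<gamma> (\<lambda>s. h (\<chi> j. s j))"
  shows "hoelder_growth C \<theta> \<gamma> (\<lambda>s. h1 (\<chi> j. s j))"
  unfolding hoelder_growth_def
proof (intro allI impI)
  fix J :: "'d set" and y z x :: "'d \<Rightarrow> real"
  assume in01: "\<forall>i. y i \<in> {0<..<1} \<and> z i \<in> {0<..<1} \<and> x i \<in> {0<..<1}"
  have "alt J y z (\<lambda>s. h1 (\<chi> j. s j)) x = alt J y z (\<lambda>s. h (\<chi> j. s j)) x"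
    unfolding alt_def
    by (intro sum.cong refl arg_cong2[of _ _ _ _ "(*)"] eq[symmetric])
       (use in01 in \<open>auto simp: less_imp_le\<close>)
  then show "\<bar>alt J y z (\<lambda>s. h1 (\<chi> j. s j)) x\<bar> \<le>
      C * (\<Prod>j\<in>J. \<bar>y j - z j\<bar> powr \<theta> * (edge \<gamma> (y j) + edge \<gamma> (z j))) * (\<Prod>j\<in>- J. edge \<gamma> (x j))"
    using h in01 unfolding hoelder_growth_def by simp
qed

lemma hoelder_growth_square_integrable:
  fixes h1 :: "real^'d \<Rightarrow> real"
  assumes hg: "hoelder_growth C \<theta> \<gamma> (\<lambda>s. h1 (\<chi> j. s j))" and \<gamma>: "\<gamma> < 1 / 2" and h1: "h1 \<in> borel_measurable borel"
  shows "square_integrable Ucube (\<lambda>s. h1 (\<chi> j. s j))"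
proof -
  have "(\<lambda>s. (\<chi> j. s j) :: real^'d) \<in> borel_measurable Ucube"
    by (rule vec_lambda_measurable[OF measurable_component_Ucube])
  then have m[measurable]: "(\<lambda>s. h1 (\<chi> j. s j)) \<in> borel_measurable Ucube" using h1 by (rule measurable_compose)
  have "integrable Ucube (\<lambda>s. (h1 (\<chi> j. s j))\<^sup>2)"
  proof (rule Bochner_Integration.integrable_bound)
    show "integrable Ucube (\<lambda>s :: 'd \<Rightarrow> real. C\<^sup>2 * (cube_edge \<gamma> s)\<^sup>2)"
      using square_integrable_cube_edge[OF \<gamma>, where 'd = 'd] by (simp add: square_integrable_def)
    show "(\<lambda>s. (h1 (\<chi> j. s j))\<^sup>2) \<in> borel_measurable Ucube" by measurable
    show "AE s in Ucube. norm ((h1 (\<chi> j. s j))\<^sup>2) \<le> norm (C\<^sup>2 * (cube_edge \<gamma> s)\<^sup>2)"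
      using AE_Ucube
    proof eventually_elim
      case (elim s)
      have "\<forall>i. s i \<in> {0<..<1} \<and> s i \<in> {0<..<1} \<and> s i \<in> {0<..<1}" using elim by auto
      with hg[unfolded hoelder_growth_def, rule_format, of s s s "{}"]
      have "\<bar>h1 (\<chi> j. s j)\<bar> \<le> C * cube_edge \<gamma> s"
        by (simp add: cube_edge_def)
      then have "\<bar>h1 (\<chi> j. s j)\<bar>\<^sup>2 \<le> (C * cube_edge \<gamma> s)\<^sup>2" by (intro power_mono) auto
      then show ?case by (simp add: power_mult_distrib)
    qed
  qed
  with m show ?thesis by (simp add: square_integrable_def)
qed

text \<open>The estimator sees the permutations at the nodes only, whose joint law is that of the canonical model.
  Scrambled points lie in the closed cube and may hit its boundary, so \<open>h\<close> and its Borel version \<open>h1\<close> have to agree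
  on the closed cube.\<close>

lemma scrambled_net_error_transfer:
  fixes h h1 :: "real^'d \<Rightarrow> real" and X :: "'d \<times> nat list \<Rightarrow> 'w \<Rightarrow> nat \<Rightarrow> nat"
  assumes net: "scrambled_net b t m x (\<lambda>s. h1 (\<chi> j. s j))"
    and X: "nested_uniform_scrambling b M X"
    and h1: "h1 \<in> borel_measurable borel"
    and eq: "\<And>u. (\<And>j. 0 \<le> u $ j \<and> u $ j \<le> 1) \<Longrightarrow> h u = h1 u"
    and \<mu>: "\<mu> = (\<integral>s. h1 (\<chi> j. s j) \<partial>Ucube)"
  defines "e \<equiv> \<lambda>p. (\<Sum>i<b ^ m. h1 (\<chi> j. scramble b p (x i) $ j)) / real (b ^ m) - \<mu>"
  shows "integrable M (\<lambda>\<omega>. (net_estimator b m x X h \<omega> - \<mu>)\<^sup>2)"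
    "(\<integral>\<omega>. (net_estimator b m x X h \<omega> - \<mu>)\<^sup>2 \<partial>M) = (\<integral>p. (e p)\<^sup>2 \<partial>Perms b)"
proof -
  interpret scrambled_net b t m x "\<lambda>s. h1 (\<chi> j. s j)" by (rule net)
  define Z where "Z \<omega> = (\<lambda>i\<in>nodes b. X i \<omega>)" for \<omega>
  note D = distr_nested_uniform_scrambling[OF X, folded Z_def]
  have sq: "square_integrable (Perms b) e"
    unfolding e_def by (rule error_square_integrable)
  have est: "net_estimator b m x X h \<omega> - \<mu> = e (Z \<omega>)" if "\<omega> \<in> space M" for \<omega>
  proof -
    have "Z \<omega> \<in> space (Perms b)" using measurable_space[OF D(1) that] .
    note range = scramble_in_closed_cube[OF b this]
    have "h (scramble b (\<lambda>jw. X jw \<omega>) y) = h1 (\<chi> j. scramble b (Z \<omega>) y $ j)" for y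
    proof -
      have "scramble b (\<lambda>jw. X jw \<omega>) y = scramble b (Z \<omega>) y"
        unfolding Z_def using b by (intro scramble_restrict[symmetric]) simp
      then show ?thesis using eq[of "scramble b (Z \<omega>) y"] range by simp
    qed
    then show ?thesis by (simp add: net_estimator_def e_def)
  qed
  have em: "(\<lambda>p. (e p)\<^sup>2) \<in> borel_measurable (Perms b)" using sq by (auto simp: square_integrable_def)
  have "integrable M (\<lambda>\<omega>. (e (Z \<omega>))\<^sup>2)"
    using integrable_distr_eq[OF D(1) em] sq unfolding D(2) by (simp add: square_integrable_def)
  then show "integrable M (\<lambda>\<omega>. (net_estimator b m x X h \<omega> - \<mu>)\<^sup>2)"
    by (rule Bochner_Integration.integrable_cong[THEN iffD2, rotated -1]) (auto simp: est)
  have "(\<integral>\<omega>. (net_estimator b m x X h \<omega> - \<mu>)\<^sup>2 \<partial>M) = (\<integral>\<omega>. (e (Z \<omega>))\<^sup>2 \<partial>M)"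
    by (intro Bochner_Integration.integral_cong) (auto simp: est)
  also have "\<dots> = (\<integral>p. (e p)\<^sup>2 \<partial>Perms b)"
    using integral_distr[OF D(1) em] unfolding D(2) by simp
  finally show "(\<integral>\<omega>. (net_estimator b m x X h \<omega> - \<mu>)\<^sup>2 \<partial>M) = (\<integral>p. (e p)\<^sup>2 \<partial>Perms b)" .
qed

text \<open>Boundary growth holds for every exponent, so \<open>\<theta>\<close> may be taken arbitrarily close to \<open>1/2\<close>, which makes the rate
  \<open>n powr (- 1/2 - \<theta>)\<close> arbitrarily close to \<open>1 / n\<close>.\<close>

lemma scrambled_net_rate:
  fixes h h1 :: "real^'d::{finite,linorder} \<Rightarrow> real" and x :: "nat \<Rightarrow> nat \<Rightarrow> real^'d::{finite,linorder}"
    and X :: "nat \<Rightarrow> 'd \<times> nat list \<Rightarrow> 'w \<Rightarrow> nat \<Rightarrow> nat"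
  assumes h: "boundary_growth h" and h1: "h1 \<in> borel_measurable borel"
    and eq: "\<And>u. (\<And>j. 0 \<le> u $ j \<and> u $ j \<le> 1) \<Longrightarrow> h u = h1 u"
    and b: "b \<ge> 2" and net: "\<And>m. m \<ge> t \<Longrightarrow> tmd_net b t m (x m)"
    and X: "\<And>m. m \<ge> t \<Longrightarrow> nested_uniform_scrambling b (M m) (X m)"
    and \<mu>: "\<mu> = (\<integral>s. h1 (\<chi> j. s j) \<partial>Ucube)" and \<epsilon>: "\<epsilon> > 0"
  shows "m \<ge> t \<Longrightarrow> integrable (M m) (\<lambda>\<omega>. (net_estimator b m (x m) (X m) h \<omega> - \<mu>)\<^sup>2)"
    "(\<lambda>m. sqrt (\<integral>\<omega>. (net_estimator b m (x m) (X m) h \<omega> - \<mu>)\<^sup>2 \<partial>M m))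
      \<in> O(\<lambda>m. real (b ^ m) powr (- 1 + \<epsilon>))"
proof -
  \<comment> \<open>at most half of the slack \<open>\<epsilon>\<close> is spent on \<open>\<theta> < 1/2\<close>, the rest on the powers of \<open>m\<close>\<close>
  define \<delta> where "\<delta> = min (\<epsilon> / 2) (1 / 4)"
  have \<delta>: "0 < \<delta>" "\<delta> \<le> 1 / 4" "\<delta> \<le> \<epsilon> / 2" using \<epsilon> by (auto simp: \<delta>_def)
  define \<theta> where "\<theta> = 1 / 2 - \<delta>"
  define \<gamma> where "\<gamma> = \<delta> / 2 + \<theta>"
  have \<theta>: "0 < \<theta>" "\<theta> \<le> 1" and \<gamma>: "\<gamma> < 1 / 2" using \<delta> by (auto simp: \<theta>_def \<gamma>_def)
  obtain C where C: "C > 0" and "hoelder_growth C \<theta> \<gamma> (\<lambda>s. h (\<chi> j. s j))"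
    using boundary_growth_imp_hoelder_growth[OF h _ \<theta>, of "\<delta> / 2"] \<delta> unfolding \<gamma>_def by auto
  then have hg: "hoelder_growth C \<theta> \<gamma> (\<lambda>s. h1 (\<chi> j. s j))"
    by (intro hoelder_growth_cong[where h = h, OF eq])
  have sn: "scrambled_net b t m (x m) (\<lambda>s. h1 (\<chi> j. s j))" if "m \<ge> t" for m
    using b that net[OF that] hoelder_growth_square_integrable[OF hg \<gamma> h1] by unfold_locales
  note tr = scrambled_net_error_transfer[OF sn X h1 eq \<mu>]
  show "integrable (M m) (\<lambda>\<omega>. (net_estimator b m (x m) (X m) h \<omega> - \<mu>)\<^sup>2)" if "m \<ge> t" for m
    using tr(1) that by simp
  define A where "A = real (b ^ (t + CARD('d))) * (C\<^sup>2 * real b powr (2 * \<theta> * real (t + CARD('d))) *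
      (4 ^ CARD('d) * (\<integral>s. (cube_edge \<gamma> s)\<^sup>2 \<partial>(Ucube :: ('d \<Rightarrow> real) measure))))"
  have A: "A \<ge> 0" unfolding A_def by (intro mult_nonneg_nonneg integral_nonneg_AE) auto
  obtain D where D: "D > 0" "\<And>m. real (m + 2) ^ CARD('d) \<le> D * real (b ^ m) powr (\<epsilon> - \<delta>)"
    using polynomial_times_power_bound[of b "\<epsilon> - \<delta>" "CARD('d)"] b \<delta> \<epsilon> by (auto simp: field_simps)
  have main: "sqrt (\<integral>\<omega>. (net_estimator b m (x m) (X m) h \<omega> - \<mu>)\<^sup>2 \<partial>M m) \<le> sqrt A * D * real (b ^ m) powr (- 1 + \<epsilon>)"
    if m: "m \<ge> t" for m
  proof -
    let ?r = "real (m + 2) ^ CARD('d) * real (b ^ m) powr (- 1 / 2 - \<theta>)"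
    note tr(2)[OF m m]
    also have "(\<integral>p. ((\<Sum>i<b ^ m. h1 (\<chi> j. scramble b p (x m i) $ j)) / real (b ^ m) - \<mu>)\<^sup>2 \<partial>Perms b) \<le> A * ?r\<^sup>2"
      unfolding \<mu> A_def
      by (rule scrambled_net.mean_square_error_rate[OF sn[OF m] hg]) (use C \<theta> \<gamma> in auto)
    finally have "sqrt (\<integral>\<omega>. (net_estimator b m (x m) (X m) h \<omega> - \<mu>)\<^sup>2 \<partial>M m) \<le> sqrt (A * ?r\<^sup>2)"
      by (rule real_sqrt_le_mono)
    also have "\<dots> = sqrt A * ?r" by (simp add: real_sqrt_mult)
    also have "\<dots> \<le> sqrt A * (D * real (b ^ m) powr (\<epsilon> - \<delta>) * real (b ^ m) powr (- 1 / 2 - \<theta>))"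
      using A by (intro mult_left_mono mult_right_mono D(2)) auto
    also have "\<dots> = sqrt A * D * real (b ^ m) powr ((\<epsilon> - \<delta>) + (- 1 / 2 - \<theta>))"
      by (simp only: powr_add mult.assoc)
    also have "(\<epsilon> - \<delta>) + (- 1 / 2 - \<theta>) = - 1 + \<epsilon>" by (simp add: \<theta>_def)
    finally show ?thesis .
  qed
  show "(\<lambda>m. sqrt (\<integral>\<omega>. (net_estimator b m (x m) (X m) h \<omega> - \<mu>)\<^sup>2 \<partial>M m))
      \<in> O(\<lambda>m. real (b ^ m) powr (- 1 + \<epsilon>))"
  proof (rule bigoI[of _ "sqrt A * D"])
    show "\<forall>\<^sub>F m in at_top. norm (sqrt (\<integral>\<omega>. (net_estimator b m (x m) (X m) h \<omega> - \<mu>)\<^sup>2 \<partial>M m)) \<le>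
        sqrt A * D * norm (real (b ^ m) powr (- 1 + \<epsilon>))"
      using eventually_ge_at_top[of t]
    proof eventually_elim
      case (elim m)
      have "0 \<le> (\<integral>\<omega>. (net_estimator b m (x m) (X m) h \<omega> - \<mu>)\<^sup>2 \<partial>M m)" by (rule integral_nonneg_AE) simp
      then show ?case using main[OF elim] by simp
    qed
  qed
qed

lemma borel_measurable_flow:
  fixes f :: "real^'d \<Rightarrow> real"
  assumes G: "G \<in> borel_measurable borel" and f: "continuous_on UNIV f"
    and T: "\<And>k i. k \<in> {1..K} \<Longrightarrow> continuous_on UNIV (T k i)"
  shows "f \<circ> flow G L T K \<in> borel_measurable borel"
proof -
  have "k \<le> K \<Longrightarrow> continuous_on UNIV (layers L T k)" for k
  proof (induction k)
    case (Suc k)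
    have "continuous_on UNIV (layer (L (Suc k)) (T (Suc k)))"
      unfolding layer_def using Suc.prems
      by (intro continuous_on_vec_lambda continuous_on_compose2[OF T])
         (auto simp: matrix_vector_mult_def intro!: continuous_intros)
    from continuous_on_compose2[OF this Suc.IH[OF Suc_leD[OF Suc.prems]] subset_UNIV]
    show ?case by (simp add: o_def)
  qed (auto simp: id_def)
  then have "continuous_on UNIV (f \<circ> layers L T K)"
    using f by (intro continuous_on_compose) (auto intro: continuous_on_subset)
  then have 1: "f \<circ> layers L T K \<in> borel_measurable borel" by (rule borel_measurable_continuous_onI)
  have "(\<lambda>u :: real^'d. G (u $ j)) \<in> borel_measurable borel" for j
    by (rule measurable_compose[OF _ G]) (intro borel_measurable_continuous_onI continuous_intros)
  then have "(\<lambda>u :: real^'d. (\<chi> j. G (u $ j)) :: real^'d) \<in> borel_measurable borel"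
    by (rule vec_lambda_measurable)
  from measurable_compose[OF this 1] show ?thesis by (simp add: flow_def o_def)
qed

theorem mainTheorem1:
  fixes G F :: "real \<Rightarrow> real"
    and K :: nat
    and L :: "nat \<Rightarrow> real^'d::{finite,linorder}^'d::{finite,linorder}"
    and T :: "nat \<Rightarrow> 'd \<Rightarrow> real \<Rightarrow> real"
    and f h :: "real^'d::{finite,linorder} \<Rightarrow> real"
  assumes K: "K \<ge> 1"
    and G_diffeo: "increasing_diffeo_on {0<..<1} G"
    and F_def: "F = the_inv_into {0<..<1} G"
    and G_growth: "\<And>B. B > 0 \<Longrightarrow> \<exists>C>0. \<forall>u\<in>{0<..<1}.
          \<bar>G u\<bar> \<le> C * min u (1 - u) powr (- B) \<and>
          \<bar>deriv G u\<bar> \<le> C * min u (1 - u) powr (- 1 - B)"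
    and F_log_concave: "concave_on UNIV (\<lambda>x. ln (F x))"
    and F_symmetric: "\<And>x. F x + F (- x) = 1"
    and L_lower: "\<And>k i j. k \<in> {1..K} \<Longrightarrow> i < j \<Longrightarrow> L k $ i $ j = 0"
    and L_diag: "\<And>k i. k \<in> {1..K} \<Longrightarrow> L k $ i $ i > 0"
    and L_rows: "\<And>k i. k \<in> {1..K} \<Longrightarrow> (\<Sum>j\<in>UNIV. \<bar>L k $ i $ j\<bar>) = 1"
    and T_diffeo: "\<And>k i. k \<in> {1..K} \<Longrightarrow> increasing_diffeo_on UNIV (T k i)"
    and T_cont_derivs: "\<And>k i. k \<in> {1..K} \<Longrightarrow> cont_derivs CARD('d) (T k i)"
    and T_growth: "\<And>k i B. k \<in> {1..K} \<Longrightarrow> B > 0 \<Longrightarrow> \<exists>C. \<forall>m\<le>CARD('d). \<forall>z.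
          \<bar>(deriv ^^ m) (T k i) z\<bar> \<le> C * min (F z) (1 - F z) powr (- B)"
    and T_tail: "\<And>k i. k \<in> {1..K} \<Longrightarrow> \<exists>B\<^sub>1>0. \<exists>C\<^sub>1>0. \<forall>z.
          inverse (min (F z) (1 - F z)) \<le>
            C\<^sub>1 * min (F (inv (T k i) z)) (1 - F (inv (T k i) z)) powr (- B\<^sub>1)"
    and f_cont_partials: "cont_partials CARD('d) f"
    and f_growth: "\<And>l B. (\<Sum>j\<in>UNIV. l j) \<le> CARD('d) \<Longrightarrow> B > 0 \<Longrightarrow> \<exists>C>0. \<forall>x.
          \<bar>multi_partial l f x\<bar> \<le> C * (\<Prod>j\<in>UNIV. min (F (x $ j)) (1 - F (x $ j)) powr (- B))"
    and h_def: "h = f \<circ> flow G L T K"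
  shows "boundary_growth h \<and>
    set_integrable lborel open_cube h \<and>
    (\<forall>b t. \<forall>x :: nat \<Rightarrow> nat \<Rightarrow> real^'d::{finite,linorder}. \<forall>M :: nat \<Rightarrow> 'w measure.
      \<forall>X :: nat \<Rightarrow> 'd \<times> nat list \<Rightarrow> 'w \<Rightarrow> nat \<Rightarrow> nat.
      b \<ge> 2 \<longrightarrow>
      (\<forall>m\<ge>t. tmd_net b t m (x m) \<and> nested_uniform_scrambling b (M m) (X m)) \<longrightarrow>
      (let \<mu> = (LINT u:open_cube|lborel. h u);
           err = (\<lambda>m \<omega>. net_estimator b m (x m) (X m) h \<omega> - \<mu>)
       in (\<forall>m\<ge>t. integrable (M m) (\<lambda>\<omega>. (err m \<omega>)\<^sup>2)) \<and>
          (\<forall>\<epsilon>>0. (\<lambda>m. sqrt (\<integral>\<omega>. (err m \<omega>)\<^sup>2 \<partial>M m))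
                    \<in> O(\<lambda>m. real (b ^ m) powr (- 1 + \<epsilon>)))))"
proof -
  have bg: "boundary_growth h"
    unfolding h_def
    by (rule boundary_growth_flow[OF G_diffeo F_def _ F_log_concave F_symmetric L_rows T_diffeo T_cont_derivs
          T_growth T_tail f_cont_partials f_growth]) (use G_growth in blast)
  \<comment> \<open>a Borel function that agrees with \<open>G\<close> on the closed interval, whatever the values of \<open>G\<close> outside are\<close>
  define G1 where "G1 u = (if u \<in> {0<..<1} then G u else if u = 0 then G 0 else G 1)" for u
  have "continuous_on {0<..<1} G"
    using G_diffeo
    by (auto simp: increasing_diffeo_on_def intro!: continuous_at_imp_continuous_on field_differentiable_imp_continuous_at)
  then have "(\<lambda>u. indicator {0<..<1} u *\<^sub>R G u) \<in> borel_measurable borel"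
    by (intro borel_measurable_continuous_on_indicator) auto
  moreover have "G1 = (\<lambda>u. indicator {0<..<1} u *\<^sub>R G u + indicator {0} u * G 0 + indicator (- ({0<..<1} \<union> {0})) u * G 1)"
    by (auto simp: G1_def indicator_def)
  ultimately have G1: "G1 \<in> borel_measurable borel" by simp
  define h1 where "h1 = f \<circ> flow G1 L T K"
  have T_cont: "continuous_on UNIV (T k i)" if "k \<in> {1..K}" for k i
    using T_cont_derivs[OF that, of i] by (auto simp: cont_derivs_def dest: spec[of _ 0])
  have "continuous_on UNIV f" using cont_partialsD(2)[OF f_cont_partials, of "[]"] by simp
  from borel_measurable_flow[where K = K and L = L, OF G1 this T_cont]
  have h1: "h1 \<in> borel_measurable borel" by (simp add: h1_def)
  have eq: "h u = h1 u" if "\<And>j. 0 \<le> u $ j \<and> u $ j \<le> 1" for u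
  proof -
    have "G (u $ j) = G1 (u $ j)" for j using that[of j] by (auto simp: G1_def)
    then show ?thesis by (simp add: h_def h1_def flow_def)
  qed
  have eq': "indicator open_cube u *\<^sub>R h u = indicator open_cube u *\<^sub>R h1 u" for u
  proof (cases "u \<in> open_cube")
    case True
    then have "0 \<le> u $ j \<and> u $ j \<le> 1" for j by (auto simp: open_cube_def less_imp_le)
    then show ?thesis by (simp add: eq)
  qed simp
  have \<mu>: "(LINT u:open_cube|lborel. h u) = (\<integral>s. h1 (\<chi> j. s j) \<partial>Ucube)"
    unfolding Ucube_open_cube(2)[OF h1] set_lebesgue_integral_def eq' ..
  obtain C where "hoelder_growth C (1 / 4) (3 / 8) (\<lambda>s. h (\<chi> j. s j))"
    using boundary_growth_imp_hoelder_growth[OF bg, of "1 / 8" "1 / 4"] by auto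
  then have hg: "hoelder_growth C (1 / 4) (3 / 8) (\<lambda>s. h1 (\<chi> j. s j))"
    by (intro hoelder_growth_cong[where h = h, OF eq])
  interpret C: prob_space "Ucube :: ('d \<Rightarrow> real) measure" by (rule prob_space_Ucube)
  have "integrable Ucube (\<lambda>s. h1 (\<chi> j. s j))"
    by (rule C.square_integrable_imp_integrable[OF hoelder_growth_square_integrable[OF hg _ h1]]) simp
  then have int: "set_integrable lborel open_cube h"
    unfolding Ucube_open_cube(1)[OF h1] set_integrable_def eq' .
  show ?thesis
    unfolding Let_def
  proof (intro conjI allI impI bg int)
    fix b t :: nat and x :: "nat \<Rightarrow> nat \<Rightarrow> (real, 'd) vec" and M :: "nat \<Rightarrow> 'w measure"
      and X :: "nat \<Rightarrow> 'd \<times> nat list \<Rightarrow> 'w \<Rightarrow> nat \<Rightarrow> nat"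
    assume b: "2 \<le> b" and *: "\<forall>m\<ge>t. tmd_net b t m (x m) \<and> nested_uniform_scrambling b (M m) (X m)"
    note rate = scrambled_net_rate[OF bg h1 eq b _ _ \<mu>, of t x M X]
    show "integrable (M m) (\<lambda>\<omega>. (net_estimator b m (x m) (X m) h \<omega> - (LINT u:open_cube|lborel. h u))\<^sup>2)" if "t \<le> m" for m
      using rate(1)[of 1 m] * that by auto
    show "(\<lambda>m. sqrt (\<integral>\<omega>. (net_estimator b m (x m) (X m) h \<omega> - (LINT u:open_cube|lborel. h u))\<^sup>2 \<partial>M m))
        \<in> O(\<lambda>m. real (b ^ m) powr (- 1 + \<epsilon>))" if "\<epsilon> > 0" for \<epsilon>
      using rate(2)[of \<epsilon>] * that by auto
  qed
qed

end
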